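(* Assume $1<s=|\chi(a)|<|\chi|=\bar s<\infty$ and write $\bar s=ss'$. Let $\xi\in k$ be a root of unity of order $s'$. Let $n,t\ge1$, $\sigma,\lambda\in\hat G$, $\alpha,\beta\in k^\times$; choose $\theta,\eta\in k$ with $\theta^{s'}=\alpha$, $\eta^{s'}=\beta$, and for $1\le j\le s'$ put $\alpha_j=(\theta\lambda(a)^s+\eta\xi^{j-1})^{s'}$. Then: (1) if $\beta+(-1)^{s'+1}\alpha\lambda(a)^{\bar s}\ne0$, then $$V_n(\sigma,\alpha)\otimes V_t(\lambda,\beta)\cong\bigoplus_{i=1}^{\min\{n,t\}}\bigoplus_{j=1}^{s'}s\,V_{2i-1+|n-t|}(\sigma\lambda,\alpha_j);$$ (2) if $\beta+(-1)^{s'+1}\alpha\lambda(a)^{\bar s}=0$, then there is a unique $j_0$ with $1\le j_0\le s'$ and $\alpha_{j_0}=0$, and $$V_n(\sigma,\alpha)\otimes V_t(\lambda,\beta)\cong\Big(\bigoplus_{i=1}^{\min\{n,t\}}\bigoplus_{1\le j\le s',j\ne j_0}s\,V_{2i-1+|n-t|}(\sigma\lambda,\alpha_j)\Big)\oplus\Big(\bigoplus_{i=1}^{\min\{n,t\}}\bigoplus_{j=0}^{\bar s-1}V_{(2i-1+|n-t|)s}(\chi^j\sigma\lambda)\Big).$$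
   Context: Let $k$ be an algebraically closed field of characteristic zero, $G$ a group, $a$ a central element of $G$, $\hat G$ the group of characters $G\to k^\times$, and $\chi\in\hat G$ with $\chi(a)\ne1$. $H=kG(\chi^{-1},a,0)$ is the Hopf algebra generated by the group $G$ and $x$ with $xg=\chi^{-1}(g)gx$ ($g\in G$), $\Delta(g)=g\otimes g$, $\Delta(x)=x\otimes a+1\otimes x$; tensor products of $H$-modules: $g(m\otimes n)=gm\otimes gn$, $x(m\otimes n)=xm\otimes an+m\otimes xn$. For $\lambda\in\hat G$, $t\ge1$, $V_t(\lambda)$ has basis $m_0,\dots,m_{t-1}$ with $gm_i=\chi^i(g)\lambda(g)m_i$, $xm_i=m_{i+1}$ ($i\le t-2$), $xm_{t-1}=0$. With $|\chi|=\bar s$, for $\lambda\in\hat G$, $\beta\in k$, $t\ge1$, $V_t(\lambda,\beta)$ has basis $m_0,\dots,m_{t\bar s-1}$ with $gm_i=\chi^i(g)\lambda(g)m_i$, $xm_i=m_{i+1}$ ($i\le t\bar s-2$), $xm_{t\bar s-1}=\sum_{j=0}^{t-1}\alpha_jm_{j\bar s}$ where $(Y-\beta)^t=Y^t-\sum_{j=0}^{t-1}\alpha_jY^j$. $rM$ denotes the direct sum of $r$ copies of $M$. *)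

theory Defs
  imports "HOL-Algebra.Group" "Jordan_Normal_Form.Matrix" "HOL-Computational_Algebra.Polynomial"
begin

text \<open>Finite-dimensional modules over H = kG(chi^-1,a,0), given by the matrices of
  the group elements (on carrier G) and of x, w.r.t. a chosen basis.
  The dimension is the size of the matrix of x.\<close>
type_synonym ('g,'k) hrep = "('g \<Rightarrow> 'k mat) \<times> 'k mat"

definition hdim :: "('g,'k) hrep \<Rightarrow> nat" where
  "hdim M = dim_row (snd M)"

definition hiso :: "('g,'b) monoid_scheme \<Rightarrow> ('g,'k::field) hrep \<Rightarrow> ('g,'k) hrep \<Rightarrow> bool" where
  "hiso G M N \<longleftrightarrow> hdim M = hdim N \<and>
     (\<exists>P. P \<in> carrier_mat (hdim N) (hdim M) \<and> invertible_mat P \<and>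
          (\<forall>g\<in>carrier G. P * fst M g = fst N g * P) \<and> P * snd M = snd N * P)"

text \<open>Kronecker product; basis m_i \<otimes> n_j has index i * dim N + j.\<close>
definition kron :: "'k::semiring_1 mat \<Rightarrow> 'k mat \<Rightarrow> 'k mat" where
  "kron A B = mat (dim_row A * dim_row B) (dim_col A * dim_col B)
     (\<lambda>(i,j). A $$ (i div dim_row B, j div dim_col B) * B $$ (i mod dim_row B, j mod dim_col B))"

text \<open>Tensor product of H-modules via Delta(g) = g\<otimes>g, Delta(x) = x\<otimes>a + 1\<otimes>x.\<close>
definition htensor :: "'g \<Rightarrow> ('g,'k::field) hrep \<Rightarrow> ('g,'k) hrep \<Rightarrow> ('g,'k) hrep" where
  "htensor a M N = ((\<lambda>g. kron (fst M g) (fst N g)),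
      kron (snd M) (fst N a) + kron (1\<^sub>m (hdim M)) (snd N))"

definition hdsum :: "('g,'k::field) hrep \<Rightarrow> ('g,'k) hrep \<Rightarrow> ('g,'k) hrep" where
  "hdsum M N = ((\<lambda>g. four_block_mat (fst M g) (0\<^sub>m (hdim M) (hdim N)) (0\<^sub>m (hdim N) (hdim M)) (fst N g)),
      four_block_mat (snd M) (0\<^sub>m (hdim M) (hdim N)) (0\<^sub>m (hdim N) (hdim M)) (snd N))"

definition hzero :: "('g,'k::field) hrep" where
  "hzero = ((\<lambda>g. 0\<^sub>m 0 0), 0\<^sub>m 0 0)"

definition hdsums :: "('g,'k::field) hrep list \<Rightarrow> ('g,'k) hrep" where
  "hdsums Ms = foldr hdsum Ms hzero"

definition character :: "('g,'b) monoid_scheme \<Rightarrow> ('g \<Rightarrow> 'k::field) \<Rightarrow> bool" where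
  "character G f \<longleftrightarrow> (\<forall>g\<in>carrier G. f g \<noteq> 0) \<and>
     (\<forall>g\<in>carrier G. \<forall>h\<in>carrier G. f (g \<otimes>\<^bsub>G\<^esub> h) = f g * f h)"

definition char_order :: "('g,'b) monoid_scheme \<Rightarrow> ('g \<Rightarrow> 'k::field) \<Rightarrow> nat" where
  "char_order G f = (if \<exists>n>0. \<forall>g\<in>carrier G. f g ^ n = 1
      then LEAST n. n > 0 \<and> (\<forall>g\<in>carrier G. f g ^ n = 1) else 0)"

definition elem_order :: "'k::field \<Rightarrow> nat" where
  "elem_order x = (if \<exists>n>0. x ^ n = 1 then LEAST n. n > 0 \<and> x ^ n = 1 else 0)"

text \<open>The module V_t(lambda): g m_i = chi^i(g) lambda(g) m_i, x m_i = m_{i+1}, x m_{t-1} = 0.\<close>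
definition Vmod :: "('g \<Rightarrow> 'k::field) \<Rightarrow> nat \<Rightarrow> ('g \<Rightarrow> 'k) \<Rightarrow> ('g,'k) hrep" where
  "Vmod chi t lam = ((\<lambda>g. mat t t (\<lambda>(i,j). if i = j then chi g ^ i * lam g else 0)),
      mat t t (\<lambda>(i,j). if i = j + 1 then 1 else 0))"

text \<open>The coefficients alpha_j with (Y - beta)^t = Y^t - sum_{j<t} alpha_j Y^j.\<close>
definition Vcoeff :: "nat \<Rightarrow> 'k::field \<Rightarrow> nat \<Rightarrow> 'k" where
  "Vcoeff t beta j = - coeff ([:- beta, 1:] ^ t) j"

text \<open>The module V_t(lambda,beta) of dimension t * sbar, sbar = |chi|.\<close>
definition Vmod2 :: "('g \<Rightarrow> 'k::field) \<Rightarrow> nat \<Rightarrow> nat \<Rightarrow> ('g \<Rightarrow> 'k) \<Rightarrow> 'k \<Rightarrow> ('g,'k) hrep" where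
  "Vmod2 chi sbar t lam beta = ((\<lambda>g. mat (t * sbar) (t * sbar)
        (\<lambda>(i,j). if i = j then chi g ^ i * lam g else 0)),
      mat (t * sbar) (t * sbar) (\<lambda>(i,j).
        (if i = j + 1 then 1 else 0) +
        (if j = t * sbar - 1 \<and> sbar dvd i then Vcoeff t beta (i div sbar) else 0)))"

end

theory Submission
  imports Defs "HOL-Library.Nat_Bijection"
begin

text \<open>
  Let \<open>u = x^s\<close> on the first factor, \<open>v = x^s\<close> on the second and \<open>c = lam(a)^s\<close>. Since \<open>x \<otimes> a\<close> and
  \<open>1 \<otimes> x\<close> commute up to the primitive \<open>s\<close>-th root of unity \<open>chi a\<close>, the q-binomial theorem gives
  \<open>X^s = c u + v\<close> on the tensor product. In suitable bases \<open>u = theta (1 + \<epsilon>) T\<close> and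
  \<open>v = eta (1 + \<delta>) T'\<close>, with \<open>\<epsilon>^n = 0\<close>, \<open>\<delta>^t = 0\<close> and \<open>T\<close>, \<open>T'\<close> cyclic shifts of order \<open>s'\<close>. On the
  \<open>xi^k\<close>-eigenspace of \<open>T'/T\<close> this reads \<open>X^s = T (kappa + L)\<close> with \<open>kappa = c theta + eta xi^k\<close> and
  \<open>L = c theta \<epsilon> + eta xi^k \<delta>\<close>. By the Clebsch-Gordan rule for \<open>sl2\<close>, \<open>L\<close> has Jordan blocks of sizes
  \<open>2 i - 1 + |n - t|\<close>. A generator of such a block generates a module \<open>V_d(sigma lam, kappa^s')\<close> under
  \<open>X\<close> if \<open>kappa \<noteq> 0\<close>, and a module \<open>V_(d s)\<close> for each starting weight if \<open>kappa = 0\<close>.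
  It remains to check that the submodules obtained span the tensor product, and to count dimensions.
\<close>

section \<open>Sequences of vectors combined along polynomials\<close>

text \<open>Writing x^s on a factor as theta (1 + \<epsilon>) T, instead of putting x^sbar into
  Jordan form, decides the shape of the proof: X^s is a sum of the two s-th powers, so its nilpotent
  part L is linear in \<epsilon> and \<delta>, without higher or mixed terms. A rescaling of the two
  variables turns L into x + y on k[x,y]/(x^n, y^t), the raising operator of sl2. In return the
  given modules have to be recovered from the model. This works because in characteristic zero (1 +
  \<epsilon>)^s' - 1 is \<epsilon> times a unit. In the same way (kappa + L)^s' - kappa^s' is L
  times a unit when kappa \<noteq> 0.

  The two cases of the theorem differ in what can be done with weights. For kappa \<noteq> 0 a power
  of X moves a generator to weight 0 without losing anything, so the s starting weights p < s give s
  copies of one module. For kappa = 0 the operator X is nilpotent on the block, no such move exists,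
  and every weight modulo sbar contributes a module of its own.\<close>

locale vspace = vector_space scale
  for scale :: "'k::field_char_0 \<Rightarrow> 'v::ab_group_add \<Rightarrow> 'v"
begin

lemma linear_funpow:
  assumes "Vector_Spaces.linear scale scale X"
  shows "Vector_Spaces.linear scale scale (X ^^ k)"
proof (induction k)
  case 0
  then show ?case by (simp add: Vector_Spaces.linear_iff vector_space_axioms)
next
  case (Suc k)
  with assms show ?case by (simp add: Vector_Spaces.linear_iff)
qed

lemma funpow_in_closed:
  assumes "\<And>v. v \<in> S \<Longrightarrow> X v \<in> S" and "v \<in> S"
  shows "(X ^^ k) v \<in> S"
  using assms by (induction k) auto

lemma linear_span_closed:
  assumes "Vector_Spaces.linear scale scale X" and "\<And>b. b \<in> B \<Longrightarrow> X b \<in> span B" and "v \<in> span B"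
  shows "X v \<in> span B"
  using assms(3)
proof (induction rule: span_induct_alt)
  case base
  then show ?case using assms(1) by (simp add: module_hom.zero Vector_Spaces.linear_iff_module_hom span_zero)
next
  case (step c x y)
  then show ?case using assms(1,2)
    by (simp add: Vector_Spaces.linear_iff span_add span_scale)
qed

text \<open>For e i = Y^i w this is f(Y) w. A family of vectors replaces the operator Y because the
  nilpotent part of the operators below is given only as a shift of indices.\<close>

definition pcomb :: "(nat \<Rightarrow> 'v) \<Rightarrow> 'k poly \<Rightarrow> 'v" where
  "pcomb e f = (\<Sum>i\<le>degree f. scale (coeff f i) (e i))"

lemma pcomb_altdef:
  assumes "degree f \<le> N"
  shows "pcomb e f = (\<Sum>i\<le>N. scale (coeff f i) (e i))"
  unfolding pcomb_def
  by (rule sum.mono_neutral_left) (use assms in \<open>auto simp: coeff_eq_0\<close>)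

lemma pcomb_0 [simp]: "pcomb e 0 = 0"
  by (simp add: pcomb_def)

lemma pcomb_add: "pcomb e (f + g) = pcomb e f + pcomb e g"
proof -
  let ?N = "max (degree f) (degree g)"
  have "degree (f + g) \<le> ?N" by (rule degree_add_le) auto
  then show ?thesis
    by (simp add: pcomb_altdef[of _ ?N] scale_left_distrib sum.distrib)
qed

lemma pcomb_smult: "pcomb e (smult c f) = scale c (pcomb e f)"
  by (simp add: pcomb_altdef[of _ "degree f"] scale_sum_right)

lemma pcomb_monom: "pcomb e (monom c k) = scale c (e k)"
proof -
  have "pcomb e (monom c k) = (\<Sum>i\<le>k. if i = k then scale c (e i) else 0)"
    unfolding pcomb_altdef[OF degree_monom_le] by (rule sum.cong) auto
  then show ?thesis by simp
qed

lemma pcomb_pCons: "pcomb e (pCons c f) = scale c (e 0) + pcomb (\<lambda>i. e (Suc i)) f"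
proof -
  have "degree (pCons c f) \<le> Suc (degree f)" by (rule degree_pCons_le)
  then show ?thesis
    by (simp add: pcomb_altdef[of _ "Suc (degree f)"] sum.atMost_Suc_shift pcomb_def del: sum.atMost_Suc)
qed

lemma pcomb_linear_factor:
  "pcomb e ([:c, 1:] * f) = scale c (pcomb e f) + pcomb (\<lambda>i. e (Suc i)) f"
proof -
  have "pcomb e ([:c, 1:] * f) = pcomb e (smult c f + pCons 0 f)" by simp
  also have "\<dots> = scale c (pcomb e f) + pcomb (\<lambda>i. e (Suc i)) f"
    by (simp only: pcomb_add pcomb_smult pcomb_pCons) simp
  finally show ?thesis .
qed

lemma pcomb_linear:
  assumes "Vector_Spaces.linear scale scale X"
  shows "X (pcomb e f) = pcomb (\<lambda>i. X (e i)) f"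
  using assms unfolding pcomb_def
  by (simp add: module_hom.sum module_hom.scale Vector_Spaces.linear_iff_module_hom)

lemma pcomb_in_subspace:
  assumes "subspace S" and "\<And>i. e i \<in> S"
  shows "pcomb e f \<in> S"
  unfolding pcomb_def using assms by (intro subspace_sum subspace_scale) auto

text \<open>A family that stops at d models Y^d w = 0, so multiples of Y^d act as zero.\<close>

lemma pcomb_monom_mult_eq_0:
  assumes "\<And>i. i \<ge> d \<Longrightarrow> e i = 0"
  shows "pcomb e (monom 1 d * f) = 0"
  unfolding pcomb_def by (intro sum.neutral) (auto simp: coeff_monom_mult assms)

text \<open>Downward induction: the lowest nonvanishing coefficients make the system triangular.\<close>

lemma pcomb_triangular:
  assumes S: "subspace S" and e0: "\<And>i. i \<ge> d \<Longrightarrow> e i = 0"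
    and F: "\<And>k. pcomb e (monom 1 k * F k) \<in> S" and F0: "\<And>k. coeff (F k) 0 \<noteq> 0"
  shows "e k \<in> S"
proof (induction "d - k" arbitrary: k rule: less_induct)
  case less
  show ?case
  proof (cases "k \<ge> d")
    case True
    then show ?thesis using e0 S by (simp add: subspace_0)
  next
    case False
    obtain c G where FG: "F k = pCons c G" by (cases "F k")
    have c: "c \<noteq> 0" using F0[of k] FG by simp
    have "monom 1 k * F k = monom c k + monom 1 (Suc k) * G"
      unfolding FG by (simp add: monom_Suc mult_pCons_right smult_monom)
    then have "pcomb e (monom 1 k * F k) = scale c (e k) + pcomb e (monom 1 (Suc k) * G)"
      by (simp add: pcomb_add pcomb_monom)
    moreover have "pcomb e (monom 1 (Suc k) * G) \<in> S"
      unfolding pcomb_def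
    proof (intro subspace_sum S)
      fix i
      show "scale (coeff (monom 1 (Suc k) * G) i) (e i) \<in> S"
      proof (cases "i \<le> k")
        case True
        then show ?thesis using S by (simp add: coeff_monom_mult subspace_0)
      next
        case 2: False
        then have "e i \<in> S" using less False by simp
        then show ?thesis using S by (simp add: subspace_scale)
      qed
    qed
    ultimately have "scale c (e k) \<in> S"
      using F[of k] subspace_diff[OF S, of "pcomb e (monom 1 k * F k)" "pcomb e (monom 1 (Suc k) * G)"]
      by simp
    then have "scale (inverse c) (scale c (e k)) \<in> S" using S by (rule subspace_scale[rotated])
    then show ?thesis using c by simp
  qed
qed

end

section \<open>Powers of a linear polynomial around their constant term\<close>

lemma coeff_linear_power:
  fixes c :: "'a::comm_ring_1"
  shows "coeff ([:c, 1:] ^ m) 0 = c ^ m" and "coeff ([:c, 1:] ^ m) 1 = of_nat m * c ^ (m - 1)"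
proof -
  show 0: "coeff ([:c, 1:] ^ m) 0 = c ^ m" for m
    by (induction m) auto
  show "coeff ([:c, 1:] ^ m) 1 = of_nat m * c ^ (m - 1)"
  proof (induction m)
    case (Suc m)
    then show ?case using 0[of m] by (cases m) (auto simp: algebra_simps coeff_pCons)
  qed simp
qed

text \<open>The linear coefficient is m c^(m-1), nonzero for c \<noteq> 0 because the characteristic
  is zero. Hence (c + L)^m - c^m is L times a unit for nilpotent L.\<close>

lemma linear_power_minus_const:
  fixes c :: "'a::field_char_0"
  assumes "m > 0"
  obtains g where "[:c, 1:] ^ m - [:c ^ m:] = monom 1 1 * g" and "c \<noteq> 0 \<Longrightarrow> coeff g 0 \<noteq> 0"
proof -
  obtain b g where g: "[:c, 1:] ^ m - [:c ^ m:] = pCons b g" by (cases "[:c, 1:] ^ m - [:c ^ m:]")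
  have "coeff (pCons b g) 0 = 0" unfolding g[symmetric] by (simp add: coeff_linear_power)
  then have "b = 0" by simp
  have "coeff (pCons b g) 1 = of_nat m * c ^ (m - 1)"
    unfolding g[symmetric] using coeff_linear_power(2)[of c m] by simp
  with \<open>b = 0\<close> g assms show ?thesis
    by (intro that[of g]) (auto simp: monom_altdef)
qed

text \<open>With Y = L nilpotent, this shows that a Jordan block of L becomes a Jordan block of (c +
  L)^m of the same size with eigenvalue c^m.\<close>

lemma pcompose_linear_power_minus_const:
  fixes c :: "'a::field_char_0"
  assumes "m > 0"
  obtains g where "pcompose ([:- (c ^ m), 1:] ^ k) ([:c, 1:] ^ m) = monom 1 k * g"
    and "c \<noteq> 0 \<Longrightarrow> coeff g 0 \<noteq> 0"
proof -
  obtain g where g: "[:c, 1:] ^ m - [:c ^ m:] = monom 1 1 * g" "c \<noteq> 0 \<Longrightarrow> coeff g 0 \<noteq> 0"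
    using linear_power_minus_const[OF assms, of c] by blast
  have "pcompose ([:- (c ^ m), 1:] ^ k) ([:c, 1:] ^ m) = (monom 1 1 * g) ^ k"
    unfolding g(1)[symmetric]
    by (induction k) (simp_all add: pcompose_mult pcompose_1 pcompose_pCons one_pCons[symmetric] del: mult_pCons_left mult_pCons_right)
  also have "\<dots> = monom 1 k * g ^ k" by (simp add: power_mult_distrib monom_power)
  finally show ?thesis using g(2) by (intro that[of "g ^ k"]) (auto simp: coeff_0_power)
qed

section \<open>Cyclic modules of a periodic shift with a nilpotent part\<close>

text \<open>\<open>e h k\<close> stands for T^h L^k w and \<open>U\<close> for T (kappa + L), where
  T^m = 1 and L^d = 0. Neither T nor L is an operator here; both exist only as index shifts. The
  instances are the s-th powers of \<open>x1\<close>, \<open>x2\<close> and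
  \<open>X\<close>.\<close>

locale twisted_chain = vspace scale
  for scale :: "'k::field_char_0 \<Rightarrow> 'v::ab_group_add \<Rightarrow> 'v" +
  fixes U :: "'v \<Rightarrow> 'v" and e :: "nat \<Rightarrow> nat \<Rightarrow> 'v" and kappa :: 'k and m d :: nat
  assumes linear_U: "Vector_Spaces.linear scale scale U"
    and U_e: "\<And>h k. U (e h k) = scale kappa (e (Suc h) k) + e (Suc h) (Suc k)"
    and e_periodic: "\<And>h k. e (h + m) k = e h k"
    and e_eq_0: "\<And>h k. k \<ge> d \<Longrightarrow> e h k = 0"
    and m_pos: "m > 0"
begin

lemma U_pcomb: "U (pcomb (e h) f) = pcomb (e (Suc h)) ([:kappa, 1:] * f)"
proof -
  have "U (pcomb (e h) f) = pcomb (\<lambda>k. scale kappa (e (Suc h) k) + e (Suc h) (Suc k)) f"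
    by (simp add: pcomb_linear[OF linear_U] U_e)
  also have "\<dots> = scale kappa (pcomb (e (Suc h)) f) + pcomb (\<lambda>k. e (Suc h) (Suc k)) f"
    by (simp add: pcomb_def scale_right_distrib sum.distrib scale_sum_right mult.commute)
  finally show ?thesis by (simp only: pcomb_linear_factor)
qed

lemma funpow_U_pcomb: "(U ^^ N) (pcomb (e h) f) = pcomb (e (h + N)) ([:kappa, 1:] ^ N * f)"
proof (induction N)
  case (Suc N)
  then show ?case by (simp only: funpow.simps o_apply U_pcomb add_Suc_right power_Suc mult.assoc)
qed simp

lemma e_periodic_mult: "e (h + m * j) k = e h k"
proof (induction j)
  case (Suc j)
  have "e (h + m * Suc j) k = e (h + m * j + m) k" by (simp add: algebra_simps)
  with Suc show ?case by (simp only: e_periodic)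
qed simp

text \<open>Since T^m = 1, U^m stays in row h and acts there as (kappa + L)^m. A polynomial in U^m
  therefore becomes one in L by substitution.\<close>

lemma pcomb_funpow_U:
  "pcomb (\<lambda>j. (U ^^ (m * j)) (e h 0)) f = pcomb (e h) (pcompose f ([:kappa, 1:] ^ m))"
proof (induction f)
  case (pCons c f)
  have e: "e (h + m) = e h" using e_periodic by blast
  have "pcomb (\<lambda>j. (U ^^ (m * Suc j)) (e h 0)) f = (U ^^ m) (pcomb (\<lambda>j. (U ^^ (m * j)) (e h 0)) f)"
    by (simp add: pcomb_linear[OF linear_funpow[OF linear_U]] funpow_add)
  also have "\<dots> = pcomb (e h) ([:kappa, 1:] ^ m * pcompose f ([:kappa, 1:] ^ m))"
    by (simp add: pCons.IH funpow_U_pcomb e)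
  finally show ?case
    by (simp add: pcomb_pCons pcompose_pCons pcomb_add)
qed (simp_all)

text \<open>This is (U^m - kappa^m)^d = 0 on the generator, the defining relation of a module V_d
  with parameter kappa^m.\<close>

lemma pcomb_funpow_U_eq_0:
  "pcomb (\<lambda>j. (U ^^ (m * j)) (e h 0)) ([:- (kappa ^ m), 1:] ^ d) = 0"
proof -
  obtain g where "pcompose ([:- (kappa ^ m), 1:] ^ d) ([:kappa, 1:] ^ m) = monom 1 d * g"
    using pcompose_linear_power_minus_const[OF m_pos] by metis
  then show ?thesis
    by (simp add: pcomb_funpow_U pcomb_monom_mult_eq_0 e_eq_0)
qed

text \<open>In effect U is invertible: T is periodic and kappa + L is a unit. Moving the generator
  by \<open>U ^^ b\<close> thus loses nothing, and this freedom is used later to adjust its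
  weight.\<close>

lemma e_in_invariant_subspace:
  assumes "kappa \<noteq> 0" and S: "subspace S" and US: "\<And>v. v \<in> S \<Longrightarrow> U v \<in> S"
    and gen: "(U ^^ b) (e 0 0) \<in> S"
  shows "e h k \<in> S"
proof -
  \<comment> \<open>N is congruent to h modulo m, so U^N leads from row 0 to row h; and it is at
    least b, so only powers of U known to land in S occur.\<close>
  define N where "N = h + m * b"
  have "b \<le> N" using m_pos unfolding N_def by (simp add: trans_le_add2)
  have eN: "e N = e h" unfolding N_def using e_periodic_mult by blast
  have mem: "(U ^^ (N + M)) (e 0 0) \<in> S" for M
  proof -
    have "N + M = (N + M - b) + b" using \<open>b \<le> N\<close> by simp
    then have "(U ^^ (N + M)) (e 0 0) = (U ^^ (N + M - b)) ((U ^^ b) (e 0 0))"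
      using funpow_add[of "N + M - b" b U] by simp
    then show ?thesis using gen US by (simp add: funpow_in_closed)
  qed
  have key: "pcomb (e h) ([:kappa, 1:] ^ N * pcompose f ([:kappa, 1:] ^ m)) \<in> S" for f
  proof -
    have "pcomb (e h) ([:kappa, 1:] ^ N * pcompose f ([:kappa, 1:] ^ m))
        = (U ^^ N) (pcomb (\<lambda>j. (U ^^ (m * j)) (e 0 0)) f)"
      by (simp add: pcomb_funpow_U funpow_U_pcomb eN)
    also have "\<dots> = pcomb (\<lambda>j. (U ^^ (N + m * j)) (e 0 0)) f"
      by (simp add: pcomb_linear[OF linear_funpow[OF linear_U]] funpow_add)
    also have "\<dots> \<in> S" using S mem by (rule pcomb_in_subspace)
    finally show ?thesis .
  qed
  \<comment> \<open>Taking f = (Y - kappa^m)^k gives a combination in row h that starts at L^k. The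
    additional factor (kappa + L)^N has constant term kappa^N \<noteq> 0 and preserves the
    start.\<close>
  have "\<exists>g. coeff g 0 \<noteq> 0 \<and> pcomb (e h) (monom 1 k * g) \<in> S" for k
  proof -
    obtain g where g: "pcompose ([:- (kappa ^ m), 1:] ^ k) ([:kappa, 1:] ^ m) = monom 1 k * g"
      "kappa \<noteq> 0 \<Longrightarrow> coeff g 0 \<noteq> 0"
      using pcompose_linear_power_minus_const[OF m_pos, of kappa k] by blast
    have "pcomb (e h) (monom 1 k * ([:kappa, 1:] ^ N * g)) \<in> S"
      using key[of "[:- (kappa ^ m), 1:] ^ k"] unfolding g(1) by (simp add: mult.left_commute)
    moreover have "coeff ([:kappa, 1:] ^ N * g) 0 \<noteq> 0"
      using g(2) assms(1) coeff_linear_power(1)[of kappa N] by (simp add: coeff_mult)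
    ultimately show ?thesis by blast
  qed
  then obtain F where "\<And>k. coeff (F k) 0 \<noteq> 0 \<and> pcomb (e h) (monom 1 k * F k) \<in> S" by metis
  then show ?thesis
    using pcomb_triangular[OF S, of d "e h" F k] e_eq_0 by blast
qed

end

section \<open>The q-binomial theorem\<close>

text \<open>Gaussian binomial coefficients, in the Pascal form produced by expanding \<open>(A + B)^(Suc m)\<close>
  as \<open>(A + B) (A + B)^m\<close> with \<open>A B = q B A\<close>.\<close>

fun qbinom :: "'a::comm_ring_1 \<Rightarrow> nat \<Rightarrow> nat \<Rightarrow> 'a" where
  "qbinom q m 0 = 1"
| "qbinom q 0 (Suc k) = 0"
| "qbinom q (Suc m) (Suc k) = qbinom q m k + q ^ Suc k * qbinom q m (Suc k)"

lemma qbinom_eq_0: "k > m \<Longrightarrow> qbinom q m k = 0"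
  by (induction q m k rule: qbinom.induct) auto

lemma qbinom_diag: "qbinom q m m = 1"
  by (induction m) (auto simp: qbinom_eq_0)

text \<open>The q-analogue of (k+1) binom(m+1,k+1) = (m+1) binom(m,k). This form without quotients
  remains valid at roots of unity, where q-factorials vanish.\<close>

lemma qbinom_absorb:
  "(1 - q ^ Suc k) * qbinom q (Suc m) (Suc k) = (1 - q ^ Suc m) * qbinom q m k"
proof (induction m arbitrary: k)
  case 0
  then show ?case by (cases k) auto
next
  case (Suc m)
  show ?case
  proof (cases k)
    case 0
    have "(1 - q) * qbinom q (Suc (Suc m)) (Suc 0) = (1 - q) + q * ((1 - q) * qbinom q (Suc m) (Suc 0))"
      unfolding qbinom.simps(3)[of q "Suc m"] by (simp add: ring_distribs mult.left_commute del: qbinom.simps(3))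
    also have "(1 - q) * qbinom q (Suc m) (Suc 0) = 1 - q ^ Suc m"
      using Suc.IH[of 0] by (simp del: qbinom.simps(3))
    finally show ?thesis using 0 by (simp add: algebra_simps del: qbinom.simps(3))
  next
    case k: (Suc l)
    have "(1 - q ^ Suc k) * qbinom q (Suc (Suc m)) (Suc k)
        = (1 - q ^ Suc k) * qbinom q (Suc m) k
          + q ^ Suc k * ((1 - q ^ Suc k) * qbinom q (Suc m) (Suc k))"
      by (simp add: algebra_simps)
    also have "\<dots> = (1 - q ^ Suc k) * qbinom q (Suc m) k + q ^ Suc k * ((1 - q ^ Suc m) * qbinom q m k)"
      by (simp only: Suc.IH)
    also have "\<dots> = (1 - q ^ Suc k) * qbinom q (Suc m) k
        + q ^ Suc k * (qbinom q m k - q ^ Suc m * qbinom q m k)"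
      by (simp add: algebra_simps)
    also have "\<dots> = (1 - q ^ Suc (Suc m)) * qbinom q (Suc m) k"
    proof -
      have IH: "qbinom q (Suc m) k - q ^ Suc l * qbinom q (Suc m) k = qbinom q m l - q ^ Suc m * qbinom q m l"
        using Suc.IH[of l] k by (simp add: algebra_simps)
      have P: "qbinom q (Suc m) k = qbinom q m l + q ^ Suc l * qbinom q m k"
        using k by simp
      have "q ^ Suc l * qbinom q m k = qbinom q (Suc m) k - qbinom q m l" using P by simp
      then have "q ^ Suc k * (qbinom q m k - q ^ Suc m * qbinom q m k)
          = q * (1 - q ^ Suc m) * (qbinom q (Suc m) k - qbinom q m l)"
        using k by (simp add: algebra_simps)
      also have "\<dots> = q * (1 - q ^ Suc m) * qbinom q (Suc m) k - q * (qbinom q m l - q ^ Suc m * qbinom q m l)"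
        by (simp add: algebra_simps)
      also have "\<dots> = q * (1 - q ^ Suc m) * qbinom q (Suc m) k
           - q * (qbinom q (Suc m) k - q ^ Suc l * qbinom q (Suc m) k)"
        by (simp only: IH)
      finally show ?thesis using k by (simp add: algebra_simps)
    qed
    finally show ?thesis .
  qed
qed

text \<open>Absorption has the factor 1 - q^s = 0 on one side and the nonzero factor 1 - q^k on the
  other.\<close>

lemma qbinom_root_of_unity:
  fixes q :: "'a::field"
  assumes "q ^ s = 1" and "\<And>i. 0 < i \<Longrightarrow> i < s \<Longrightarrow> q ^ i \<noteq> 1" and "0 < k" and "k < s"
  shows "qbinom q s k = 0"
proof -
  obtain l m where l: "k = Suc l" and m: "s = Suc m" using assms(3,4) by (cases k; cases s) auto
  have "(1 - q ^ k) * qbinom q s k = 0"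
    using qbinom_absorb[of q l m] assms(1) unfolding l m by simp
  moreover have "q ^ k \<noteq> 1" using assms by blast
  ultimately show ?thesis by simp
qed

context vspace
begin

text \<open>The relations are confined to a set S because the operators of the model are controlled
  only on the subspace W of the ambient space.\<close>

lemma q_commute_funpow:
  assumes A: "Vector_Spaces.linear scale scale A" and B: "Vector_Spaces.linear scale scale B"
    and BS: "\<And>v. v \<in> S \<Longrightarrow> B v \<in> S"
    and q: "\<And>v. v \<in> S \<Longrightarrow> A (B v) = scale q (B (A v))" and v: "v \<in> S"
  shows "A ((B ^^ k) v) = scale (q ^ k) ((B ^^ k) (A v))"
proof (induction k)
  case (Suc k)
  have "A ((B ^^ Suc k) v) = scale q (B (A ((B ^^ k) v)))"
    using q funpow_in_closed[of S B, OF BS v] by simp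
  then show ?case using Suc B by (simp add: Vector_Spaces.linear_iff)
qed simp

lemma q_binomial_theorem:
  assumes A: "Vector_Spaces.linear scale scale A" and B: "Vector_Spaces.linear scale scale B"
    and AS: "\<And>v. v \<in> S \<Longrightarrow> A v \<in> S" and BS: "\<And>v. v \<in> S \<Longrightarrow> B v \<in> S"
    and q: "\<And>v. v \<in> S \<Longrightarrow> A (B v) = scale q (B (A v))" and v: "v \<in> S"
  shows "((\<lambda>v. A v + B v) ^^ m) v = (\<Sum>k\<le>m. scale (qbinom q m k) ((B ^^ k) ((A ^^ (m - k)) v)))"
proof (induction m)
  case (Suc m)
  let ?t = "\<lambda>m k. (B ^^ k) ((A ^^ (m - k)) v)"
  have A': "A (?t m k) = scale (q ^ k) (?t (Suc m) k)" if "k \<le> m" for k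
    using that q_commute_funpow[OF A B BS q, of "(A ^^ (m - k)) v" k] funpow_in_closed[of S A, OF AS v]
    by (simp add: Suc_diff_le)
  have "((\<lambda>v. A v + B v) ^^ Suc m) v
      = A (\<Sum>k\<le>m. scale (qbinom q m k) (?t m k)) + B (\<Sum>k\<le>m. scale (qbinom q m k) (?t m k))"
    by (simp add: Suc)
  also have "A (\<Sum>k\<le>m. scale (qbinom q m k) (?t m k))
      = (\<Sum>k\<le>m. scale (q ^ k * qbinom q m k) (?t (Suc m) k))"
    using A A' by (simp add: module_hom.sum module_hom.scale Vector_Spaces.linear_iff_module_hom mult.commute)
  \<comment> \<open>The added term k = Suc m is zero; with it the sum can be shifted by one and its
    tail combined with the sum from B by the Pascal rule.\<close>
  also have "\<dots> = (\<Sum>k\<le>Suc m. scale (q ^ k * qbinom q m k) (?t (Suc m) k))"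
    by (simp add: qbinom_eq_0)
  also have "\<dots> = ?t (Suc m) 0 + (\<Sum>k\<le>m. scale (q ^ Suc k * qbinom q m (Suc k)) (?t (Suc m) (Suc k)))"
    unfolding sum.atMost_Suc_shift by simp
  also have "B (\<Sum>k\<le>m. scale (qbinom q m k) (?t m k))
      = (\<Sum>k\<le>m. scale (qbinom q m k) (?t (Suc m) (Suc k)))"
    using B by (simp add: module_hom.sum module_hom.scale Vector_Spaces.linear_iff_module_hom)
  also have "?t (Suc m) 0 + (\<Sum>k\<le>m. scale (q ^ Suc k * qbinom q m (Suc k)) (?t (Suc m) (Suc k)))
        + (\<Sum>k\<le>m. scale (qbinom q m k) (?t (Suc m) (Suc k)))
      = ?t (Suc m) 0 + (\<Sum>k\<le>m. scale (qbinom q (Suc m) (Suc k)) (?t (Suc m) (Suc k)))"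
    by (simp add: sum.distrib scale_left_distrib add_ac)
  also have "\<dots> = (\<Sum>k\<le>Suc m. scale (qbinom q (Suc m) k) (?t (Suc m) k))"
    unfolding sum.atMost_Suc_shift by simp
  finally show ?case .
qed simp

lemma q_freshmans_dream:
  assumes A: "Vector_Spaces.linear scale scale A" and B: "Vector_Spaces.linear scale scale B"
    and AS: "\<And>v. v \<in> S \<Longrightarrow> A v \<in> S" and BS: "\<And>v. v \<in> S \<Longrightarrow> B v \<in> S"
    and q: "\<And>v. v \<in> S \<Longrightarrow> A (B v) = scale q (B (A v))" and v: "v \<in> S"
    and root: "q ^ s = 1" "\<And>i. 0 < i \<Longrightarrow> i < s \<Longrightarrow> q ^ i \<noteq> 1" and s: "s > 0"
  shows "((\<lambda>v. A v + B v) ^^ s) v = (A ^^ s) v + (B ^^ s) v"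
proof -
  have "((\<lambda>v. A v + B v) ^^ s) v = (\<Sum>k\<le>s. scale (qbinom q s k) ((B ^^ k) ((A ^^ (s - k)) v)))"
    by (rule q_binomial_theorem[OF A B AS BS q v])
  also have "\<dots> = (\<Sum>k\<in>{0, s}. scale (qbinom q s k) ((B ^^ k) ((A ^^ (s - k)) v)))"
    by (rule sum.mono_neutral_right) (auto simp: qbinom_root_of_unity[OF root])
  finally show ?thesis using s by (simp add: qbinom_diag)
qed

end

section \<open>The Clebsch-Gordan rule\<close>

text \<open>The operator \<open>x + y\<close> on the coefficients of \<open>k[x,y]/(x^n, y^t)\<close>; it is the raising operator
  of the \<open>sl2\<close>-module \<open>V \<otimes> W\<close> with \<open>dim V = n\<close>, \<open>dim W = t\<close>, and \<open>lower\<close> is the lowering operator.\<close>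

definition raise :: "nat \<Rightarrow> nat \<Rightarrow> (nat \<Rightarrow> nat \<Rightarrow> 'k::field_char_0) \<Rightarrow> nat \<Rightarrow> nat \<Rightarrow> 'k" where
  "raise n t c = (\<lambda>i j. if i < n \<and> j < t
     then (if i = 0 then 0 else c (i - 1) j) + (if j = 0 then 0 else c i (j - 1)) else 0)"

definition lower :: "nat \<Rightarrow> nat \<Rightarrow> (nat \<Rightarrow> nat \<Rightarrow> 'k::field_char_0) \<Rightarrow> nat \<Rightarrow> nat \<Rightarrow> 'k" where
  "lower n t c = (\<lambda>i j. of_nat ((i + 1) * (n - 1 - i)) * c (i + 1) j
     + of_nat ((j + 1) * (t - 1 - j)) * c i (j + 1))"

definition homog :: "nat \<Rightarrow> nat \<Rightarrow> nat \<Rightarrow> (nat \<Rightarrow> nat \<Rightarrow> 'k::field_char_0) \<Rightarrow> bool" where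
  "homog n t r c \<longleftrightarrow> (\<forall>i j. c i j \<noteq> 0 \<longrightarrow> i < n \<and> j < t \<and> i + j = r)"

lemma homog_raise:
  assumes "homog n t r c"
  shows "homog n t (Suc r) (raise n t c)"
  unfolding homog_def
proof (intro allI impI)
  fix i j
  assume nz: "raise n t c i j \<noteq> 0"
  then have ij: "i < n" "j < t" by (auto simp: raise_def split: if_splits)
  have "(i \<noteq> 0 \<and> c (i - 1) j \<noteq> 0) \<or> (j \<noteq> 0 \<and> c i (j - 1) \<noteq> 0)"
    using nz ij by (auto simp: raise_def split: if_splits)
  then show "i < n \<and> j < t \<and> i + j = Suc r"
    using assms ij unfolding homog_def by force
qed

text \<open>The commutator of \<open>lower\<close> and \<open>raise\<close> is the weight operator
  of sl2: x^i contributes n - 1 - 2 i and y^j contributes t - 1 - 2 j, which adds up to a constant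
  in degree r = i + j.\<close>

lemma lower_raise:
  assumes "homog n t r c"
  shows "lower n t (raise n t c) i j
    = raise n t (lower n t c) i j + (of_nat (n + t) - 2 - 2 * of_nat r) * c i j"
proof (cases "i < n \<and> j < t")
  case True
  \<comment> \<open>The substitution removes the truncated subtractions n - 1 - i and t - 1 - j; a =
    0 and b = 0 are the far edges of the box.\<close>
  then obtain a b where n: "n = i + 1 + a" and t: "t = j + 1 + b"
    by (metis add.commute less_imp_Suc_add add_Suc Suc_eq_plus1)
  have c0: "c i' j' = 0" if "i' \<ge> n \<or> j' \<ge> t" for i' j'
    using assms that unfolding homog_def by (meson not_le)
  have r: "c i j = 0 \<or> r = i + j" using assms unfolding homog_def by auto
  show ?thesis
    using r c0[of "i + 1" j] c0[of i "j + 1"] c0[of "i + 1" "j - 1"] c0[of "i - 1" "j + 1"]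
    unfolding lower_def raise_def n t
    by (cases i; cases j; cases a; cases b) (auto simp: algebra_simps)
next
  case False
  then have "c i j = 0" using assms unfolding homog_def by blast
  with False show ?thesis unfolding lower_def raise_def by auto
qed

text \<open>Lowering raise^(k+1) c gives (k+1) (d-k-1) raise^k c, where d - 1 is the weight of c.
  The scalar vanishes only for k + 1 = d, so from d on the vanishing of raise^(k+1) c forces that of
  raise^k c.\<close>

lemma raise_eq_0_of_primitive:
  fixes c :: "nat \<Rightarrow> nat \<Rightarrow> 'k::field_char_0"
  assumes hom: "homog n t l c" and prim: "lower n t c = (\<lambda>i j. 0)"
    and d: "d + 2 * l + 1 = n + t" and k: "k \<ge> d"
  shows "(raise n t ^^ k) c = (\<lambda>i j. 0)"
proof -
  let ?c = "\<lambda>k. (raise n t ^^ k) c"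
  have hk: "homog n t (l + k) (?c k)" for k
    by (induction k) (auto simp: hom homog_raise)
  have low: "lower n t (?c (Suc k)) = (\<lambda>i j. of_nat (Suc k) * (of_nat d - of_nat (Suc k)) * ?c k i j)" for k
  proof (induction k)
    case 0
    have "(of_nat (n + t) - 2 - 2 * of_nat l :: 'k) = of_nat d - 1"
      unfolding d[symmetric] by simp
    then show ?case using lower_raise[OF hom] prim by (auto simp: fun_eq_iff raise_def)
  next
    case (Suc k)
    show ?case
    proof (intro ext)
      fix i j
      have nt: "(of_nat (n + t) :: 'k) = of_nat d + 2 * of_nat l + 1" unfolding d[symmetric] by simp
      have "lower n t (?c (Suc (Suc k))) i j = raise n t (lower n t (?c (Suc k))) i j
          + (of_nat (n + t) - 2 - 2 * of_nat (l + Suc k)) * ?c (Suc k) i j"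
        using lower_raise[OF hk[of "Suc k"]] by simp
      also have "raise n t (lower n t (?c (Suc k))) i j
          = of_nat (Suc k) * (of_nat d - of_nat (Suc k)) * ?c (Suc k) i j"
        unfolding Suc by (simp add: raise_def algebra_simps)
      finally show "lower n t (?c (Suc (Suc k))) i j
          = of_nat (Suc (Suc k)) * (of_nat d - of_nat (Suc (Suc k))) * ?c (Suc k) i j"
        unfolding nt by (simp add: algebra_simps)
    qed
  qed
  \<comment> \<open>The degree l + k exceeds the top degree (n - 1) + (t - 1) of the box; the
    downward induction starts here.\<close>
  have big: "?c k = (\<lambda>i j. 0)" if "k \<ge> n + t" for k
  proof (intro ext)
    fix i j show "?c k i j = 0" using hk[of k] that unfolding homog_def by (metis add_less_mono le_trans less_le_not_le trans_le_add2)
  qed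
  show ?thesis using k
  proof (induction "n + t - k" arbitrary: k rule: less_induct)
    case less
    show ?case
    proof (cases "k \<ge> n + t")
      case True then show ?thesis by (rule big)
    next
      case False
      then have "?c (Suc k) = (\<lambda>i j. 0)" using less.hyps[of "Suc k"] less.prems by simp
      then have "lower n t (?c (Suc k)) = (\<lambda>i j. 0)" by (simp add: lower_def)
      then have "of_nat (Suc k) * (of_nat d - of_nat (Suc k)) * ?c k i j = 0" for i j
        unfolding low by meson
      moreover have "(of_nat d - of_nat (Suc k) :: 'k) \<noteq> 0"
        using less.prems by (simp only: right_minus_eq of_nat_eq_iff)
      ultimately show ?thesis by (auto simp: fun_eq_iff simp del: of_nat_Suc)
    qed
  qed
qed

text \<open>In degree l the kernel of \<open>lower\<close> is given by a two-term recursion along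
  the antidiagonal, solved by positive integers with alternating signs. The alternating sum is the
  value of the polynomial c at x = -1, y = 1; that it is nonzero says that c is not a multiple of x
  + y, so c supplies what the image of \<open>raise\<close> misses in degree l.\<close>

lemma exists_primitive:
  assumes "l < n" and "l < t"
  obtains c :: "nat \<Rightarrow> nat \<Rightarrow> 'k::field_char_0"
  where "homog n t l c" and "lower n t c = (\<lambda>i j. 0)" and "(\<Sum>i\<le>l. (-1) ^ i * c i (l - i)) \<noteq> 0"
proof -
  \<comment> \<open>The telescoping solution of g(a+1) (a+1) (n-1-a) = g(a) (l-a) (t-l+a). The last
    product runs from a to l, which avoids denominators.\<close>
  define g where "g a = (l choose a) * (\<Prod>b<a. t - l + b) * (\<Prod>b=a..<l. n - 1 - b)" for a
  have g: "g (Suc a) * (Suc a * (n - 1 - a)) = g a * ((l - a) * (t - l + a))" if "a < l" for a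
  proof -
    have 1: "(\<Prod>b=a..<l. n - 1 - b) = (n - 1 - a) * (\<Prod>b=Suc a..<l. n - 1 - b)"
      using that by (simp add: prod.atLeast_Suc_lessThan)
    have 2: "(l choose Suc a) * Suc a = (l choose a) * (l - a)"
      using binomial_absorb_comp[of l a] binomial_absorption[of a l] by (simp only: mult.commute)
    have "g (Suc a) * (Suc a * (n - 1 - a)) = ((l choose Suc a) * Suc a) * (\<Prod>b<a. t - l + b) * (t - l + a)
       * ((n - 1 - a) * (\<Prod>b=Suc a..<l. n - 1 - b))"
      unfolding g_def by (simp only: prod.lessThan_Suc mult_ac)
    then show ?thesis unfolding 2 1[symmetric] g_def by (simp only: mult_ac)
  qed
  define c where "c i j = (if i + j = l then (-1) ^ i * of_nat (g i) else (0::'k))" for i j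
  have "homog n t l c" unfolding homog_def c_def using assms by auto
  moreover have "lower n t c i j = 0" for i j
  proof (cases "i + j + 1 = l")
    case True
    have *: "j + 1 = l - i" "t - 1 - j = t - l + i" "i < l" using True assms by auto
    have "lower n t c i j = (-1) ^ i * (of_nat (g i * ((l - i) * (t - l + i))) - of_nat (g (Suc i) * (Suc i * (n - 1 - i))))"
    proof -
      have "c (i + 1) j = - ((-1) ^ i * of_nat (g (Suc i)))" "c i (j + 1) = (-1) ^ i * of_nat (g i)"
        using True by (simp_all add: c_def)
      then show ?thesis unfolding lower_def *(1,2)
        by (simp only: of_nat_mult Suc_eq_plus1 right_diff_distrib mult_minus_right mult_ac uminus_add_conv_diff)
    qed
    then show ?thesis by (simp only: g[OF *(3)] diff_self mult_zero_right)
  next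
    case False
    then have "c (i + 1) j = 0" "c i (j + 1) = 0" by (simp_all add: c_def)
    then show ?thesis unfolding lower_def by simp
  qed
  moreover have "(\<Sum>i\<le>l. (-1) ^ i * c i (l - i)) \<noteq> 0"
  proof -
    have "(\<Sum>i\<le>l. (-1) ^ i * c i (l - i)) = (\<Sum>i\<le>l. of_nat (g i))"
      by (rule sum.cong) (auto simp: c_def)
    also have "\<dots> = of_nat (\<Sum>i\<le>l. g i)" by simp
    finally show ?thesis
    proof (rule ssubst)
      have "g 0 > 0" using assms by (auto simp: g_def)
      then have "(\<Sum>i\<le>l. g i) > 0" by (metis atMost_iff finite_atMost le0 sum_pos2)
      then show "of_nat (\<Sum>i\<le>l. g i) \<noteq> (0::'k)" by (simp only: of_nat_eq_0_iff)
    qed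
  qed
  ultimately show ?thesis by (intro that[of c]) auto
qed

text \<open>The monomial x^a y^b of the truncated ring, hence zero outside the box.\<close>

definition coeff_delta :: "nat \<Rightarrow> nat \<Rightarrow> nat \<Rightarrow> nat \<Rightarrow> nat \<Rightarrow> nat \<Rightarrow> 'k::field_char_0" where
  "coeff_delta n t a b = (\<lambda>i j. if a < n \<and> b < t \<and> i = a \<and> j = b then 1 else 0)"

lemma raise_coeff_delta:
  assumes "a < n" and "b < t"
  shows "raise n t (coeff_delta n t a b)
    = (\<lambda>i j. coeff_delta n t (Suc a) b i j + coeff_delta n t a (Suc b) i j)"
  using assms by (auto simp: raise_def coeff_delta_def fun_eq_iff)

text \<open>Modulo multiples of x + y, the monomial x^a y^(r-a) is (-1)^a y^r, so each degree needs
  at most one generator. Below \<open>min n t\<close> it is \<open>g r\<close>; from there on x^r or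
  y^r is zero in the truncated ring, and the rest of the degree follows.\<close>

lemma coeff_delta_generated:
  fixes C :: "(nat \<Rightarrow> nat \<Rightarrow> 'k::field_char_0) set"
  assumes zero: "(\<lambda>i j. 0) \<in> C"
    and comb: "\<And>x c c'. c \<in> C \<Longrightarrow> c' \<in> C \<Longrightarrow> (\<lambda>i j. x * c i j + c' i j) \<in> C"
    and raise: "\<And>c. c \<in> C \<Longrightarrow> raise n t c \<in> C"
    and gen: "\<And>l. l < min n t \<Longrightarrow> g l \<in> C"
    and hom: "\<And>l. l < min n t \<Longrightarrow> homog n t l (g l)"
    and nz: "\<And>l. l < min n t \<Longrightarrow> (\<Sum>i\<le>l. (-1) ^ i * g l i (l - i)) \<noteq> 0"
  shows "coeff_delta n t a b \<in> C"
proof -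
  let ?d = "coeff_delta n t :: nat \<Rightarrow> nat \<Rightarrow> nat \<Rightarrow> nat \<Rightarrow> 'k"
  have cong: "c \<in> C" if "c' \<in> C" "\<And>i j. c i j = c' i j" for c c'
  proof -
    have "c = c'" using that(2) by (intro ext)
    then show ?thesis using that(1) by simp
  qed
  have scaled: "(\<lambda>i j. x * c i j) \<in> C" if "c \<in> C" for x c
    using comb[OF that zero, of x] by simp
  have sums: "(\<lambda>i j. \<Sum>a\<in>A. f a i j) \<in> C" if "finite A" "\<And>a. a \<in> A \<Longrightarrow> f a \<in> C" for A :: "nat set" and f
    using that
  proof (induction A)
    case (insert x F)
    then have "(\<lambda>i j. 1 * f x i j + (\<Sum>a\<in>F. f a i j)) \<in> C" by (intro comb) auto
    then show ?case using insert by simp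
  qed (simp add: zero)
  have "?d a (r - a) \<in> C" if "a \<le> r" for r a
    using that
  proof (induction r arbitrary: a rule: less_induct)
    case (less r)
    have step: "(\<lambda>i j. ?d (Suc a) (r - Suc a) i j + ?d a (r - a) i j) \<in> C" if "a < r" for a
    proof (cases "a < n \<and> r - Suc a < t")
      case True
      have "raise n t (?d a (r - Suc a)) \<in> C"
        using raise less.IH[of "r - 1" a] that by simp
      moreover have "Suc (r - Suc a) = r - a" using that by simp
      ultimately show ?thesis using True by (simp add: raise_coeff_delta)
    next
      case False
      then show ?thesis using zero by (elim cong) (auto simp: coeff_delta_def)
    qed
    have alt: "(\<lambda>i j. ?d a (r - a) i j - (-1) ^ a * ?d 0 r i j) \<in> C" if "a \<le> r" for a
      using that
    proof (induction a)
      case 0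
      then show ?case by (simp add: zero)
    next
      case (Suc a)
      then have "(\<lambda>i j. (-1) * (?d a (r - a) i j - (-1) ^ a * ?d 0 r i j)
          + (?d (Suc a) (r - Suc a) i j + ?d a (r - a) i j)) \<in> C"
        by (intro comb step Suc.IH) auto
      then show ?case by (simp add: add.commute)
    qed
    have d0: "?d 0 r \<in> C"
    proof (cases "r < min n t")
      case True
      let ?s = "\<Sum>a\<le>r. (-1) ^ a * g r a (r - a)"
      have g: "g r i j = (\<Sum>a\<le>r. g r a (r - a) * ?d a (r - a) i j)" for i j
      proof (cases "i + j = r")
        case True
        have "(\<Sum>a\<le>r. g r a (r - a) * ?d a (r - a) i j) = (\<Sum>a\<in>{i}. g r a (r - a) * ?d a (r - a) i j)"
          by (rule sum.mono_neutral_right) (use True in \<open>auto simp: coeff_delta_def\<close>)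
        also have "\<dots> = g r i j" using True \<open>r < min n t\<close> by (auto simp: coeff_delta_def)
        finally show ?thesis by simp
      next
        case False
        then have "g r i j = 0" using hom[OF True] unfolding homog_def by blast
        moreover have "(\<Sum>a\<le>r. g r a (r - a) * ?d a (r - a) i j) = 0"
          using False by (intro sum.neutral) (auto simp: coeff_delta_def)
        ultimately show ?thesis by simp
      qed
      have "(\<lambda>i j. \<Sum>a\<le>r. g r a (r - a) * (?d a (r - a) i j - (-1) ^ a * ?d 0 r i j)) \<in> C"
        by (intro sums scaled alt) auto
      then have "(\<lambda>i j. (-1) * (\<Sum>a\<le>r. g r a (r - a) * (?d a (r - a) i j - (-1) ^ a * ?d 0 r i j)) + g r i j) \<in> C"
        using gen[OF True] by (intro comb) auto
      \<comment> \<open>Replacing every monomial of \<open>g r\<close> by its residue leaves y^r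
        times the value of \<open>g r\<close> at x = -1, y = 1.\<close>
      then have "(\<lambda>i j. ?s * ?d 0 r i j) \<in> C"
      proof (rule cong)
        fix i j
        show "?s * ?d 0 r i j = (-1) * (\<Sum>a\<le>r. g r a (r - a) * (?d a (r - a) i j - (-1) ^ a * ?d 0 r i j)) + g r i j"
          unfolding g[of i j]
          by (simp add: right_diff_distrib sum_subtractf sum_negf sum_distrib_left sum_distrib_right mult_ac)
      qed
      then have "(\<lambda>i j. inverse ?s * (?s * ?d 0 r i j)) \<in> C" by (rule scaled)
      then show ?thesis
      proof (rule cong)
        fix i j
        show "?d 0 r i j = inverse ?s * (?s * ?d 0 r i j)"
          using nz[OF True] by (simp add: mult.assoc[symmetric])
      qed
    next
      case False
      show ?thesis
      proof (cases "r < t")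
        case True
        \<comment> \<open>Here r \<ge> n, so x^r = 0, while y^r agrees with x^r up to sign.\<close>
        then have "?d r 0 i j = 0" for i j using False by (auto simp: coeff_delta_def)
        then have "(\<lambda>i j. - ((-1) ^ r * ?d 0 r i j)) \<in> C" using alt[of r] by simp
        then have "(\<lambda>i j. - ((-1) ^ r) * (- ((-1) ^ r * ?d 0 r i j))) \<in> C" by (rule scaled)
        then show ?thesis by simp
      next
        case False
        then show ?thesis using zero by (elim cong) (auto simp: coeff_delta_def)
      qed
    qed
    have "(\<lambda>i j. (-1) ^ a * ?d 0 r i j + (?d a (r - a) i j - (-1) ^ a * ?d 0 r i j)) \<in> C"
      using less.prems by (intro comb d0 alt)
    then show ?case by simp
  qed
  from this[of a "a + b"] show ?thesis by simp
qed

section \<open>Evaluating coefficient arrays at a family of vectors\<close>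

context vspace
begin

definition dcomb :: "nat \<Rightarrow> nat \<Rightarrow> (nat \<Rightarrow> nat \<Rightarrow> 'v) \<Rightarrow> (nat \<Rightarrow> nat \<Rightarrow> 'k) \<Rightarrow> 'v" where
  "dcomb n t D c = (\<Sum>i<n. \<Sum>j<t. scale (c i j) (D i j))"

lemma dcomb_zero: "dcomb n t D (\<lambda>i j. 0) = 0"
  by (simp add: dcomb_def)

lemma dcomb_comb: "dcomb n t D (\<lambda>i j. x * c i j + c' i j) = scale x (dcomb n t D c) + dcomb n t D c'"
  by (simp add: dcomb_def scale_left_distrib sum.distrib scale_sum_right)

lemma dcomb_delta:
  assumes "a < n" and "b < t"
  shows "dcomb n t D (coeff_delta n t a b) = D a b"
proof -
  have "(\<Sum>j<t. scale (coeff_delta n t a b i j) (D i j)) = (if i = a then D a b else 0)" for i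
  proof -
    have "(\<Sum>j<t. scale (coeff_delta n t a b i j) (D i j)) = (\<Sum>j<t. if j = b then (if i = a then D a b else 0) else 0)"
      using assms by (intro sum.cong) (auto simp: coeff_delta_def)
    also have "\<dots> = (if i = a then D a b else 0)" using assms by simp
    finally show ?thesis .
  qed
  then show ?thesis unfolding dcomb_def using assms by simp
qed

text \<open>Multiplication by x + y moves from the coefficients to the indices of D. The terms that
  \<open>raise\<close> cuts off at the edge of the box belong to vectors that are zero.\<close>

lemma dcomb_raise:
  assumes "\<And>i j. i \<ge> n \<or> j \<ge> t \<Longrightarrow> D i j = 0"
  shows "dcomb n t D (raise n t c) = dcomb n t (\<lambda>i j. D (Suc i) j + D i (Suc j)) c"
proof -
  have 1: "(\<Sum>i<n. if i = 0 then 0 else scale (c (i - 1) j) (D i j)) = (\<Sum>i<n. scale (c i j) (D (Suc i) j))" for j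
  proof (cases n)
    case (Suc n')
    have "D (Suc n') j = 0" using assms Suc by simp
    then show ?thesis unfolding Suc by (subst sum.lessThan_Suc_shift) simp
  qed simp
  have 2: "(\<Sum>j<t. if j = 0 then 0 else scale (c i (j - 1)) (D i j)) = (\<Sum>j<t. scale (c i j) (D i (Suc j)))" for i
  proof (cases t)
    case (Suc t')
    have "D i (Suc t') = 0" using assms Suc by simp
    then show ?thesis unfolding Suc by (subst sum.lessThan_Suc_shift) simp
  qed simp
  have "dcomb n t D (raise n t c) = (\<Sum>i<n. \<Sum>j<t. (if i = 0 then 0 else scale (c (i - 1) j) (D i j))
      + (if j = 0 then 0 else scale (c i (j - 1)) (D i j)))"
    unfolding dcomb_def by (intro sum.cong) (auto simp: raise_def scale_left_distrib)
  also have "\<dots> = (\<Sum>j<t. \<Sum>i<n. if i = 0 then 0 else scale (c (i - 1) j) (D i j))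
      + (\<Sum>i<n. \<Sum>j<t. if j = 0 then 0 else scale (c i (j - 1)) (D i j))"
    unfolding sum.distrib by (subst (1) sum.swap) simp
  also have "\<dots> = (\<Sum>j<t. \<Sum>i<n. scale (c i j) (D (Suc i) j)) + (\<Sum>i<n. \<Sum>j<t. scale (c i j) (D i (Suc j)))"
    unfolding 1 2 ..
  also have "\<dots> = dcomb n t (\<lambda>i j. D (Suc i) j + D i (Suc j)) c"
    unfolding dcomb_def scale_right_distrib sum.distrib by (subst (1) sum.swap) simp
  finally show ?thesis .
qed

lemma dcomb_generated:
  assumes S: "subspace S"
    and gen: "\<And>l k. l < min n t \<Longrightarrow> dcomb n t D ((raise n t ^^ k) (g l)) \<in> S"
    and hom: "\<And>l. l < min n t \<Longrightarrow> homog n t l (g l)"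
    and nz: "\<And>l. l < min n t \<Longrightarrow> (\<Sum>i\<le>l. (-1) ^ i * g l i (l - i)) \<noteq> 0"
    and "a < n" and "b < t"
  shows "D a b \<in> S"
proof -
  \<comment> \<open>Quantifying over all k makes this set closed under \<open>raise\<close>.\<close>
  let ?C = "{c. \<forall>k. dcomb n t D ((raise n t ^^ k) c) \<in> S}"
  have raise_zero1: "raise n t (\<lambda>i j. 0) = (\<lambda>i j. 0 :: 'k)" by (auto simp: raise_def fun_eq_iff)
  have raise_comb1: "raise n t (\<lambda>i j. x * c i j + c' i j)
      = (\<lambda>i j. x * raise n t c i j + raise n t c' i j)" for x and c c' :: "nat \<Rightarrow> nat \<Rightarrow> 'k"
    by (auto simp: raise_def fun_eq_iff algebra_simps)
  have raise_zero: "(raise n t ^^ k) (\<lambda>i j. 0) = (\<lambda>i j. 0 :: 'k)" for k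
    by (induction k) (simp_all add: raise_zero1)
  have raise_comb: "(raise n t ^^ k) (\<lambda>i j. x * c i j + c' i j)
      = (\<lambda>i j. x * (raise n t ^^ k) c i j + (raise n t ^^ k) c' i j)" for k x and c c' :: "nat \<Rightarrow> nat \<Rightarrow> 'k"
    by (induction k) (simp_all add: raise_comb1)
  have "coeff_delta n t a b \<in> ?C"
  proof (rule coeff_delta_generated[where g = g])
    show "raise n t c \<in> ?C" if "c \<in> ?C" for c
    proof -
      have "dcomb n t D ((raise n t ^^ Suc k) c) \<in> S" for k using that by blast
      then show ?thesis by (simp only: funpow_Suc_right o_apply mem_Collect_eq) simp
    qed
  qed (use S gen hom nz in \<open>auto simp: raise_zero dcomb_zero raise_comb dcomb_comb subspace_0
        intro!: subspace_add subspace_scale\<close>)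
  then have "dcomb n t D ((raise n t ^^ 0) (coeff_delta n t a b)) \<in> S" by blast
  then show ?thesis using dcomb_delta[of a n b t D] assms by simp
qed

end

section \<open>Modules realised by lists of vectors\<close>

lemma sum_lessThan_add:
  fixes f :: "nat \<Rightarrow> 'a::comm_monoid_add"
  shows "(\<Sum>i<m + n. f i) = (\<Sum>i<m. f i) + (\<Sum>i<n. f (m + i))"
  by (induction n) (simp_all add: add.assoc)

text \<open>The reindexing behind the position i * dim N + j in a Kronecker product.\<close>

lemma sum_div_mod:
  fixes f :: "nat \<Rightarrow> nat \<Rightarrow> 'a::comm_monoid_add"
  shows "(\<Sum>I<m * n. f (I div n) (I mod n)) = (\<Sum>i<m. \<Sum>j<n. f i j)"
proof (induction m)
  case (Suc m)
  have "(\<Sum>I<Suc m * n. f (I div n) (I mod n)) = (\<Sum>I<m * n + n. f (I div n) (I mod n))"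
    by (simp add: add.commute)
  also have "\<dots> = (\<Sum>i<m. \<Sum>j<n. f i j) + (\<Sum>j<n. f ((m * n + j) div n) ((m * n + j) mod n))"
    by (simp only: sum_lessThan_add Suc)
  also have "(\<Sum>j<n. f ((m * n + j) div n) ((m * n + j) mod n)) = (\<Sum>j<n. f m j)"
    by (intro sum.cong) auto
  finally show ?case by simp
qed simp

context vspace
begin

text \<open>The list may be linearly dependent. Independence enters only when two lists are
  compared, in the form that the length is the dimension of the span.\<close>

definition acts :: "('v \<Rightarrow> 'v) \<Rightarrow> 'v list \<Rightarrow> 'k mat \<Rightarrow> bool" where
  "acts X bs A \<longleftrightarrow> A \<in> carrier_mat (length bs) (length bs)
     \<and> (\<forall>j<length bs. X (bs ! j) = (\<Sum>i<length bs. scale (A $$ (i, j)) (bs ! i)))"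

definition realizes :: "('g, 'c) monoid_scheme \<Rightarrow> ('g \<Rightarrow> 'v \<Rightarrow> 'v) \<Rightarrow> ('v \<Rightarrow> 'v) \<Rightarrow> 'v list \<Rightarrow> ('g, 'k) hrep \<Rightarrow> bool" where
  "realizes G act X bs M \<longleftrightarrow> acts X bs (snd M) \<and> (\<forall>g\<in>carrier G. acts (act g) bs (fst M g))"

lemma realizes_hdim: "realizes G act X bs M \<Longrightarrow> hdim M = length bs"
  by (auto simp: realizes_def acts_def hdim_def)

lemma acts_span_closed:
  assumes "acts X bs A" and "Vector_Spaces.linear scale scale X" and "v \<in> span (set bs)"
  shows "X v \<in> span (set bs)"
proof (rule linear_span_closed[OF assms(2) _ assms(3)])
  fix b assume "b \<in> set bs"
  then obtain j where "j < length bs" "b = bs ! j" by (auto simp: in_set_conv_nth)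
  then have "X b = (\<Sum>i<length bs. scale (A $$ (i, j)) (bs ! i))" using assms(1) by (simp add: acts_def)
  also have "\<dots> \<in> span (set bs)" by (intro span_sum span_scale span_base) auto
  finally show "X b \<in> span (set bs)" .
qed

lemma acts_four_block:
  assumes A: "acts X bs A" and B: "acts X cs B"
  shows "acts X (bs @ cs) (four_block_mat A (0\<^sub>m (length bs) (length cs)) (0\<^sub>m (length cs) (length bs)) B)"
    (is "acts X _ ?F")
proof -
  have dA: "A \<in> carrier_mat (length bs) (length bs)" and dB: "B \<in> carrier_mat (length cs) (length cs)"
    using A B by (auto simp: acts_def)
  have idx: "?F $$ (i, j) = (if i < length bs then if j < length bs then A $$ (i, j) else 0
      else if j < length bs then 0 else B $$ (i - length bs, j - length bs))"
    if "i < length bs + length cs" "j < length bs + length cs" for i j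
    using that dA dB by (auto simp: index_mat_four_block)
  have "X ((bs @ cs) ! j) = (\<Sum>i<length (bs @ cs). scale (?F $$ (i, j)) ((bs @ cs) ! i))"
    if j: "j < length (bs @ cs)" for j
  proof (cases "j < length bs")
    case True
    then have "X ((bs @ cs) ! j) = (\<Sum>i<length bs. scale (A $$ (i, j)) (bs ! i))"
      using A by (simp add: acts_def nth_append)
    then show ?thesis using True j idx by (simp add: sum_lessThan_add nth_append)
  next
    case False
    then have "X ((bs @ cs) ! j) = (\<Sum>i<length cs. scale (B $$ (i, j - length bs)) (cs ! i))"
      using B j by (simp add: acts_def nth_append)
    then show ?thesis using False j idx by (simp add: sum_lessThan_add nth_append)
  qed
  then show ?thesis using dA dB unfolding acts_def by simp
qed

lemma realizes_hdsum:
  assumes "realizes G act X bs M" and "realizes G act X cs N"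
  shows "realizes G act X (bs @ cs) (hdsum M N)"
  using assms realizes_hdim[OF assms(1)] realizes_hdim[OF assms(2)]
  by (simp add: realizes_def hdsum_def acts_four_block)

lemma realizes_hdsums:
  assumes "list_all2 (realizes G act X) bss Ms"
  shows "realizes G act X (concat bss) (hdsums Ms)"
  using assms
proof (induction rule: list_all2_induct)
  case Nil
  then show ?case by (simp add: hdsums_def hzero_def realizes_def acts_def)
next
  case (Cons bs bss M Ms)
  then show ?case using realizes_hdsum by (simp add: hdsums_def)
qed

text \<open>W bounds the lists from above and A from below: A collects generators that are sure to
  occur, and the spanning argument starts from these alone.\<close>

definition gen_realizes :: "('g, 'c) monoid_scheme \<Rightarrow> ('g \<Rightarrow> 'v \<Rightarrow> 'v) \<Rightarrow> ('v \<Rightarrow> 'v) \<Rightarrow> 'v set \<Rightarrow> 'v set \<Rightarrow> ('g, 'k) hrep list \<Rightarrow> bool" where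
  "gen_realizes G act X W A Ms \<longleftrightarrow> (\<exists>bss. list_all2 (realizes G act X) bss Ms
     \<and> A \<subseteq> set (concat bss) \<and> set (concat bss) \<subseteq> W)"

lemma gen_realizes_single:
  assumes "realizes G act X bs M" and "w \<in> set bs" and "set bs \<subseteq> W"
  shows "gen_realizes G act X W {w} [M]"
  unfolding gen_realizes_def using assms by (intro exI[of _ "[bs]"]) simp

lemma gen_realizes_append:
  assumes "gen_realizes G act X W A Ms" and "gen_realizes G act X W B Ns"
  shows "gen_realizes G act X W (A \<union> B) (Ms @ Ns)"
proof -
  obtain bss css where "list_all2 (realizes G act X) bss Ms" "A \<subseteq> set (concat bss)" "set (concat bss) \<subseteq> W"
    "list_all2 (realizes G act X) css Ns" "B \<subseteq> set (concat css)" "set (concat css) \<subseteq> W"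
    using assms unfolding gen_realizes_def by auto
  then show ?thesis unfolding gen_realizes_def
    by (intro exI[of _ "bss @ css"]) (auto intro: list_all2_appendI)
qed

lemma gen_realizes_concat:
  assumes "\<And>i. i \<in> set is \<Longrightarrow> gen_realizes G act X W (A i) (Ms i)"
  shows "gen_realizes G act X W (\<Union>i\<in>set is. A i) (concat (map Ms is))"
  using assms
proof (induction "is")
  case Nil
  then show ?case by (simp add: gen_realizes_def)
next
  case (Cons i "is")
  then show ?case using gen_realizes_append[of G act X W "A i" "Ms i"] by simp
qed

lemma gen_realizes_map:
  assumes "\<And>i. i \<in> set is \<Longrightarrow> gen_realizes G act X W {w i} [M i]"
  shows "gen_realizes G act X W (w ` set is) (map M is)"
proof -
  have "w ` set is = (\<Union>i\<in>set is. {w i})" and "map M is = concat (map (\<lambda>i. [M i]) is)" by auto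
  then show ?thesis using gen_realizes_concat[of "is" G act X W "\<lambda>i. {w i}" "\<lambda>i. [M i]"] assms by simp
qed

section \<open>Spanning lists whose length is the dimension\<close>

lemma span_list_coeffs:
  assumes "v \<in> span (set bs)"
  shows "\<exists>f. v = (\<Sum>i<length bs. scale (f i) (bs ! i))"
  using assms
proof (induction rule: span_induct_alt)
  case base
  then show ?case by (intro exI[of _ "\<lambda>i. 0"]) simp
next
  case (step c x y)
  then obtain f k where f: "y = (\<Sum>i<length bs. scale (f i) (bs ! i))" and k: "k < length bs" "x = bs ! k"
    by (auto simp: in_set_conv_nth)
  have "(\<Sum>i<length bs. scale (f i + (if i = k then c else 0)) (bs ! i))
      = y + (\<Sum>i<length bs. if i = k then scale c (bs ! i) else 0)"
    unfolding f sum.distrib[symmetric] by (intro sum.cong) (auto simp: scale_left_distrib)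
  also have "\<dots> = scale c x + y" using k by simp
  finally show ?case by metis
qed

text \<open>Two different expansions would make one entry a combination of the other positions, and
  fewer than \<open>length bs\<close> vectors would span.\<close>

lemma spanning_list_unique:
  assumes dim: "dim (span (set bs)) = length bs"
    and eq: "(\<Sum>i<length bs. scale (f i) (bs ! i)) = (\<Sum>i<length bs. scale (g i) (bs ! i))"
    and k: "k < length bs"
  shows "f k = g k"
proof (rule ccontr)
  assume ne: "f k \<noteq> g k"
  let ?J = "{..<length bs} - {k}" and ?h = "\<lambda>i. f i - g i"
  let ?B = "(\<lambda>i. bs ! i) ` ?J"
  have "(\<Sum>i<length bs. scale (?h i) (bs ! i)) = 0"
    using eq by (simp add: scale_left_diff_distrib sum_subtractf)
  then have "scale (?h k) (bs ! k) + (\<Sum>i\<in>?J. scale (?h i) (bs ! i)) = 0"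
    using k by (simp add: sum.remove[of "{..<length bs}" k])
  then have "scale (?h k) (bs ! k) = - (\<Sum>i\<in>?J. scale (?h i) (bs ! i))"
    by (simp add: eq_neg_iff_add_eq_0)
  also have "\<dots> \<in> span ?B" by (intro span_neg span_sum span_scale span_base) auto
  finally have "scale (inverse (?h k)) (scale (?h k) (bs ! k)) \<in> span ?B" by (rule span_scale)
  then have "bs ! k \<in> span ?B" using ne by simp
  moreover have "set bs = insert (bs ! k) ?B" using k by (auto simp: set_conv_nth)
  ultimately have "span (set bs) \<subseteq> span ?B" by (simp add: span_redundant)
  then have "dim (span (set bs)) \<le> card ?B" by (intro dim_le_card) auto
  also have "\<dots> \<le> card ?J" by (rule card_image_le) simp
  also have "\<dots> < length bs" using k by simp
  finally show False using dim by simp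
qed

text \<open>Both products hold the coordinates of \<open>X (bs ! j)\<close> with respect to
  \<open>cs\<close>, and these are unique.\<close>

lemma acts_intertwines:
  assumes X: "Vector_Spaces.linear scale scale X"
    and A: "acts X bs A" and B: "acts X cs B"
    and dim: "dim (span (set cs)) = length cs" and len: "length bs = length cs"
    and P: "P \<in> carrier_mat (length cs) (length cs)"
    and PB: "\<And>j. j < length cs \<Longrightarrow> bs ! j = (\<Sum>i<length cs. scale (P $$ (i, j)) (cs ! i))"
  shows "P * A = B * P"
proof (rule eq_matI)
  let ?n = "length cs"
  have dA: "A \<in> carrier_mat ?n ?n" and dB: "B \<in> carrier_mat ?n ?n"
    using A B len by (auto simp: acts_def)
  fix l j assume "l < dim_row (B * P)" "j < dim_col (B * P)"
  then have l: "l < ?n" and j: "j < ?n" using dB P by auto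
  have mult: "(C * D) $$ (i, j) = (\<Sum>k<?n. C $$ (i, k) * D $$ (k, j))"
    if "C \<in> carrier_mat ?n ?n" "D \<in> carrier_mat ?n ?n" "i < ?n" for C D :: "'k mat" and i
    using that j by (auto simp: times_mat_def scalar_prod_def atLeast0LessThan intro!: sum.cong)
  have "X (bs ! j) = (\<Sum>i<?n. scale (A $$ (i, j)) (\<Sum>l<?n. scale (P $$ (l, i)) (cs ! l)))"
    using A len j PB by (simp add: acts_def)
  also have "\<dots> = (\<Sum>l<?n. scale ((P * A) $$ (l, j)) (cs ! l))"
    unfolding scale_sum_right scale_scale
    by (subst sum.swap) (auto simp: mult[OF P dA] scale_sum_left mult.commute intro!: sum.cong)
  finally have 1: "X (bs ! j) = (\<Sum>l<?n. scale ((P * A) $$ (l, j)) (cs ! l))" .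
  have "X (bs ! j) = (\<Sum>i<?n. scale (P $$ (i, j)) (X (cs ! i)))"
    unfolding PB[OF j] using X by (simp add: module_hom.sum module_hom.scale Vector_Spaces.linear_iff_module_hom)
  also have "\<dots> = (\<Sum>i<?n. scale (P $$ (i, j)) (\<Sum>l<?n. scale (B $$ (l, i)) (cs ! l)))"
    using B by (simp add: acts_def)
  also have "\<dots> = (\<Sum>l<?n. scale ((B * P) $$ (l, j)) (cs ! l))"
    unfolding scale_sum_right scale_scale
    by (subst sum.swap) (auto simp: mult[OF dB P] scale_sum_left mult.commute intro!: sum.cong)
  finally have "(\<Sum>l<?n. scale ((P * A) $$ (l, j)) (cs ! l)) = (\<Sum>l<?n. scale ((B * P) $$ (l, j)) (cs ! l))"
    using 1 by simp
  from spanning_list_unique[OF dim this l] show "(P * A) $$ (l, j) = (B * P) $$ (l, j)" .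
qed (use assms in \<open>auto simp: acts_def\<close>)

lemma acts_id: "acts (\<lambda>v. v) bs (1\<^sub>m (length bs))"
proof -
  have "bs ! j = (\<Sum>i<length bs. scale (1\<^sub>m (length bs) $$ (i, j)) (bs ! i))" if "j < length bs" for j
  proof -
    have "(\<Sum>i<length bs. scale (1\<^sub>m (length bs) $$ (i, j)) (bs ! i)) = (\<Sum>i<length bs. if i = j then bs ! i else 0)"
      using that by (intro sum.cong) auto
    then show ?thesis using that by simp
  qed
  then show ?thesis by (auto simp: acts_def)
qed

lemma change_of_basis:
  assumes "set bs \<subseteq> span (set cs)"
  obtains P where "P \<in> carrier_mat (length cs) (length bs)"
    and "\<And>j. j < length bs \<Longrightarrow> bs ! j = (\<Sum>i<length cs. scale (P $$ (i, j)) (cs ! i))"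
proof -
  have "\<forall>j. \<exists>f. j < length bs \<longrightarrow> bs ! j = (\<Sum>i<length cs. scale (f i) (cs ! i))"
    using span_list_coeffs assms by (meson nth_mem subsetD)
  then obtain F where "\<And>j. j < length bs \<Longrightarrow> bs ! j = (\<Sum>i<length cs. scale (F j i) (cs ! i))" by metis
  then show ?thesis
    by (intro that[of "mat (length cs) (length bs) (\<lambda>(i, j). F j i)"]) auto
qed

text \<open>Both matrix modules describe the same operators on W in two bases, so the change of
  basis intertwines them. Independence comes from counting, never from an examination of the single
  summands.\<close>

lemma realizes_hiso:
  assumes bs: "realizes G act X bs M" and cs: "realizes G act X cs N"
    and X: "Vector_Spaces.linear scale scale X"
    and act: "\<And>g. g \<in> carrier G \<Longrightarrow> Vector_Spaces.linear scale scale (act g)"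
    and sp: "span (set bs) = W" "span (set cs) = W" and len: "length bs = dim W" "length cs = dim W"
  shows "hiso G M N"
proof -
  let ?n = "dim W"
  have hd: "hdim M = ?n" "hdim N = ?n" using bs cs len by (simp_all add: realizes_hdim)
  have sub: "set bs \<subseteq> span (set cs)" "set cs \<subseteq> span (set bs)" using sp span_superset by blast+
  obtain P where P: "P \<in> carrier_mat ?n ?n"
    and PB: "\<And>j. j < ?n \<Longrightarrow> bs ! j = (\<Sum>i<?n. scale (P $$ (i, j)) (cs ! i))"
    using change_of_basis[OF sub(1)] unfolding len by metis
  obtain Q where Q: "Q \<in> carrier_mat ?n ?n"
    and QC: "\<And>j. j < ?n \<Longrightarrow> cs ! j = (\<Sum>i<?n. scale (Q $$ (i, j)) (bs ! i))"
    using change_of_basis[OF sub(2)] unfolding len by metis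
  have inter: "P * A = B * P" if "acts Y bs A" "acts Y cs B" "Vector_Spaces.linear scale scale Y" for A B Y
    using acts_intertwines[OF that(3,1,2)] sp len P PB by simp
  \<comment> \<open>Stated for arbitrary lists so as to give both P * Q = 1 and Q * P = 1.\<close>
  have unit: "R * T = 1\<^sub>m ?n" if R: "R \<in> carrier_mat ?n ?n" and T: "T \<in> carrier_mat ?n ?n"
    and us: "dim (span (set us)) = length us" "length us = ?n"
    and RU: "\<And>j. j < ?n \<Longrightarrow> vs ! j = (\<Sum>i<?n. scale (R $$ (i, j)) (us ! i))"
    and TU: "\<And>j. j < ?n \<Longrightarrow> us ! j = (\<Sum>i<?n. scale (T $$ (i, j)) (vs ! i))" for R T us vs
  proof (rule eq_matI)
    fix l j assume "l < dim_row (1\<^sub>m ?n :: 'k mat)" "j < dim_col (1\<^sub>m ?n :: 'k mat)"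
    then have l: "l < ?n" and j: "j < ?n" by auto
    have "us ! j = (\<Sum>i<?n. scale (T $$ (i, j)) (\<Sum>l<?n. scale (R $$ (l, i)) (us ! l)))"
      using TU[OF j] RU by simp
    also have "\<dots> = (\<Sum>l<?n. scale ((R * T) $$ (l, j)) (us ! l))"
      unfolding scale_sum_right scale_scale using R T j
      by (subst sum.swap) (auto simp: times_mat_def scalar_prod_def atLeast0LessThan scale_sum_left mult.commute intro!: sum.cong)
    finally have "(\<Sum>l<?n. scale (1\<^sub>m ?n $$ (l, j)) (us ! l)) = (\<Sum>l<?n. scale ((R * T) $$ (l, j)) (us ! l))"
      using acts_id[of us] us j by (simp add: acts_def)
    then show "(R * T) $$ (l, j) = 1\<^sub>m ?n $$ (l, j)"
      using spanning_list_unique[OF us(1), unfolded us(2)] l by metis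
  qed (use R T in auto)
  have "P * Q = 1\<^sub>m ?n" using unit[OF P Q _ _ PB QC] sp len by simp
  moreover have "Q * P = 1\<^sub>m ?n" using unit[OF Q P _ _ QC PB] sp len by simp
  ultimately have "invertible_mat P"
    unfolding invertible_mat_def inverts_mat_def using P Q by auto
  then show ?thesis unfolding hiso_def hd
    using P inter bs cs X act by (intro conjI exI[of _ P]) (auto simp: realizes_def)
qed

section \<open>The modules generated by the powers of X on one vector\<close>

text \<open>The hypothesis reads (X^sbar - beta)^t w = 0. The polynomial is monic, so X^(t sbar) w
  is a combination of lower powers with the coefficients \<open>Vcoeff\<close> of the last
  column.\<close>

lemma acts_Vmod2:
  assumes rel: "pcomb (\<lambda>j. (X ^^ (sbar * j)) w) ([:- beta, 1:] ^ t) = 0" and "sbar > 0"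
  shows "acts X (map (\<lambda>i. (X ^^ i) w) [0..<t * sbar]) (snd (Vmod2 chi sbar t lam beta))"
proof -
  let ?N = "t * sbar"
  have top: "(X ^^ ?N) w = (\<Sum>j<t. scale (Vcoeff t beta j) ((X ^^ (j * sbar)) w))"
  proof -
    have deg: "degree ([:- beta, 1:] ^ t) = t" by (simp add: degree_power_eq)
    have "coeff ([:- beta, 1:] ^ t) t = 1"
      using lead_coeff_power[of "[:- beta, 1:]" t] deg by simp
    then have "(X ^^ ?N) w + (\<Sum>j<t. scale (coeff ([:- beta, 1:] ^ t) j) ((X ^^ (sbar * j)) w)) = 0"
      using rel unfolding pcomb_def deg by (simp add: lessThan_Suc_atMost[symmetric] mult.commute add.commute)
    then show ?thesis
      by (simp add: Vcoeff_def sum_negf eq_neg_iff_add_eq_0 mult.commute)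
  qed
  show ?thesis
    unfolding acts_def
  proof (intro conjI allI impI)
    fix j assume "j < length (map (\<lambda>i. (X ^^ i) w) [0..<?N])"
    then have j: "j < ?N" by simp
    have "(\<Sum>i<?N. scale (snd (Vmod2 chi sbar t lam beta) $$ (i, j)) ((X ^^ i) w))
       = (\<Sum>i<?N. (if i = Suc j then (X ^^ i) w else 0)
           + (if j = ?N - 1 \<and> i mod sbar = 0 then scale (Vcoeff t beta (i div sbar)) ((X ^^ (i div sbar * sbar)) w) else 0))"
      using j by (intro sum.cong) (auto simp: Vmod2_def scale_left_distrib mod_eq_0_iff_dvd)
    \<comment> \<open>Writing the index as i * sbar + r, only r = 0 contributes to the last
      column.\<close>
    also have "\<dots> = (if Suc j < ?N then (X ^^ Suc j) w else 0)
        + (\<Sum>i<t. \<Sum>r<sbar. if j = ?N - 1 \<and> r = 0 then scale (Vcoeff t beta i) ((X ^^ (i * sbar)) w) else 0)"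
      unfolding sum.distrib sum_div_mod[symmetric] by simp
    also have "(\<Sum>i<t. \<Sum>r<sbar. if j = ?N - 1 \<and> r = 0 then scale (Vcoeff t beta i) ((X ^^ (i * sbar)) w) else 0)
        = (if j = ?N - 1 then (X ^^ ?N) w else 0)"
      unfolding top using assms(2) by (auto intro!: sum.cong)
    also have "(if Suc j < ?N then (X ^^ Suc j) w else 0) + (if j = ?N - 1 then (X ^^ ?N) w else 0) = (X ^^ Suc j) w"
    proof (cases "Suc j < ?N")
      case False
      then have "Suc j = ?N" using j by simp
      then show ?thesis unfolding \<open>Suc j = ?N\<close>[symmetric] by simp
    qed (use j in auto)
    finally show "X (map (\<lambda>i. (X ^^ i) w) [0..<?N] ! j) = (\<Sum>i<length (map (\<lambda>i. (X ^^ i) w) [0..<?N]).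
        scale (snd (Vmod2 chi sbar t lam beta) $$ (i, j)) (map (\<lambda>i. (X ^^ i) w) [0..<?N] ! i))"
      using j by simp
  qed (simp add: Vmod2_def)
qed

lemma realizes_Vmod2:
  assumes rel: "pcomb (\<lambda>j. (X ^^ (sbar * j)) w) ([:- beta, 1:] ^ t) = 0"
    and wt: "\<And>g i. g \<in> carrier G \<Longrightarrow> act g ((X ^^ i) w) = scale (chi g ^ i * lam g) ((X ^^ i) w)"
    and sbar: "sbar > 0"
  shows "realizes G act X (map (\<lambda>i. (X ^^ i) w) [0..<t * sbar]) (Vmod2 chi sbar t lam beta)"
proof -
  let ?N = "t * sbar"
  have "acts (act g) (map (\<lambda>i. (X ^^ i) w) [0..<?N]) (fst (Vmod2 chi sbar t lam beta) g)"
    if g: "g \<in> carrier G" for g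
    unfolding acts_def
  proof (intro conjI allI impI)
    fix j assume "j < length (map (\<lambda>i. (X ^^ i) w) [0..<?N])"
    then have j: "j < ?N" by simp
    have "(\<Sum>i<?N. scale (fst (Vmod2 chi sbar t lam beta) g $$ (i, j)) ((X ^^ i) w))
       = (\<Sum>i<?N. if i = j then scale (chi g ^ i * lam g) ((X ^^ i) w) else 0)"
      using j by (intro sum.cong) (auto simp: Vmod2_def)
    then show "act g (map (\<lambda>i. (X ^^ i) w) [0..<?N] ! j) = (\<Sum>i<length (map (\<lambda>i. (X ^^ i) w) [0..<?N]).
        scale (fst (Vmod2 chi sbar t lam beta) g $$ (i, j)) (map (\<lambda>i. (X ^^ i) w) [0..<?N] ! i))"
      using j wt[OF g] by simp
  qed (simp add: Vmod2_def)
  then show ?thesis using acts_Vmod2[OF rel sbar] by (simp add: realizes_def)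
qed

lemma realizes_Vmod:
  assumes rel: "(X ^^ N) w = 0"
    and wt: "\<And>g i. g \<in> carrier G \<Longrightarrow> act g ((X ^^ i) w) = scale (chi g ^ i * lam g) ((X ^^ i) w)"
  shows "realizes G act X (map (\<lambda>i. (X ^^ i) w) [0..<N]) (Vmod chi N lam)"
proof -
  have "acts X (map (\<lambda>i. (X ^^ i) w) [0..<N]) (snd (Vmod chi N lam))"
    unfolding acts_def
  proof (intro conjI allI impI)
    fix j assume "j < length (map (\<lambda>i. (X ^^ i) w) [0..<N])"
    then have j: "j < N" by simp
    have "(\<Sum>i<N. scale (snd (Vmod chi N lam) $$ (i, j)) ((X ^^ i) w)) = (\<Sum>i<N. if i = Suc j then (X ^^ i) w else 0)"
      using j by (intro sum.cong) (auto simp: Vmod_def)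
    also have "\<dots> = (X ^^ Suc j) w"
    proof (cases "Suc j < N")
      case False
      then have "Suc j = N" using j by simp
      then show ?thesis using rel by simp
    qed simp
    finally show "X (map (\<lambda>i. (X ^^ i) w) [0..<N] ! j) = (\<Sum>i<length (map (\<lambda>i. (X ^^ i) w) [0..<N]).
        scale (snd (Vmod chi N lam) $$ (i, j)) (map (\<lambda>i. (X ^^ i) w) [0..<N] ! i))"
      using j by simp
  qed (simp add: Vmod_def)
  moreover have "acts (act g) (map (\<lambda>i. (X ^^ i) w) [0..<N]) (fst (Vmod chi N lam) g)"
    if g: "g \<in> carrier G" for g
    unfolding acts_def
  proof (intro conjI allI impI)
    fix j assume "j < length (map (\<lambda>i. (X ^^ i) w) [0..<N])"
    then have j: "j < N" by simp
    have "(\<Sum>i<N. scale (fst (Vmod chi N lam) g $$ (i, j)) ((X ^^ i) w))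
       = (\<Sum>i<N. if i = j then scale (chi g ^ i * lam g) ((X ^^ i) w) else 0)"
      using j by (intro sum.cong) (auto simp: Vmod_def)
    then show "act g (map (\<lambda>i. (X ^^ i) w) [0..<N] ! j) = (\<Sum>i<length (map (\<lambda>i. (X ^^ i) w) [0..<N]).
        scale (fst (Vmod chi N lam) g $$ (i, j)) (map (\<lambda>i. (X ^^ i) w) [0..<N] ! i))"
      using j wt[OF g] by simp
  qed (simp add: Vmod_def)
  ultimately show ?thesis by (simp add: realizes_def)
qed

lemma acts_kron:
  assumes A: "A \<in> carrier_mat m m" and B: "B \<in> carrier_mat n n"
    and Y: "\<And>i j. i < m \<Longrightarrow> j < n \<Longrightarrow>
      Y (b i j) = (\<Sum>i'<m. \<Sum>j'<n. scale (A $$ (i', i) * B $$ (j', j)) (b i' j'))"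
  shows "acts Y (map (\<lambda>I. b (I div n) (I mod n)) [0..<m * n]) (kron A B)"
  unfolding acts_def
proof (intro conjI allI impI)
  fix J assume "J < length (map (\<lambda>I. b (I div n) (I mod n)) [0..<m * n])"
  then have J: "J < m * n" by simp
  then have n: "n > 0" by (cases n) auto
  have "Y (b (J div n) (J mod n)) = (\<Sum>i'<m. \<Sum>j'<n. scale (A $$ (i', J div n) * B $$ (j', J mod n)) (b i' j'))"
    using J n by (intro Y) (auto simp: less_mult_imp_div_less)
  also have "\<dots> = (\<Sum>I<m * n. scale (A $$ (I div n, J div n) * B $$ (I mod n, J mod n)) (b (I div n) (I mod n)))"
    by (rule sum_div_mod[symmetric])
  also have "\<dots> = (\<Sum>I<m * n. scale (kron A B $$ (I, J)) (b (I div n) (I mod n)))"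
    using A B J by (intro sum.cong) (auto simp: kron_def)
  finally show "Y (map (\<lambda>I. b (I div n) (I mod n)) [0..<m * n] ! J)
      = (\<Sum>i<length (map (\<lambda>I. b (I div n) (I mod n)) [0..<m * n]).
          scale (kron A B $$ (i, J)) (map (\<lambda>I. b (I div n) (I mod n)) [0..<m * n] ! i))"
    using J by simp
qed (use A B in \<open>simp add: kron_def\<close>)

lemma acts_add:
  assumes "acts Y bs A" and "acts Z bs B"
  shows "acts (\<lambda>v. Y v + Z v) bs (A + B)"
proof -
  have "Y (bs ! j) + Z (bs ! j) = (\<Sum>i<length bs. scale ((A + B) $$ (i, j)) (bs ! i))" if "j < length bs" for j
    using assms that unfolding acts_def
    by (auto simp: sum.distrib[symmetric] scale_left_distrib[symmetric] intro!: sum.cong)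
  then show ?thesis using assms by (auto simp: acts_def)
qed

end

lemma hdim_hdsum [simp]: "hdim (hdsum M N) = hdim M + hdim N"
  by (simp add: hdim_def hdsum_def)

lemma hdim_hdsums: "hdim (hdsums Ms) = sum_list (map hdim Ms)"
  by (induction Ms) (simp_all add: hdsums_def, simp add: hdim_def hzero_def)

section \<open>Shifts that carry a unipotent factor on every s-th step\<close>

context vspace
begin

context
  fixes F :: "nat \<Rightarrow> nat \<Rightarrow> 'v" and x :: "'v \<Rightarrow> 'v" and theta :: 'k and s s' d :: nat
  assumes lin: "Vector_Spaces.linear scale scale x"
    and x_F: "\<And>i p. x (F i p) = (if p mod s = s - 1 then scale theta (F i (Suc p) + F (Suc i) (Suc p)) else F i (Suc p))"
    and F_period: "\<And>i p. F i (p + s * s') = F i p"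
    and F_zero: "\<And>i p. i \<ge> d \<Longrightarrow> F i p = 0"
    and s_pos: "s > 0" and s'_pos: "s' > 0" and theta_nz: "theta \<noteq> 0"
begin

lemma shift_small_power:
  assumes "p mod s + l < s"
  shows "(x ^^ l) (F i p) = F i (p + l)"
  using assms
proof (induction l)
  case (Suc l)
  have "(p + l) mod s = p mod s + l"
    using Suc.prems by (metis mod_add_left_eq mod_less add_Suc_right Suc_lessD)
  moreover from this have "(p + l) mod s \<noteq> s - 1" using Suc.prems by simp
  ultimately show ?case using Suc by (simp add: x_F)
qed simp

text \<open>Wherever they start, s consecutive steps leave the residue s - 1 exactly once, so the
  factor theta (1 + \<epsilon>) is collected exactly once.\<close>

lemma shift_full_power: "(x ^^ s) (F i p) = scale theta (F i (p + s) + F (Suc i) (p + s))"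
proof -
  define u where "u = p mod s"
  \<comment> \<open>After v steps the residue is s - 1; the next step carries the factor, and u
    plain steps remain.\<close>
  define v where "v = s - 1 - u"
  have u: "u < s" using s_pos by (simp add: u_def)
  have s: "s = u + Suc v" using u by (simp add: v_def)
  have pv: "(p + v) mod s = s - 1"
  proof -
    have "(p + v) mod s = (u + v) mod s" unfolding u_def by (simp add: mod_add_left_eq)
    then show ?thesis using s by simp
  qed
  have psv: "Suc (p + v) mod s = 0"
    using pv s_pos by (metis Suc_pred' mod_Suc)
  have last_part: "(x ^^ u) (F i' (Suc (p + v))) = F i' (p + s)" for i'
  proof -
    have "(x ^^ u) (F i' (Suc (p + v))) = F i' (Suc (p + v) + u)"
      by (rule shift_small_power) (use psv u in simp)
    moreover have "Suc (p + v) + u = p + s" using s by simp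
    ultimately show ?thesis by (simp only:)
  qed
  have "(x ^^ s) (F i p) = (x ^^ u) (x ((x ^^ v) (F i p)))"
    using s funpow_add[of u "Suc v" x] by simp
  also have "(x ^^ v) (F i p) = F i (p + v)"
    by (rule shift_small_power) (use s u_def in linarith)
  also have "x (F i (p + v)) = scale theta (F i (Suc (p + v)) + F (Suc i) (Suc (p + v)))"
    by (simp add: x_F pv)
  also have "(x ^^ u) \<dots> = scale theta ((x ^^ u) (F i (Suc (p + v))) + (x ^^ u) (F (Suc i) (Suc (p + v))))"
    using linear_funpow[OF lin, of u] by (simp add: Vector_Spaces.linear_iff)
  also have "\<dots> = scale theta (F i (p + s) + F (Suc i) (p + s))" unfolding last_part ..
  finally show ?thesis .
qed

text \<open>Here T = \<tau>^s, kappa = theta and L = theta \<epsilon>; the powers of theta in the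
  family turn \<epsilon> into L.\<close>

lemma shift_twisted_chain:
  "twisted_chain scale (x ^^ s) (\<lambda>h k. scale (theta ^ k) (F k (s * h))) theta s' d"
proof (intro twisted_chain.intro twisted_chain_axioms.intro)
  fix h k
  have "s * h + s * s' = s * (h + s')" by (simp add: distrib_left)
  then show "scale (theta ^ k) (F k (s * (h + s'))) = scale (theta ^ k) (F k (s * h))"
    using F_period[of k "s * h"] by simp
  show "(x ^^ s) (scale (theta ^ k) (F k (s * h)))
      = scale theta (scale (theta ^ k) (F k (s * Suc h))) + scale (theta ^ Suc k) (F (Suc k) (s * Suc h))"
    using linear_funpow[OF lin, of s]
    by (simp add: Vector_Spaces.linear_iff shift_full_power scale_right_distrib add.commute mult.commute)
qed (simp_all add: vspace_axioms linear_funpow[OF lin] F_zero s'_pos)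

text \<open>This connects the model with the given modules: \<open>F 0 0\<close> satisfies the
  relation of V_d with parameter theta^s', and d is the nilpotency bound of \<epsilon>.\<close>

lemma shift_relation:
  "pcomb (\<lambda>j. (x ^^ (s * s' * j)) (F 0 0)) ([:- (theta ^ s'), 1:] ^ d) = 0"
proof -
  interpret twisted_chain scale "x ^^ s" "\<lambda>h k. scale (theta ^ k) (F k (s * h))" theta s' d
    by (rule shift_twisted_chain)
  show ?thesis using pcomb_funpow_U_eq_0[of 0] by (simp add: funpow_mult mult.assoc)
qed

text \<open>Positions divisible by s are reached by powers of x^s because theta \<noteq> 0; the
  others follow by fewer than s plain shifts.\<close>

lemma shift_generates:
  assumes S: "subspace S" and xS: "\<And>v. v \<in> S \<Longrightarrow> x v \<in> S" and gen: "F 0 0 \<in> S"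
  shows "F i p \<in> S"
proof -
  interpret twisted_chain scale "x ^^ s" "\<lambda>h k. scale (theta ^ k) (F k (s * h))" theta s' d
    by (rule shift_twisted_chain)
  have "scale (theta ^ i) (F i (s * (p div s))) \<in> S"
    by (rule e_in_invariant_subspace[OF theta_nz S, of 0]) (use gen in \<open>auto intro: funpow_in_closed xS\<close>)
  then have "scale (inverse (theta ^ i)) (scale (theta ^ i) (F i (s * (p div s)))) \<in> S"
    by (rule subspace_scale[OF S])
  then have "F i (s * (p div s)) \<in> S" using theta_nz by simp
  then have "(x ^^ (p mod s)) (F i (s * (p div s))) \<in> S" using xS by (intro funpow_in_closed)
  moreover have "(x ^^ (p mod s)) (F i (s * (p div s))) = F i (s * (p div s) + p mod s)"
    by (rule shift_small_power) (use s_pos in simp)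
  ultimately show ?thesis by simp
qed

end

lemma linear_agree_on_span:
  assumes "Vector_Spaces.linear scale scale f" and "Vector_Spaces.linear scale scale g"
    and "\<And>b. b \<in> B \<Longrightarrow> f b = g b" and "v \<in> span B"
  shows "f v = g v"
  using assms(4)
proof (induction rule: span_induct_alt)
  case base
  then show ?case using assms(1,2) by (simp add: module_hom.zero Vector_Spaces.linear_iff_module_hom)
next
  case (step c x y)
  then show ?case using assms(1-3) by (simp add: Vector_Spaces.linear_iff)
qed

lemma linear_compose_fun:
  assumes "Vector_Spaces.linear scale scale f" and "Vector_Spaces.linear scale scale g"
  shows "Vector_Spaces.linear scale scale (\<lambda>v. f (g v))"
  using assms by (simp add: Vector_Spaces.linear_iff)

lemma linear_add_fun:
  assumes "Vector_Spaces.linear scale scale f" and "Vector_Spaces.linear scale scale g"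
  shows "Vector_Spaces.linear scale scale (\<lambda>v. f v + g v)"
  using assms by (simp add: Vector_Spaces.linear_iff scale_right_distrib add_ac)

lemma linear_scale_fun:
  assumes "Vector_Spaces.linear scale scale f"
  shows "Vector_Spaces.linear scale scale (\<lambda>v. scale c (f v))"
  using assms by (simp add: Vector_Spaces.linear_iff scale_right_distrib mult.commute)

end

section \<open>A model of the tensor product\<close>

text \<open>\<open>E i p j r\<close> stands for \<open>\<epsilon>^i \<tau>^p \<otimes> \<delta>^j \<tau>'^r\<close> in \<open>k[\<epsilon>, \<tau>]/(\<epsilon>^n, \<tau>^sbar - 1) \<otimes> k[\<delta>, \<tau>']/(\<delta>^t, \<tau>'^sbar - 1)\<close>.
  The operator \<open>x1\<close> is \<open>\<tau>\<close>, except that every \<open>s\<close>-th step carries the factor \<open>theta (1 + \<epsilon>)\<close>; thus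
  \<open>x1^s = theta (1 + \<epsilon>) \<tau>^s\<close> exactly, and no roots of unipotent operators have to be taken.\<close>

locale tensor_model = vspace scale
  for scale :: "'k::field_char_0 \<Rightarrow> 'v::ab_group_add \<Rightarrow> 'v" +
  fixes G :: "('g, 'c) monoid_scheme" and a :: 'g and chi sigma lam :: "'g \<Rightarrow> 'k"
    and s s' n t :: nat and xi theta eta :: 'k
    and E :: "nat \<Rightarrow> nat \<Rightarrow> nat \<Rightarrow> nat \<Rightarrow> 'v" and x1 x2 a2 :: "'v \<Rightarrow> 'v" and act :: "'g \<Rightarrow> 'v \<Rightarrow> 'v"
  assumes a_in: "a \<in> carrier G"
    and q_root: "chi a ^ s = 1" and q_prim: "\<And>i. 0 < i \<Longrightarrow> i < s \<Longrightarrow> chi a ^ i \<noteq> 1"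
    and chi_root: "\<And>g. g \<in> carrier G \<Longrightarrow> chi g ^ (s * s') = 1"
    and xi_root: "xi ^ s' = 1" and xi_prim: "\<And>i. 0 < i \<Longrightarrow> i < s' \<Longrightarrow> xi ^ i \<noteq> 1"
    and s_pos: "s > 0" and s'_pos: "s' > 0"
    and lam_nz: "lam a \<noteq> 0" and theta_nz: "theta \<noteq> 0" and eta_nz: "eta \<noteq> 0"
    and lin_x1: "Vector_Spaces.linear scale scale x1" and lin_x2: "Vector_Spaces.linear scale scale x2"
    and lin_a2: "Vector_Spaces.linear scale scale a2"
    and lin_act: "\<And>g. Vector_Spaces.linear scale scale (act g)"
    and E_zero: "\<And>i p j r. i \<ge> n \<or> j \<ge> t \<Longrightarrow> E i p j r = 0"
    and E_period1: "\<And>i p j r. E i (p + s * s') j r = E i p j r"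
    and E_period2: "\<And>i p j r. E i p j (r + s * s') = E i p j r"
    and x1_E: "\<And>i p j r. x1 (E i p j r) =
      (if p mod s = s - 1 then scale theta (E i (Suc p) j r + E (Suc i) (Suc p) j r) else E i (Suc p) j r)"
    and x2_E: "\<And>i p j r. x2 (E i p j r) =
      (if r mod s = s - 1 then scale eta (E i p j (Suc r) + E i p (Suc j) (Suc r)) else E i p j (Suc r))"
    and a2_E: "\<And>i p j r. a2 (E i p j r) = scale (chi a ^ r * lam a) (E i p j r)"
    and act_E: "\<And>g i p j r. g \<in> carrier G \<Longrightarrow>
      act g (E i p j r) = scale (chi g ^ (p + r) * (sigma g * lam g)) (E i p j r)"
begin

definition W :: "'v set" where "W = span (range (\<lambda>(i, p, j, r). E i p j r))"

text \<open>Delta(x) = x \<otimes> a + 1 \<otimes> x, with \<open>a2\<close> the action of a on the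
  second factor.\<close>

definition X :: "'v \<Rightarrow> 'v" where "X v = x1 (a2 v) + x2 v"

abbreviation "sbar \<equiv> s * s'"

lemma sbar_pos: "sbar > 0" using s_pos s'_pos by simp

lemma E_in_W: "E i p j r \<in> W"
  unfolding W_def by (rule span_base) (auto intro: image_eqI[of _ _ "(i, p, j, r)"])

lemma subspace_W: "subspace W" by (simp add: W_def)

lemma W_closedI:
  assumes "Vector_Spaces.linear scale scale f" and "\<And>i p j r. f (E i p j r) \<in> W" and "v \<in> W"
  shows "f v \<in> W"
  unfolding W_def
  by (rule linear_span_closed[OF assms(1) _ assms(3)[unfolded W_def]]) (use assms(2) in \<open>auto simp: W_def\<close>)

lemma W_eqI:
  assumes "Vector_Spaces.linear scale scale f" and "Vector_Spaces.linear scale scale g"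
    and "\<And>i p j r. f (E i p j r) = g (E i p j r)" and "v \<in> W"
  shows "f v = g v"
  by (rule linear_agree_on_span[OF assms(1,2) _ assms(4)[unfolded W_def]]) (use assms(3) in auto)

lemma W_subsetI:
  assumes "subspace S" and "\<And>i p j r. E i p j r \<in> S"
  shows "W \<subseteq> S"
  using assms unfolding W_def by (intro span_minimal) auto

lemma x1_W: "v \<in> W \<Longrightarrow> x1 v \<in> W"
  by (rule W_closedI[OF lin_x1]) (auto simp: x1_E intro!: subspace_scale subspace_add subspace_W E_in_W)

lemma x2_W: "v \<in> W \<Longrightarrow> x2 v \<in> W"
  by (rule W_closedI[OF lin_x2]) (auto simp: x2_E intro!: subspace_scale subspace_add subspace_W E_in_W)

lemma a2_W: "v \<in> W \<Longrightarrow> a2 v \<in> W"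
  by (rule W_closedI[OF lin_a2]) (auto simp: a2_E intro!: subspace_scale subspace_W E_in_W)

lemma X_W: "v \<in> W \<Longrightarrow> X v \<in> W"
  unfolding X_def by (intro subspace_add subspace_W x1_W x2_W a2_W)

lemma lin_X: "Vector_Spaces.linear scale scale X"
  unfolding X_def[abs_def] by (rule linear_add_fun[OF linear_compose_fun[OF lin_x1 lin_a2] lin_x2])

lemmas lin_simps = lin_x1[unfolded Vector_Spaces.linear_iff] lin_x2[unfolded Vector_Spaces.linear_iff]
  lin_a2[unfolded Vector_Spaces.linear_iff] lin_act[unfolded Vector_Spaces.linear_iff]
  lin_X[unfolded Vector_Spaces.linear_iff]

lemma x1_x2: "v \<in> W \<Longrightarrow> x1 (x2 v) = x2 (x1 v)"
  by (rule W_eqI[OF linear_compose_fun[OF lin_x1 lin_x2] linear_compose_fun[OF lin_x2 lin_x1]])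
     (simp_all add: x1_E x2_E lin_simps scale_right_distrib add_ac mult.commute)

lemma a2_x1: "v \<in> W \<Longrightarrow> a2 (x1 v) = x1 (a2 v)"
  by (rule W_eqI[OF linear_compose_fun[OF lin_a2 lin_x1] linear_compose_fun[OF lin_x1 lin_a2]])
     (simp_all add: x1_E a2_E lin_simps scale_right_distrib mult_ac)

lemma a2_x2: "v \<in> W \<Longrightarrow> a2 (x2 v) = scale (chi a) (x2 (a2 v))"
  by (rule W_eqI[OF linear_compose_fun[OF lin_a2 lin_x2] linear_scale_fun[OF linear_compose_fun[OF lin_x2 lin_a2]]])
     (simp_all add: x2_E a2_E lin_simps scale_right_distrib mult_ac)

section \<open>Weight spaces of the group\<close>

definition weight :: "nat \<Rightarrow> 'v set" where
  "weight k = {v \<in> W. \<forall>g\<in>carrier G. act g v = scale (chi g ^ k * (sigma g * lam g)) v}"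

lemma weightD: "v \<in> weight k \<Longrightarrow> g \<in> carrier G \<Longrightarrow> act g v = scale (chi g ^ k * (sigma g * lam g)) v"
  by (simp add: weight_def)

lemma weight_W: "v \<in> weight k \<Longrightarrow> v \<in> W"
  by (simp add: weight_def)

lemma subspace_weight: "subspace (weight k)"
proof -
  have "act g 0 = 0" for g
    using lin_act[of g] by (simp add: module_hom.zero Vector_Spaces.linear_iff_module_hom)
  then show ?thesis unfolding subspace_def weight_def
    by (auto simp: lin_simps scale_right_distrib mult_ac
      intro: subspace_0 subspace_add subspace_scale subspace_W)
qed

lemma weight_sbar: "weight (k + sbar * j) = weight k"
proof -
  have "chi g ^ (k + sbar * j) = chi g ^ k" if "g \<in> carrier G" for g
    using chi_root[OF that] by (simp add: power_add power_mult)
  then show ?thesis by (simp add: weight_def)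
qed

lemma E_weight: "E i p j r \<in> weight (p + r)"
  by (simp add: weight_def E_in_W act_E)

lemma act_x1: "g \<in> carrier G \<Longrightarrow> v \<in> W \<Longrightarrow> act g (x1 v) = scale (chi g) (x1 (act g v))"
  by (rule W_eqI[OF linear_compose_fun[OF lin_act lin_x1] linear_scale_fun[OF linear_compose_fun[OF lin_x1 lin_act]]])
     (simp_all add: x1_E act_E lin_simps scale_right_distrib mult_ac)

lemma act_x2: "g \<in> carrier G \<Longrightarrow> v \<in> W \<Longrightarrow> act g (x2 v) = scale (chi g) (x2 (act g v))"
  by (rule W_eqI[OF linear_compose_fun[OF lin_act lin_x2] linear_scale_fun[OF linear_compose_fun[OF lin_x2 lin_act]]])
     (simp_all add: x2_E act_E lin_simps scale_right_distrib mult_ac)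

lemma act_a2: "g \<in> carrier G \<Longrightarrow> v \<in> W \<Longrightarrow> act g (a2 v) = a2 (act g v)"
  by (rule W_eqI[OF linear_compose_fun[OF lin_act lin_a2] linear_compose_fun[OF lin_a2 lin_act]])
     (simp_all add: a2_E act_E lin_simps mult_ac)

lemma weight_x1: "v \<in> weight k \<Longrightarrow> x1 v \<in> weight (Suc k)"
  by (auto simp: weight_def x1_W act_x1 lin_simps mult.assoc)

lemma weight_x2: "v \<in> weight k \<Longrightarrow> x2 v \<in> weight (Suc k)"
  by (auto simp: weight_def x2_W act_x2 lin_simps mult.assoc)

lemma weight_a2: "v \<in> weight k \<Longrightarrow> a2 v \<in> weight k"
  by (auto simp: weight_def a2_W act_a2 lin_simps)

lemma weight_X: "v \<in> weight k \<Longrightarrow> X v \<in> weight (Suc k)"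
  unfolding X_def by (intro subspace_add subspace_weight weight_x1 weight_x2 weight_a2)

lemma weight_funpow:
  assumes "\<And>v k. v \<in> weight k \<Longrightarrow> f v \<in> weight (Suc k)" and "v \<in> weight k"
  shows "(f ^^ i) v \<in> weight (k + i)"
  using assms by (induction i) auto

lemma funpow_X_W: "v \<in> W \<Longrightarrow> (X ^^ k) v \<in> W"
  using X_W by (rule funpow_in_closed)

lemma funpow_x1_W: "v \<in> W \<Longrightarrow> (x1 ^^ k) v \<in> W"
  using x1_W by (rule funpow_in_closed)

lemma funpow_x2_W: "v \<in> W \<Longrightarrow> (x2 ^^ k) v \<in> W"
  using x2_W by (rule funpow_in_closed)

text \<open>\<open>m i j\<close> is the basis vector \<open>m_i \<otimes> m_j\<close> of the tensor product.\<close>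

definition m :: "nat \<Rightarrow> nat \<Rightarrow> 'v" where "m i j = (x1 ^^ i) ((x2 ^^ j) (E 0 0 0 0))"

lemma m_W: "m i j \<in> W"
  unfolding m_def by (intro funpow_x1_W funpow_x2_W E_in_W)

lemma m_weight: "m i j \<in> weight (i + j)"
proof -
  have "(x2 ^^ j) (E 0 0 0 0) \<in> weight (0 + j)" using weight_x2 E_weight[of 0 0 0 0] by (intro weight_funpow) auto
  then show ?thesis unfolding m_def using weight_x1 weight_funpow[of x1 _ j i] by (simp add: add.commute)
qed

lemma x2_funpow_x1: "v \<in> W \<Longrightarrow> x2 ((x1 ^^ i) v) = (x1 ^^ i) (x2 v)"
  by (induction i) (simp_all add: funpow_x1_W x1_x2[symmetric])

lemma x1_funpow_x2: "v \<in> W \<Longrightarrow> x1 ((x2 ^^ j) v) = (x2 ^^ j) (x1 v)"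
  by (induction j) (simp_all add: funpow_x2_W x1_x2)

lemma funpow_x1_x2: "v \<in> W \<Longrightarrow> (x1 ^^ i) ((x2 ^^ j) v) = (x2 ^^ j) ((x1 ^^ i) v)"
  by (induction i) (simp_all add: funpow_x1_W x1_funpow_x2)

lemma a2_funpow_x1: "v \<in> W \<Longrightarrow> a2 ((x1 ^^ i) v) = (x1 ^^ i) (a2 v)"
  by (induction i) (simp_all add: funpow_x1_W a2_x1)

lemma a2_m: "a2 (m i j) = scale (chi a ^ j * lam a) (m i j)"
proof -
  have "a2 ((x2 ^^ j) (E 0 0 0 0)) = scale (chi a ^ j * lam a) ((x2 ^^ j) (E 0 0 0 0))"
    by (induction j) (simp_all add: a2_E a2_x2 funpow_x2_W E_in_W lin_simps mult_ac)
  then show ?thesis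
    unfolding m_def using linear_funpow[OF lin_x1, of i]
    by (simp add: a2_funpow_x1 funpow_x2_W E_in_W Vector_Spaces.linear_iff)
qed

lemma x1_relation:
  "pcomb (\<lambda>k. (x1 ^^ (sbar * k)) (E 0 0 0 0)) ([:- (theta ^ s'), 1:] ^ n) = 0"
  by (rule shift_relation[where F = "\<lambda>i p. E i p 0 0"])
     (simp_all add: lin_x1 x1_E E_period1 E_zero s_pos s'_pos theta_nz)

lemma x2_relation:
  "pcomb (\<lambda>k. (x2 ^^ (sbar * k)) (E 0 0 0 0)) ([:- (eta ^ s'), 1:] ^ t) = 0"
  by (rule shift_relation[where F = "\<lambda>j r. E 0 0 j r"])
     (simp_all add: lin_x2 x2_E E_period2 E_zero s_pos s'_pos eta_nz)

text \<open>The power of \<open>x2\<close> commutes with \<open>x1\<close> and carries the relation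
  of \<open>E 0 0 0 0\<close> over to the start of the j-th column.\<close>

lemma x1_m:
  assumes "i < n * sbar"
  shows "x1 (m i j) = (\<Sum>i'<n * sbar. scale (snd (Vmod2 chi sbar n sigma (theta ^ s')) $$ (i', i)) (m i' j))"
proof -
  let ?w = "(x2 ^^ j) (E 0 0 0 0)"
  have "pcomb (\<lambda>k. (x1 ^^ (sbar * k)) ?w) ([:- (theta ^ s'), 1:] ^ n)
      = (x2 ^^ j) (pcomb (\<lambda>k. (x1 ^^ (sbar * k)) (E 0 0 0 0)) ([:- (theta ^ s'), 1:] ^ n))"
    by (simp add: pcomb_linear[OF linear_funpow[OF lin_x2]] funpow_x1_x2 E_in_W)
  also have "\<dots> = 0"
    unfolding x1_relation using linear_funpow[OF lin_x2, of j]
    by (simp add: module_hom.zero Vector_Spaces.linear_iff_module_hom)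
  finally have "acts x1 (map (\<lambda>i. (x1 ^^ i) ?w) [0..<n * sbar]) (snd (Vmod2 chi sbar n sigma (theta ^ s')))"
    using sbar_pos by (rule acts_Vmod2)
  then show ?thesis using assms unfolding acts_def m_def by simp
qed

lemma x2_m:
  assumes "j < t * sbar"
  shows "x2 (m i j) = (\<Sum>j'<t * sbar. scale (snd (Vmod2 chi sbar t lam (eta ^ s')) $$ (j', j)) (m i j'))"
proof -
  have "acts x2 (map (\<lambda>j. (x2 ^^ j) (E 0 0 0 0)) [0..<t * sbar]) (snd (Vmod2 chi sbar t lam (eta ^ s')))"
    using x2_relation sbar_pos by (rule acts_Vmod2)
  then have "x2 ((x2 ^^ j) (E 0 0 0 0))
      = (\<Sum>j'<t * sbar. scale (snd (Vmod2 chi sbar t lam (eta ^ s')) $$ (j', j)) ((x2 ^^ j') (E 0 0 0 0)))"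
    using assms unfolding acts_def by simp
  then show ?thesis
    unfolding m_def using linear_funpow[OF lin_x1, of i]
    by (simp add: x2_funpow_x1 funpow_x2_W E_in_W module_hom.sum module_hom.scale Vector_Spaces.linear_iff_module_hom)
qed

abbreviation "tensor_basis \<equiv> map (\<lambda>I. m (I div (t * sbar)) (I mod (t * sbar))) [0..<n * sbar * (t * sbar)]"

lemma Vmod2_g_index:
  assumes "i < d * r" and "j < d * r"
  shows "fst (Vmod2 chi r d l b) g $$ (i, j) = (if i = j then chi g ^ i * l g else 0)"
  using assms by (simp add: Vmod2_def)

lemma tensor_basis_realizes:
  "realizes G act X tensor_basis
     (htensor a (Vmod2 chi sbar n sigma (theta ^ s')) (Vmod2 chi sbar t lam (eta ^ s')))"
proof -
  let ?M = "Vmod2 chi sbar n sigma (theta ^ s')" and ?N = "Vmod2 chi sbar t lam (eta ^ s')"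
  let ?dM = "n * sbar" and ?dN = "t * sbar"
  have M: "snd ?M \<in> carrier_mat ?dM ?dM" "fst ?M g \<in> carrier_mat ?dM ?dM"
    and N: "snd ?N \<in> carrier_mat ?dN ?dN" "fst ?N g \<in> carrier_mat ?dN ?dN" for g
    by (simp_all add: Vmod2_def)
  have "acts (\<lambda>v. x1 (a2 v)) tensor_basis (kron (snd ?M) (fst ?N a))"
  proof (rule acts_kron[OF M(1) N(2)])
    fix i j assume ij: "i < ?dM" "j < ?dN"
    have "(\<Sum>j'<?dN. scale (snd ?M $$ (i', i) * fst ?N a $$ (j', j)) (m i' j'))
        = (\<Sum>j'<?dN. if j' = j then scale (snd ?M $$ (i', i) * (chi a ^ j * lam a)) (m i' j) else 0)" for i'
      using ij by (intro sum.cong) (auto simp: Vmod2_g_index)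
    then show "x1 (a2 (m i j)) = (\<Sum>i'<?dM. \<Sum>j'<?dN. scale (snd ?M $$ (i', i) * fst ?N a $$ (j', j)) (m i' j'))"
      using ij by (simp add: a2_m lin_simps x1_m scale_sum_right mult.commute)
  qed
  moreover have "acts x2 tensor_basis (kron (1\<^sub>m ?dM) (snd ?N))"
  proof (rule acts_kron[OF _ N(1)])
    fix i j assume ij: "i < ?dM" "j < ?dN"
    have "(\<Sum>i'<?dM. \<Sum>j'<?dN. scale (1\<^sub>m ?dM $$ (i', i) * snd ?N $$ (j', j)) (m i' j'))
        = (\<Sum>i'<?dM. if i' = i then \<Sum>j'<?dN. scale (snd ?N $$ (j', j)) (m i j') else 0)"
      using ij by (intro sum.cong) auto
    then show "x2 (m i j) = (\<Sum>i'<?dM. \<Sum>j'<?dN. scale (1\<^sub>m ?dM $$ (i', i) * snd ?N $$ (j', j)) (m i' j'))"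
      using ij by (simp add: x2_m)
  qed simp
  ultimately have "acts X tensor_basis (kron (snd ?M) (fst ?N a) + kron (1\<^sub>m ?dM) (snd ?N))"
    unfolding X_def[abs_def] by (rule acts_add)
  moreover have "acts (act g) tensor_basis (kron (fst ?M g) (fst ?N g))" if g: "g \<in> carrier G" for g
  proof (rule acts_kron[OF M(2) N(2)])
    fix i j assume ij: "i < ?dM" "j < ?dN"
    have "(\<Sum>j'<?dN. scale (fst ?M g $$ (i', i) * fst ?N g $$ (j', j)) (m i' j'))
        = (\<Sum>j'<?dN. if j' = j then scale (fst ?M g $$ (i', i) * (chi g ^ j * lam g)) (m i' j) else 0)" for i'
      using ij by (intro sum.cong) (auto simp: Vmod2_g_index)
    then have "(\<Sum>i'<?dM. \<Sum>j'<?dN. scale (fst ?M g $$ (i', i) * fst ?N g $$ (j', j)) (m i' j'))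
        = (\<Sum>i'<?dM. scale (fst ?M g $$ (i', i) * (chi g ^ j * lam g)) (m i' j))"
      using ij by simp
    also have "\<dots> = (\<Sum>i'<?dM. if i' = i then scale (chi g ^ i * sigma g * (chi g ^ j * lam g)) (m i j) else 0)"
      using ij by (intro sum.cong) (auto simp: Vmod2_g_index)
    finally show "act g (m i j) = (\<Sum>i'<?dM. \<Sum>j'<?dN. scale (fst ?M g $$ (i', i) * fst ?N g $$ (j', j)) (m i' j'))"
      using ij by (simp add: weightD[OF m_weight g] power_add mult_ac)
  qed
  moreover have "hdim ?M = ?dM" by (simp add: hdim_def Vmod2_def)
  ultimately show ?thesis by (simp add: realizes_def htensor_def)
qed

text \<open>The span contains \<open>E 0 0 0 0\<close> and is stable under \<open>x1\<close> and
  \<open>x2\<close>, so \<open>shift_generates\<close> recovers every E, along the first factor and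
  then along the second.\<close>

lemma tensor_basis_span:
  assumes "n > 0" and "t > 0"
  shows "span (set tensor_basis) = W"
proof
  show "span (set tensor_basis) \<subseteq> W"
    by (intro span_minimal subspace_W) (auto simp: m_W)
  let ?S = "span (set tensor_basis)"
  let ?dM = "n * sbar" and ?dN = "t * sbar"
  have dpos: "?dM > 0" "?dN > 0" using assms sbar_pos by auto
  have m_in: "m i j \<in> ?S" if "i < ?dM" "j < ?dN" for i j
  proof (rule span_base)
    have "i * ?dN + j < ?dM * ?dN"
      using that by (metis add_less_cancel_left add.commute less_le_trans mult_Suc mult_le_mono1 Suc_leI)
    moreover have "(i * d + j) div d = i \<and> (i * d + j) mod d = j" if "j < d" for d :: nat
      using that by auto
    note this[OF that(2)]
    ultimately have "m i j = m ((i * ?dN + j) div ?dN) ((i * ?dN + j) mod ?dN)"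
      and "i * ?dN + j \<in> set [0..<?dM * ?dN]" by simp_all
    then show "m i j \<in> set tensor_basis" unfolding set_map by (rule image_eqI)
  qed
  have basis: "\<exists>i<?dM. \<exists>j<?dN. b = m i j" if b: "b \<in> set tensor_basis" for b
  proof -
    obtain I where I: "I < ?dM * ?dN" "b = m (I div ?dN) (I mod ?dN)" using b by auto
    then show ?thesis using dpos by (intro exI[of _ "I div ?dN"] conjI exI[of _ "I mod ?dN"])
        (auto simp: less_mult_imp_div_less)
  qed
  have c1: "x1 v \<in> ?S" if "v \<in> ?S" for v
    using lin_x1 _ that
  proof (rule linear_span_closed)
    fix b assume "b \<in> set tensor_basis"
    then obtain i j where "i < ?dM" "j < ?dN" "b = m i j" using basis by blast
    then show "x1 b \<in> ?S" by (simp add: x1_m del: set_map) (intro span_sum span_scale m_in, auto)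
  qed
  have c2: "x2 v \<in> ?S" if "v \<in> ?S" for v
    using lin_x2 _ that
  proof (rule linear_span_closed)
    fix b assume "b \<in> set tensor_basis"
    then obtain i j where "i < ?dM" "j < ?dN" "b = m i j" using basis by blast
    then show "x2 b \<in> ?S" by (simp add: x2_m del: set_map) (intro span_sum span_scale m_in, auto)
  qed
  have E0: "E 0 0 0 0 \<in> ?S" using m_in[of 0 0] dpos unfolding m_def by simp
  have E1: "E i p 0 0 \<in> ?S" for i p
    by (rule shift_generates[where F = "\<lambda>i p. E i p 0 0" and x = x1 and theta = theta and s = s and s' = s' and d = n])
       (assumption | rule lin_x1 x1_E E_period1 s_pos s'_pos theta_nz subspace_span c1 E0 | simp add: E_zero)+
  have "E i p j r \<in> ?S" for i p j r
    by (rule shift_generates[where F = "\<lambda>j r. E i p j r" and x = x2 and theta = eta and s = s and s' = s' and d = t])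
       (assumption | rule lin_x2 x2_E E_period2 s_pos s'_pos eta_nz subspace_span c2 E1 | simp add: E_zero)+
  then show "W \<subseteq> ?S" using subspace_span by (intro W_subsetI)
qed

end

section \<open>Decomposition of the model\<close>

lemma periodic_add_mult:
  fixes f :: "nat \<Rightarrow> 'a"
  assumes "\<And>r. f (r + N) = f r"
  shows "f (r + N * k) = f r"
proof (induction k)
  case (Suc k)
  have "f (r + N * Suc k) = f (r + N * k + N)" by (simp add: algebra_simps)
  with Suc show ?case by (simp only: assms)
qed simp

lemma sum_lessThan_Suc_periodic:
  fixes f :: "nat \<Rightarrow> 'a::cancel_comm_monoid_add"
  assumes "f N = f 0"
  shows "(\<Sum>r<N. f (Suc r)) = (\<Sum>r<N. f r)"
proof -
  have "f 0 + (\<Sum>r<N. f (Suc r)) = (\<Sum>r<N. f r) + f N"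
    using sum.lessThan_Suc_shift[of f N] by simp
  then show ?thesis using assms by (simp add: add.commute)
qed

lemma sum_root_of_unity:
  fixes z :: "'a::field"
  assumes "z ^ N = 1" and "z \<noteq> 1"
  shows "(\<Sum>i<N. z ^ i) = 0"
  using assms by (simp add: sum_gp_strict)

context vspace
begin

lemma dcomb_linear:
  assumes "Vector_Spaces.linear scale scale Y"
  shows "Y (dcomb n t D c) = dcomb n t (\<lambda>i j. Y (D i j)) c"
  using assms unfolding dcomb_def
  by (simp add: module_hom.sum module_hom.scale Vector_Spaces.linear_iff_module_hom)

lemma dcomb_add_family: "dcomb n t (\<lambda>i j. D i j + D' i j) c = dcomb n t D c + dcomb n t D' c"
  by (simp add: dcomb_def scale_right_distrib sum.distrib)

lemma dcomb_scale_family: "dcomb n t (\<lambda>i j. scale x (D i j)) c = scale x (dcomb n t D c)"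
  by (simp add: dcomb_def scale_sum_right mult.commute)

lemma dcomb_in_subspace:
  assumes "subspace S" and "\<And>i j. D i j \<in> S"
  shows "dcomb n t D c \<in> S"
  unfolding dcomb_def using assms by (intro subspace_sum subspace_scale) auto

end

context tensor_model
begin

definition kappa :: "nat \<Rightarrow> 'k" where "kappa k = theta * lam a ^ s + eta * xi ^ k"

lemma x1_power_E: "(x1 ^^ s) (E i p j r) = scale theta (E i (p + s) j r + E (Suc i) (p + s) j r)"
  by (rule shift_full_power[where F = "\<lambda>i p. E i p j r" and s' = s' and d = n])
     (assumption | rule lin_x1 x1_E E_period1 s_pos s'_pos theta_nz | simp add: E_zero)+

lemma x2_power_E: "(x2 ^^ s) (E i p j r) = scale eta (E i p j (r + s) + E i p (Suc j) (r + s))"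
  by (rule shift_full_power[where F = "\<lambda>j r. E i p j r" and s' = s' and d = t])
     (assumption | rule lin_x2 x2_E E_period2 s_pos s'_pos eta_nz | simp add: E_zero)+

text \<open>The eigenvalue chi(a)^r lam(a) depends on r, but its s-th power does not, since chi(a)^s
  = 1.\<close>

lemma a2_power: 
  assumes "v \<in> W"
  shows "(a2 ^^ s) v = scale (lam a ^ s) v"
proof (rule W_eqI[OF linear_funpow[OF lin_a2] linear_scale_fun _ assms])
  show "Vector_Spaces.linear scale scale (\<lambda>v. v)"
    using linear_funpow[OF lin_a2, of 0] by (simp add: id_def)
  fix i p j r
  have "(a2 ^^ k) (E i p j r) = scale ((chi a ^ r * lam a) ^ k) (E i p j r)" for k
    by (induction k) (simp_all add: a2_E lin_simps mult.commute)
  moreover have "(chi a ^ r * lam a) ^ s = lam a ^ s"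
    using q_root by (simp add: power_mult_distrib power_mult[symmetric] mult.commute[of r]) (simp add: power_mult)
  ultimately show "(a2 ^^ s) (E i p j r) = scale (lam a ^ s) (E i p j r)" by simp
qed

text \<open>For A = x1 a2 and B = x2 one has A B = chi(a) B A on W, the scalar arising when a2
  passes x2.\<close>

lemma X_power_s:
  assumes v: "v \<in> W"
  shows "(X ^^ s) v = scale (lam a ^ s) ((x1 ^^ s) v) + (x2 ^^ s) v"
proof -
  have "(X ^^ s) v = ((\<lambda>v. x1 (a2 v)) ^^ s) v + (x2 ^^ s) v"
    unfolding X_def[abs_def]
    by (rule q_freshmans_dream[where S = W and q = "chi a", OF linear_compose_fun[OF lin_x1 lin_a2] lin_x2])
       (simp_all add: x1_W x2_W a2_W v a2_x2 lin_simps x1_x2 q_root q_prim s_pos)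
  also have "((\<lambda>v. x1 (a2 v)) ^^ k) v = (x1 ^^ k) ((a2 ^^ k) v)" for k
  proof (induction k)
    case (Suc k)
    have "(a2 ^^ k) v \<in> W" using a2_W v by (rule funpow_in_closed)
    then show ?case using Suc by (simp add: a2_funpow_x1)
  qed simp
  finally show ?thesis
    using linear_funpow[OF lin_x1, of s] by (simp add: a2_power[OF v] Vector_Spaces.linear_iff)
qed

lemma X_power_E: "(X ^^ s) (E i p j r) = scale (theta * lam a ^ s) (E i (p + s) j r + E (Suc i) (p + s) j r)
    + scale eta (E i p j (r + s) + E i p (Suc j) (r + s))"
  by (simp add: X_power_s E_in_W x1_power_E x2_power_E mult.commute)

text \<open>A discrete Fourier transform along \<open>r\<close>; \<open>(s' - 1) * r\<close> plays the role of \<open>- r\<close> modulo \<open>s'\<close>,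
  so that the weight \<open>p + s * h\<close> is kept.\<close>

definition dft :: "nat \<Rightarrow> nat \<Rightarrow> nat \<Rightarrow> nat \<Rightarrow> nat \<Rightarrow> 'v" where
  "dft p k h i j = (\<Sum>r<s'. scale ((inverse xi ^ k) ^ r) (E i (p + s * (h + (s' - 1) * r)) j (s * r)))"

lemma xi_nz: "xi \<noteq> 0"
  using xi_root s'_pos by (metis power_0_left zero_neq_one less_irrefl)

text \<open>Advancing either factor by s leads to row \<open>Suc h\<close>. On the second factor it
  also shifts the summation index, which produces the eigenvalue xi^k.\<close>

lemma X_power_dft: "(X ^^ s) (dft p k h i j)
    = scale (theta * lam a ^ s) (dft p k (Suc h) i j + dft p k (Suc h) (Suc i) j)
      + scale (eta * xi ^ k) (dft p k (Suc h) i j + dft p k (Suc h) i (Suc j))"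
proof -
  define y where "y = inverse xi ^ k"
  define f where "f i j r = scale (y ^ r) (E i (p + s * (Suc h + (s' - 1) * r)) j (s * r))" for i j r
  have D: "dft p k (Suc h) i j = (\<Sum>r<s'. f i j r)" for i j
    by (simp add: dft_def f_def y_def)
  have y: "y ^ s' = 1" "y * xi ^ k = 1" "y \<noteq> 0"
    using xi_root xi_nz by (simp_all add: y_def power_inverse power_mult[symmetric] mult.commute[of k])
      (simp add: power_mult)
  \<comment> \<open>The summand takes the same value at r = 0 and r = s', so the sum is unchanged
    when r is shifted by one.\<close>
  have per: "f i j s' = f i j 0" for i j
  proof -
    have "E i (p + s * (Suc h + (s' - 1) * s')) j (s * s') = E i (p + s * Suc h + s * s' * (s' - 1)) j (0 + s * s')"
      by (simp add: algebra_simps)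
    also have "\<dots> = E i (p + s * Suc h) j 0"
      unfolding E_period2 by (rule periodic_add_mult[where f = "\<lambda>p. E i p j 0"]) (rule E_period1)
    finally show ?thesis unfolding f_def using y(1) by simp
  qed
  have shift: "(\<Sum>r<s'. f i j (Suc r)) = (\<Sum>r<s'. f i j r)" for i j
    by (rule sum_lessThan_Suc_periodic) (rule per)
  have 1: "scale (y ^ r) (E i (p + s * (h + (s' - 1) * r) + s) j (s * r)) = f i j r" for i j r
    by (simp add: f_def algebra_simps)
  \<comment> \<open>The step (s' - 1) s from r to r + 1 and the step s to the next row make one full
    period, so the first exponent stays.\<close>
  have 2: "scale (y ^ r) (E i (p + s * (h + (s' - 1) * r)) j (s * r + s)) = scale (xi ^ k) (f i j (Suc r))" for i j r
  proof -
    have eq: "p + s * (Suc h + (s' - 1) * Suc r) = p + s * (h + (s' - 1) * r) + s * s'"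
      using s'_pos by (cases s') (simp_all add: algebra_simps)
    have sr: "s * Suc r = s * r + s" by simp
    have "f i j (Suc r) = scale (y * y ^ r) (E i (p + s * (h + (s' - 1) * r)) j (s * r + s))"
      by (simp only: f_def eq sr E_period1 power_Suc)
    then show ?thesis using y(2) by (simp add: mult.assoc[symmetric] mult.commute[of "xi ^ k"])
  qed
  have "(X ^^ s) (dft p k h i j) = (\<Sum>r<s'. scale (y ^ r) ((X ^^ s) (E i (p + s * (h + (s' - 1) * r)) j (s * r))))"
    unfolding dft_def y_def using linear_funpow[OF lin_X, of s]
    by (simp add: module_hom.sum module_hom.scale Vector_Spaces.linear_iff_module_hom)
  also have "\<dots> = (\<Sum>r<s'. scale (theta * lam a ^ s) (f i j r + f (Suc i) j r)
      + scale (eta * xi ^ k) (f i j (Suc r) + f i (Suc j) (Suc r)))"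
  proof (rule sum.cong)
    fix r
    have "scale (y ^ r) ((X ^^ s) (E i (p + s * (h + (s' - 1) * r)) j (s * r)))
      = scale (theta * lam a ^ s) (scale (y ^ r) (E i (p + s * (h + (s' - 1) * r) + s) j (s * r))
          + scale (y ^ r) (E (Suc i) (p + s * (h + (s' - 1) * r) + s) j (s * r)))
        + scale eta (scale (y ^ r) (E i (p + s * (h + (s' - 1) * r)) j (s * r + s))
          + scale (y ^ r) (E i (p + s * (h + (s' - 1) * r)) (Suc j) (s * r + s)))"
      unfolding X_power_E by (simp only: scale_right_distrib scale_scale mult.commute)
    then show "scale (y ^ r) ((X ^^ s) (E i (p + s * (h + (s' - 1) * r)) j (s * r)))
      = scale (theta * lam a ^ s) (f i j r + f (Suc i) j r)
      + scale (eta * xi ^ k) (f i j (Suc r) + f i (Suc j) (Suc r))"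
      unfolding 1 2 by (simp add: scale_right_distrib)
  qed simp
  also have "\<dots> = scale (theta * lam a ^ s) ((\<Sum>r<s'. f i j r) + (\<Sum>r<s'. f (Suc i) j r))
      + scale (eta * xi ^ k) ((\<Sum>r<s'. f i j (Suc r)) + (\<Sum>r<s'. f i (Suc j) (Suc r)))"
    by (simp only: sum.distrib scale_sum_right scale_right_distrib)
  finally show ?thesis unfolding shift D .
qed

lemma dft_period: "dft p k (h + s') i j = dft p k h i j"
proof -
  have "p + s * (h + s' + (s' - 1) * r) = p + s * (h + (s' - 1) * r) + s * s'" for r
    by (simp add: algebra_simps)
  then show ?thesis unfolding dft_def by (simp only: E_period1)
qed

lemma dft_weight: "dft p k h i j \<in> weight (p + s * h)"
  unfolding dft_def
proof (intro subspace_sum subspace_scale subspace_weight)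
  fix r
  have "p + s * (h + (s' - 1) * r) + s * r = p + s * h + s * s' * r"
    using s'_pos by (cases s') (simp_all add: algebra_simps)
  then show "E i (p + s * (h + (s' - 1) * r)) j (s * r) \<in> weight (p + s * h)"
    using E_weight[of i "p + s * (h + (s' - 1) * r)" j "s * r"] weight_sbar[of "p + s * h" r] by (simp only:)
qed

text \<open>The scalars absorb the coefficients of \<epsilon> and \<delta> in L, so that L becomes x
  + y and \<open>raise\<close> applies.\<close>

definition dft_scaled :: "nat \<Rightarrow> nat \<Rightarrow> nat \<Rightarrow> nat \<Rightarrow> nat \<Rightarrow> 'v" where
  "dft_scaled p k h i j = scale ((theta * lam a ^ s) ^ i * (eta * xi ^ k) ^ j) (dft p k h i j)"

lemma X_power_dft_scaled: "(X ^^ s) (dft_scaled p k h i j)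
    = scale (kappa k) (dft_scaled p k (Suc h) i j) + (dft_scaled p k (Suc h) (Suc i) j + dft_scaled p k (Suc h) i (Suc j))"
  using linear_funpow[OF lin_X, of s]
  by (simp add: dft_scaled_def kappa_def Vector_Spaces.linear_iff X_power_dft scale_right_distrib scale_left_distrib distrib_left mult_ac add_ac)

lemma dft_scaled_zero: "i \<ge> n \<or> j \<ge> t \<Longrightarrow> dft_scaled p k h i j = 0"
  by (simp add: dft_scaled_def dft_def E_zero)

definition is_prim :: "nat \<Rightarrow> (nat \<Rightarrow> nat \<Rightarrow> 'k) \<Rightarrow> bool" where
  "is_prim l c \<longleftrightarrow> homog n t l c \<and> lower n t c = (\<lambda>i j. 0) \<and> (\<Sum>i\<le>l. (-1) ^ i * c i (l - i)) \<noteq> 0"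

definition prim :: "nat \<Rightarrow> nat \<Rightarrow> nat \<Rightarrow> 'k" where
  "prim l = (SOME c. is_prim l c)"

lemma prim:
  assumes "l < min n t"
  shows "homog n t l (prim l)" and "lower n t (prim l) = (\<lambda>i j. 0)"
    and "(\<Sum>i\<le>l. (-1) ^ i * prim l i (l - i)) \<noteq> 0"
proof -
  obtain c where "is_prim l c"
    using exists_primitive[of l n t] assms unfolding is_prim_def by (metis min_less_iff_conj)
  then have "is_prim l (prim l)"
    unfolding prim_def by (rule someI[of "is_prim l"])
  then show "homog n t l (prim l)" "lower n t (prim l) = (\<lambda>i j. 0)"
    "(\<Sum>i\<le>l. (-1) ^ i * prim l i (l - i)) \<noteq> 0" unfolding is_prim_def by blast+
qed

text \<open>T^h L^b applied to the primitive vector of degree l in the xi^k-eigenspace: for fixed h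
  this is a Jordan chain of L.\<close>

definition chain :: "nat \<Rightarrow> nat \<Rightarrow> nat \<Rightarrow> nat \<Rightarrow> nat \<Rightarrow> 'v" where
  "chain p k l h b = dcomb n t (dft_scaled p k h) ((raise n t ^^ b) (prim l))"

lemma chain_twisted:
  assumes "l < min n t"
  shows "twisted_chain scale (X ^^ s) (chain p k l) (kappa k) s' (n + t - 1 - 2 * l)"
proof (intro twisted_chain.intro twisted_chain_axioms.intro)
  fix h b
  show "(X ^^ s) (chain p k l h b) = scale (kappa k) (chain p k l (Suc h) b) + chain p k l (Suc h) (Suc b)"
    unfolding chain_def
    by (simp add: dcomb_linear[OF linear_funpow[OF lin_X]] X_power_dft_scaled dcomb_add_family[of n t "\<lambda>i j. scale (kappa k) (dft_scaled p k (Suc h) i j)"]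
        dcomb_scale_family dcomb_raise[OF dft_scaled_zero])
  show "chain p k l (h + s') b = chain p k l h b"
    by (simp add: chain_def dcomb_def dft_scaled_def dft_period)
  show "chain p k l h b = 0" if "n + t - 1 - 2 * l \<le> b"
  proof -
    have "(raise n t ^^ b) (prim l) = (\<lambda>i j. 0)"
      by (rule raise_eq_0_of_primitive[OF prim(1,2)[OF assms] _ that]) (use assms in simp)
    then show ?thesis by (simp add: chain_def dcomb_zero)
  qed
qed (simp_all add: vspace_axioms linear_funpow[OF lin_X] s'_pos)

lemma chain_weight: "chain p k l h b \<in> weight (p + s * h)"
  unfolding chain_def dft_scaled_def
  by (intro dcomb_in_subspace subspace_weight subspace_scale dft_weight)

text \<open>Fourier inversion: the characters of Z/s' given by powers of xi are orthogonal, and s'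
  is invertible in characteristic zero.\<close>

lemma E_from_dft:
  assumes S: "subspace S" and D: "\<And>k. k < s' \<Longrightarrow> dft p k h i j \<in> S" and r: "r < s'"
  shows "E i (p + s * (h + (s' - 1) * r)) j (s * r) \<in> S"
proof -
  let ?E = "\<lambda>r. E i (p + s * (h + (s' - 1) * r)) j (s * r)"
  have orth: "(\<Sum>k<s'. (xi ^ k) ^ r * (inverse xi ^ k) ^ r') = (if r' = r then of_nat s' else 0)" if "r' < s'" for r'
  proof -
    let ?z = "xi ^ r * inverse xi ^ r'"
    have "(\<Sum>k<s'. (xi ^ k) ^ r * (inverse xi ^ k) ^ r') = (\<Sum>k<s'. ?z ^ k)"
      by (simp add: power_mult_distrib power_mult[symmetric] mult.commute)
    also have "\<dots> = (if r' = r then of_nat s' else 0)"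
    proof (cases "r' = r")
      case True
      then show ?thesis using xi_nz by (simp add: power_inverse)
    next
      case False
      have "?z ^ s' = (xi ^ s') ^ r * inverse (xi ^ s') ^ r'"
        by (simp add: power_mult_distrib power_mult[symmetric] power_inverse mult.commute)
      then have "?z ^ s' = 1" using xi_root by simp
      moreover have "?z \<noteq> 1"
      proof
        assume "?z = 1"
        then have eq: "xi ^ r = xi ^ r'" using xi_nz by (simp add: power_inverse field_simps)
        \<comment> \<open>The exponent is the absolute difference, so that one contradiction with
          \<open>xi_prim\<close> covers both orders of r and r'.\<close>
        have "xi ^ (max r r' - min r r') = 1"
        proof (cases "r \<le> r'")
          case True
          then have "xi ^ r' = xi ^ r * xi ^ (r' - r)" by (simp add: power_add[symmetric])
          then show ?thesis using eq True xi_nz by (simp add: max_def min_def)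
        next
          case False
          then have "xi ^ r = xi ^ r' * xi ^ (r - r')" by (simp add: power_add[symmetric])
          then show ?thesis using eq False xi_nz by (simp add: max_def min_def)
        qed
        moreover have "max r r' - min r r' > 0" "max r r' - min r r' < s'"
          using False r that by (auto simp: max_def min_def)
        ultimately show False using xi_prim by blast
      qed
      ultimately show ?thesis using False by (simp add: sum_root_of_unity)
    qed
    finally show ?thesis .
  qed
  have "(\<Sum>k<s'. scale ((xi ^ k) ^ r) (dft p k h i j)) = (\<Sum>k<s'. \<Sum>r'<s'. scale ((xi ^ k) ^ r * (inverse xi ^ k) ^ r') (?E r'))"
    by (simp add: dft_def scale_sum_right)
  also have "\<dots> = (\<Sum>r'<s'. scale (\<Sum>k<s'. (xi ^ k) ^ r * (inverse xi ^ k) ^ r') (?E r'))"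
    by (subst sum.swap) (simp add: scale_sum_left)
  also have "\<dots> = (\<Sum>r'<s'. if r' = r then scale (of_nat s') (?E r) else 0)"
    by (intro sum.cong) (auto simp: orth)
  also have "\<dots> = scale (of_nat s') (?E r)" using r by simp
  finally have "scale (of_nat s') (?E r) = (\<Sum>k<s'. scale ((xi ^ k) ^ r) (dft p k h i j))" by simp
  also have "\<dots> \<in> S" using S D by (intro subspace_sum subspace_scale) auto
  finally have "scale (inverse (of_nat s')) (scale (of_nat s') (?E r)) \<in> S" by (rule subspace_scale[OF S])
  then show ?thesis using s'_pos by simp
qed

section \<open>Generation of the model, and the summands generated\<close>

text \<open>The hypotheses name the starts of the later summands. An X-stable subspace containing
  them contains all chains, hence by Clebsch-Gordan the Fourier vectors, hence by inversion and
  further applications of X all E.\<close>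

lemma W_generated:
  assumes S: "subspace S" and XS: "\<And>v. v \<in> S \<Longrightarrow> X v \<in> S"
    and inv: "\<And>p k l. p < s \<Longrightarrow> k < s' \<Longrightarrow> l < min n t \<Longrightarrow> kappa k \<noteq> 0 \<Longrightarrow> (X ^^ (sbar - p)) (chain p k l 0 0) \<in> S"
    and nil: "\<And>p k l h. p < s \<Longrightarrow> k < s' \<Longrightarrow> l < min n t \<Longrightarrow> h < s' \<Longrightarrow> kappa k = 0 \<Longrightarrow> chain p k l h 0 \<in> S"
  shows "W \<subseteq> S"
proof -
  have US: "(X ^^ s) v \<in> S" if "v \<in> S" for v using XS that by (rule funpow_in_closed)
  have chain_S: "chain p k l h b \<in> S" if pkl: "p < s" "k < s'" "l < min n t" for p k l h b
  proof -
    interpret tc: twisted_chain scale "X ^^ s" "chain p k l" "kappa k" s' "n + t - 1 - 2 * l"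
      by (rule chain_twisted[OF pkl(3)])
    show ?thesis
    proof (cases "kappa k = 0")
      case False
      \<comment> \<open>X^p completes the move by sbar - p to X^sbar = (X^s)^s', so invariance can
        be used with b = s'.\<close>
      have "(X ^^ p) ((X ^^ (sbar - p)) (chain p k l 0 0)) \<in> S"
        using XS inv[OF pkl False] by (rule funpow_in_closed)
      moreover have "p + (sbar - p) = sbar" using pkl s'_pos by (simp add: le_trans[of p s "s * s'"])
      ultimately have "((X ^^ s) ^^ s') (chain p k l 0 0) \<in> S"
        using funpow_add[of p "sbar - p" X] by (simp add: funpow_mult)
      then show ?thesis using tc.e_in_invariant_subspace[OF False S, of s'] US by blast
    next
      case True
      have base: "chain p k l h 0 \<in> S" for h
      proof -
        have "chain p k l (h mod s') 0 = chain p k l (h mod s' + s' * (h div s')) 0"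
          by (rule tc.e_periodic_mult[symmetric])
        then show ?thesis using nil[OF pkl, of "h mod s'"] True s'_pos by simp
      qed
      \<comment> \<open>For kappa = 0 the operator X^s takes each power of L to the next one, one
        row further. So b can be climbed if all rows are available at b = 0;
        \<open>h + s' - 1\<close> is the cyclic predecessor of h.\<close>
      have "chain p k l h b \<in> S" for h
      proof (induction b arbitrary: h)
        case (Suc b)
        have "(X ^^ s) (chain p k l (h + s' - 1) b) \<in> S" using US Suc by blast
        moreover have "(X ^^ s) (chain p k l (h + s' - 1) b) = chain p k l (Suc (h + s' - 1)) (Suc b)"
          using tc.U_e True by simp
        moreover have "Suc (h + s' - 1) = h + s'" using s'_pos by simp
        ultimately show ?case using tc.e_periodic by simp
      qed (rule base)
      then show ?thesis .
    qed
  qed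
  have dft_S: "dft p k h i j \<in> S" if "p < s" "k < s'" for p k h i j
  proof (cases "i < n \<and> j < t")
    case True
    have "dft_scaled p k h i j \<in> S"
      by (rule dcomb_generated[OF S _ prim(1,3)]) (use True chain_S[OF that] in \<open>auto simp: chain_def\<close>)
    then have "scale (inverse y) (dft_scaled p k h i j) \<in> S" for y
      by (rule subspace_scale[OF S])
    moreover have "(theta * lam a ^ s) ^ i * (eta * xi ^ k) ^ j \<noteq> 0"
      using theta_nz lam_nz eta_nz xi_nz by simp
    ultimately show ?thesis
      unfolding dft_scaled_def by (metis scale_scale left_inverse scale_one)
  next
    case False
    then show ?thesis using S by (simp add: dft_def E_zero subspace_0 not_less)
  qed
  have base: "E i p j (s * r) \<in> S" for i p j r
  proof -
    let ?r = "r mod s'"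
    \<comment> \<open>The row \<open>p div s + ?r\<close> compensates the - r of the transform, so
      the first exponent is p up to a multiple of the period.\<close>
    have "E i (p mod s + s * ((p div s + ?r) + (s' - 1) * ?r)) j (s * ?r) \<in> S"
      using dft_S s_pos s'_pos by (intro E_from_dft S) auto
    moreover have "p mod s + s * ((p div s + ?r) + (s' - 1) * ?r) = p + s * s' * ?r"
    proof -
      have "p mod s + s * ((p div s + ?r) + (s' - 1) * ?r) = (p mod s + s * (p div s)) + s * (?r + (s' - 1) * ?r)"
        by (simp add: distrib_left)
      also have "?r + (s' - 1) * ?r = s' * ?r" using s'_pos by (cases s') simp_all
      finally show ?thesis by simp
    qed
    moreover have "E i (p + s * s' * ?r) j (s * ?r) = E i p j (s * ?r)"
      by (rule periodic_add_mult[where f = "\<lambda>p. E i p j (s * ?r)"]) (rule E_period1)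
    moreover have "E i p j (s * ?r) = E i p j (s * ?r + s * s' * (r div s'))"
      by (rule periodic_add_mult[where f = "\<lambda>r. E i p j r", symmetric]) (rule E_period2)
    moreover have "s * ?r + s * s' * (r div s') = s * r"
      by (metis distrib_left mod_mult_div_eq mult.assoc)
    ultimately show ?thesis by simp
  qed
  \<comment> \<open>Within a run of s steps \<open>x2\<close> is a plain shift, so the next E is X E
    - x1 (a2 E). The claim is for all i and p at once because \<open>x1\<close> changes
    them.\<close>
  have "E i p j (s * r + l) \<in> S" if "l < s" for i p j r l
    using that
  proof (induction l arbitrary: i p j)
    case 0
    then show ?case using base by simp
  next
    case (Suc l)
    then have IH: "E i p j (s * r + l) \<in> S" for i p j by simp
    have "(s * r + l) mod s \<noteq> s - 1" using Suc.prems by simp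
    then have "X (E i p j (s * r + l)) = scale (chi a ^ (s * r + l) * lam a) (x1 (E i p j (s * r + l))) + E i p j (s * r + Suc l)"
      by (simp add: X_def a2_E x2_E lin_simps)
    moreover have "scale (chi a ^ (s * r + l) * lam a) (x1 (E i p j (s * r + l))) \<in> S"
      unfolding x1_E using IH S by (auto intro!: subspace_scale subspace_add simp del: scale_scale)
    ultimately show ?case
      using subspace_diff[OF S XS[OF IH[of i p j]]] by (metis add_diff_cancel_left')
  qed
  from this[of "r mod s" i p j "r div s" for i p j r] have "E i p j r \<in> S" for i p j r
    using s_pos by (simp add: mult.commute)
  then show ?thesis using S by (intro W_subsetI)
qed

lemma weight_act_funpow_X:
  assumes "w \<in> weight k" and "g \<in> carrier G"
  shows "act g ((X ^^ i) w) = scale (chi g ^ i * (chi g ^ k * (sigma g * lam g))) ((X ^^ i) w)"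
  using weightD[OF weight_funpow[of X, OF weight_X assms(1)] assms(2), of i]
  by (simp add: power_add mult_ac)

text \<open>The chain starts at weight p, and X^(sbar - p) moves it to weight sbar, that is, to 0.
  Every p < s therefore gives the same module, whence the multiplicity s.\<close>

lemma block_invertible:
  assumes "l < min n t" and "p < s"
  shows "gen_realizes G act X W {(X ^^ (sbar - p)) (chain p k l 0 0)}
    [Vmod2 chi sbar (n + t - 1 - 2 * l) (\<lambda>g. sigma g * lam g) (kappa k ^ s')]"
proof -
  let ?w = "(X ^^ (sbar - p)) (chain p k l 0 0)" and ?d = "n + t - 1 - 2 * l"
  interpret tc: twisted_chain scale "X ^^ s" "chain p k l" "kappa k" s' ?d
    by (rule chain_twisted[OF assms(1)])
  have comm: "(X ^^ (sbar * j)) ?w = (X ^^ (sbar - p)) ((X ^^ (sbar * j)) (chain p k l 0 0))" for j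
    unfolding funpow_add[THEN fun_cong, unfolded o_apply, symmetric] by (simp only: add.commute)
  have "pcomb (\<lambda>j. (X ^^ (sbar * j)) ?w) ([:- (kappa k ^ s'), 1:] ^ ?d)
    = (X ^^ (sbar - p)) (pcomb (\<lambda>j. ((X ^^ s) ^^ (s' * j)) (chain p k l 0 0)) ([:- (kappa k ^ s'), 1:] ^ ?d))"
    by (simp only: pcomb_linear[OF linear_funpow[OF lin_X]] comm funpow_mult mult.assoc[symmetric])
  also have "\<dots> = 0"
    unfolding tc.pcomb_funpow_U_eq_0 using linear_funpow[OF lin_X, of "sbar - p"]
    by (simp add: module_hom.zero Vector_Spaces.linear_iff_module_hom)
  finally have rel: "pcomb (\<lambda>j. (X ^^ (sbar * j)) ?w) ([:- (kappa k ^ s'), 1:] ^ ?d) = 0" .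
  have "?w \<in> weight (p + s * 0 + (sbar - p))"
    by (rule weight_funpow[OF weight_X chain_weight])
  moreover have "p + s * 0 + (sbar - p) = 0 + sbar * 1"
    using assms s'_pos by (simp add: le_trans[of p s "s * s'"])
  ultimately have wt: "?w \<in> weight 0" using weight_sbar[of 0 1] by simp
  have "realizes G act X (map (\<lambda>i. (X ^^ i) ?w) [0..<?d * sbar]) (Vmod2 chi sbar ?d (\<lambda>g. sigma g * lam g) (kappa k ^ s'))"
    by (rule realizes_Vmod2[OF rel _ sbar_pos]) (simp add: weight_act_funpow_X[OF wt])
  moreover have "?w \<in> set (map (\<lambda>i. (X ^^ i) ?w) [0..<?d * sbar])"
    using assms(1) sbar_pos by (auto intro!: image_eqI[of _ _ 0])
  moreover have "set (map (\<lambda>i. (X ^^ i) ?w) [0..<?d * sbar]) \<subseteq> W"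
    using funpow_X_W[OF weight_W[OF wt]] by auto
  ultimately show ?thesis by (rule gen_realizes_single)
qed

text \<open>X^(s b) sends the start to row h + b and power b of L, which is zero for b = d. The
  weight p + s h stays as it is; for p < s and h < s' it runs through all residues modulo
  sbar.\<close>

lemma block_nilpotent:
  assumes "l < min n t" and "kappa k = 0"
  shows "gen_realizes G act X W {chain p k l h 0}
    [Vmod chi ((n + t - 1 - 2 * l) * s) (\<lambda>g. chi g ^ (p + s * h) * (sigma g * lam g))]"
proof -
  let ?w = "chain p k l h 0" and ?d = "n + t - 1 - 2 * l"
  interpret tc: twisted_chain scale "X ^^ s" "chain p k l" "kappa k" s' ?d
    by (rule chain_twisted[OF assms(1)])
  have "((X ^^ s) ^^ b) ?w = chain p k l (h + b) b" for b
    by (induction b) (simp_all add: tc.U_e assms(2))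
  then have "((X ^^ s) ^^ ?d) ?w = 0"
    using tc.e_eq_0[of ?d "h + ?d"] by simp
  then have rel: "(X ^^ (?d * s)) ?w = 0"
    by (simp only: funpow_mult mult.commute)
  have "realizes G act X (map (\<lambda>i. (X ^^ i) ?w) [0..<?d * s]) (Vmod chi (?d * s) (\<lambda>g. chi g ^ (p + s * h) * (sigma g * lam g)))"
    by (rule realizes_Vmod[OF rel]) (simp add: weight_act_funpow_X[OF chain_weight])
  moreover have "?w \<in> set (map (\<lambda>i. (X ^^ i) ?w) [0..<?d * s])"
    using assms(1) s_pos by (auto intro!: image_eqI[of _ _ 0])
  moreover have "set (map (\<lambda>i. (X ^^ i) ?w) [0..<?d * s]) \<subseteq> W"
    using funpow_X_W[OF weight_W[OF chain_weight]] by auto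
  ultimately show ?thesis by (rule gen_realizes_single)
qed

end

section \<open>Counting dimensions and matching the stated lists\<close>

text \<open>The sum of the first k terms 2 i - 1 + c is k (k + c); for k = min n t and c = |n - t|
  this is the product of minimum and maximum.\<close>

lemma sum_block_sizes:
  "(\<Sum>i\<leftarrow>[1..<min n t + 1]. 2 * i - 1 + (max n t - min n t)) = n * t"
proof -
  have sum: "(\<Sum>i\<leftarrow>[1..<k + 1]. 2 * i - 1 + c) = k * (k + c)" for k c :: nat
    by (induction k) (simp_all add: algebra_simps)
  have "min n t * (min n t + (max n t - min n t)) = n * t"
    by (simp add: min_def max_def mult.commute)
  then show ?thesis by (simp only: sum)
qed

lemma sum_list_concat_map:
  "sum_list (map f (concat (map g xs))) = (\<Sum>x\<leftarrow>xs. sum_list (map f (g x)))"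
  by (induction xs) simp_all

lemma hdim_Vmod2 [simp]: "hdim (Vmod2 chi sbar t lam beta) = t * sbar"
  by (simp add: hdim_def Vmod2_def)

lemma hdim_Vmod [simp]: "hdim (Vmod chi t lam) = t"
  by (simp add: hdim_def Vmod_def)

context tensor_model
begin

abbreviation blk :: "nat \<Rightarrow> nat" where "blk i \<equiv> 2 * i - 1 + (max n t - min n t)"

abbreviation sl :: "'g \<Rightarrow> 'k" where "sl \<equiv> \<lambda>g. sigma g * lam g"

abbreviation inv_blocks :: "nat list \<Rightarrow> ('g, 'k) hrep list" where
  "inv_blocks js \<equiv> concat (map (\<lambda>i. concat (map (\<lambda>j.
     replicate s (Vmod2 chi sbar (blk i) sl (kappa (j - 1) ^ s'))) js)) [1..<min n t + 1])"

abbreviation nil_blocks :: "('g, 'k) hrep list" where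
  "nil_blocks \<equiv> concat (map (\<lambda>i. map (\<lambda>j. Vmod chi (blk i * s) (\<lambda>g. chi g ^ j * sl g)) [0..<sbar])
     [1..<min n t + 1])"

text \<open>Block sizes grow with i but shrink with the degree l of the primitive vector, so i
  corresponds to l = min n t - i.\<close>

lemma blk_eq:
  assumes "i \<in> set [1..<min n t + 1]"
  shows "blk i = n + t - 1 - 2 * (min n t - i)" and "min n t - i < min n t"
  using assms by (auto simp: min_def max_def)

lemma gen_realizes_inv_blocks:
  "gen_realizes G act X W
    (\<Union>i\<in>set [1..<min n t + 1]. \<Union>j\<in>set js. (\<lambda>p. (X ^^ (sbar - p)) (chain p (j - 1) (min n t - i) 0 0)) ` set [0..<s])
    (inv_blocks js)"
proof (intro gen_realizes_concat)
  fix i j assume i: "i \<in> set [1..<min n t + 1]"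
  have "replicate s (Vmod2 chi sbar (blk i) sl (kappa (j - 1) ^ s'))
      = map (\<lambda>p. Vmod2 chi sbar (blk i) sl (kappa (j - 1) ^ s')) [0..<s]"
    by (simp add: map_replicate_const)
  then show "gen_realizes G act X W
    ((\<lambda>p. (X ^^ (sbar - p)) (chain p (j - 1) (min n t - i) 0 0)) ` set [0..<s])
    (replicate s (Vmod2 chi sbar (blk i) sl (kappa (j - 1) ^ s')))"
    using block_invertible[OF blk_eq(2)[OF i]] unfolding blk_eq(1)[OF i]
    by (simp only:) (rule gen_realizes_map, simp)
qed

lemma gen_realizes_nil_blocks:
  assumes "kappa k = 0"
  shows "gen_realizes G act X W
    (\<Union>i\<in>set [1..<min n t + 1]. (\<lambda>j. chain (j mod s) k (min n t - i) (j div s) 0) ` set [0..<sbar])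
    nil_blocks"
proof (intro gen_realizes_concat gen_realizes_map)
  fix i j assume i: "i \<in> set [1..<min n t + 1]"
  show "gen_realizes G act X W {chain (j mod s) k (min n t - i) (j div s) 0}
     [Vmod chi (blk i * s) (\<lambda>g. chi g ^ j * sl g)]"
    using block_nilpotent[OF blk_eq(2)[OF i] assms, of "j mod s" "j div s"] unfolding blk_eq(1)[OF i]
    by simp
qed

lemma hdim_inv_blocks: "sum_list (map hdim (inv_blocks js)) = length js * s * sbar * (n * t)"
proof -
  have "sum_list (map hdim (inv_blocks js)) = (\<Sum>i\<leftarrow>[1..<min n t + 1]. length js * s * sbar * blk i)"
    by (simp add: sum_list_concat_map sum_list_replicate sum_list_triv mult_ac del: upt_Suc)
  also have "\<dots> = length js * s * sbar * (\<Sum>i\<leftarrow>[1..<min n t + 1]. blk i)"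
    by (simp only: sum_list_const_mult)
  finally show ?thesis by (simp only: sum_block_sizes)
qed

text \<open>For each i, sbar modules of size \<open>blk i * s\<close> weigh as much as s modules of
  size \<open>blk i * sbar\<close>: they fill the place of the missing j0.\<close>

lemma hdim_nil_blocks: "sum_list (map hdim nil_blocks) = s * sbar * (n * t)"
proof -
  have "sum_list (map hdim nil_blocks) = (\<Sum>i\<leftarrow>[1..<min n t + 1]. s * sbar * blk i)"
    by (simp add: sum_list_concat_map sum_list_triv comp_def mult_ac del: upt_Suc)
  also have "\<dots> = s * sbar * (\<Sum>i\<leftarrow>[1..<min n t + 1]. blk i)"
    by (simp only: sum_list_const_mult)
  finally show ?thesis by (simp only: sum_block_sizes)
qed

text \<open>The span of a realizing list is stable under X, so by \<open>W_generated\<close> it is W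
  as soon as it contains the generators; equality of dimensions does the rest.\<close>

lemma tensor_hiso:
  assumes dim: "dim W = n * sbar * (t * sbar)" and pos: "n > 0" "t > 0"
    and bs: "realizes G act X bs M" and bsW: "set bs \<subseteq> W" and M: "hdim M = dim W"
    and inv: "\<And>p k l. p < s \<Longrightarrow> k < s' \<Longrightarrow> l < min n t \<Longrightarrow> kappa k \<noteq> 0 \<Longrightarrow> (X ^^ (sbar - p)) (chain p k l 0 0) \<in> set bs"
    and nil: "\<And>p k l h. p < s \<Longrightarrow> k < s' \<Longrightarrow> l < min n t \<Longrightarrow> h < s' \<Longrightarrow> kappa k = 0 \<Longrightarrow> chain p k l h 0 \<in> set bs"
  shows "hiso G (htensor a (Vmod2 chi sbar n sigma (theta ^ s')) (Vmod2 chi sbar t lam (eta ^ s'))) M"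
proof -
  have "acts X bs (snd M)" using bs by (simp add: realizes_def)
  then have "X v \<in> span (set bs)" if "v \<in> span (set bs)" for v
    using acts_span_closed lin_X that by blast
  then have "W \<subseteq> span (set bs)"
    by (rule W_generated[OF subspace_span]) (blast intro: span_base inv nil)+
  moreover have "span (set bs) \<subseteq> W" using bsW subspace_W by (rule span_minimal)
  ultimately have "span (set bs) = W" by blast
  moreover have "length bs = dim W" using realizes_hdim[OF bs] M by simp
  ultimately show ?thesis
    using tensor_basis_span[OF pos] dim lin_act lin_X
    by (intro realizes_hiso[OF tensor_basis_realizes bs]) auto
qed

lemma tensor_hiso_invertible:
  assumes dim: "dim W = n * sbar * (t * sbar)" and pos: "n > 0" "t > 0"
    and nz: "\<And>k. k < s' \<Longrightarrow> kappa k \<noteq> 0"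
  shows "hiso G (htensor a (Vmod2 chi sbar n sigma (theta ^ s')) (Vmod2 chi sbar t lam (eta ^ s')))
    (hdsums (inv_blocks [1..<s' + 1]))"
proof -
  obtain bss where bss: "list_all2 (realizes G act X) bss (inv_blocks [1..<s' + 1])"
    and sub: "(\<Union>i\<in>set [1..<min n t + 1]. \<Union>j\<in>set [1..<s' + 1].
      (\<lambda>p. (X ^^ (sbar - p)) (chain p (j - 1) (min n t - i) 0 0)) ` set [0..<s]) \<subseteq> set (concat bss)"
    and W: "set (concat bss) \<subseteq> W"
    using gen_realizes_inv_blocks[of "[1..<s' + 1]"] unfolding gen_realizes_def by blast
  show ?thesis
  proof (rule tensor_hiso[OF dim pos realizes_hdsums[OF bss] W])
    show "hdim (hdsums (inv_blocks [1..<s' + 1])) = dim W"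
      unfolding hdim_hdsums hdim_inv_blocks dim by (simp add: mult_ac)
    fix p k l assume pkl: "p < s" "k < s'" "l < min n t"
    have "(X ^^ (sbar - p)) (chain p (Suc k - 1) (min n t - (min n t - l)) 0 0) \<in> set (concat bss)"
      using pkl by (intro subsetD[OF sub] UN_I[of "min n t - l"] UN_I[of "Suc k"] imageI) auto
    then show "(X ^^ (sbar - p)) (chain p k l 0 0) \<in> set (concat bss)" using pkl by simp
  qed (use nz in auto)
qed

lemma tensor_hiso_nilpotent:
  assumes dim: "dim W = n * sbar * (t * sbar)" and pos: "n > 0" "t > 0"
    and j0: "1 \<le> j0" "j0 \<le> s'" "kappa (j0 - 1) = 0" and uniq: "\<And>k. k < s' \<Longrightarrow> kappa k = 0 \<Longrightarrow> k = j0 - 1"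
  shows "hiso G (htensor a (Vmod2 chi sbar n sigma (theta ^ s')) (Vmod2 chi sbar t lam (eta ^ s')))
    (hdsum (hdsums (inv_blocks (filter (\<lambda>j. j \<noteq> j0) [1..<s' + 1]))) (hdsums nil_blocks))"
proof -
  let ?js = "filter (\<lambda>j. j \<noteq> j0) [1..<s' + 1]"
  obtain bss where bss: "list_all2 (realizes G act X) bss (inv_blocks ?js)"
    and sub: "(\<Union>i\<in>set [1..<min n t + 1]. \<Union>j\<in>set ?js.
      (\<lambda>p. (X ^^ (sbar - p)) (chain p (j - 1) (min n t - i) 0 0)) ` set [0..<s]) \<subseteq> set (concat bss)"
    and W: "set (concat bss) \<subseteq> W"
    using gen_realizes_inv_blocks[of ?js] unfolding gen_realizes_def by blast
  obtain css where css: "list_all2 (realizes G act X) css nil_blocks"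
    and sub': "(\<Union>i\<in>set [1..<min n t + 1].
      (\<lambda>j. chain (j mod s) (j0 - 1) (min n t - i) (j div s) 0) ` set [0..<sbar]) \<subseteq> set (concat css)"
    and W': "set (concat css) \<subseteq> W"
    using gen_realizes_nil_blocks[OF j0(3)] unfolding gen_realizes_def by blast
  have len: "length ?js = s' - 1"
  proof -
    have "length ?js = card (set ?js)" by (rule distinct_card[symmetric]) simp
    also have "set ?js = {1..s'} - {j0}" by auto
    finally show ?thesis using j0 by simp
  qed
  show ?thesis
  proof (rule tensor_hiso[OF dim pos realizes_hdsum[OF realizes_hdsums[OF bss] realizes_hdsums[OF css]]])
    show "set (concat bss @ concat css) \<subseteq> W" using W W' by auto
    have "(s' - 1) * s * sbar * (n * t) + s * sbar * (n * t) = s' * s * sbar * (n * t)"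
      using s'_pos by (cases s') (simp_all add: algebra_simps)
    then show "hdim (hdsum (hdsums (inv_blocks ?js)) (hdsums nil_blocks)) = dim W"
      unfolding hdim_hdsum hdim_hdsums hdim_inv_blocks hdim_nil_blocks dim len by (simp add: mult_ac)
  next
    fix p k l assume pkl: "p < s" "k < s'" "l < min n t" and "kappa k \<noteq> 0"
    then have "Suc k \<noteq> j0" using j0 by auto
    then have "(X ^^ (sbar - p)) (chain p (Suc k - 1) (min n t - (min n t - l)) 0 0) \<in> set (concat bss)"
      using pkl by (intro subsetD[OF sub] UN_I[of "min n t - l"] UN_I[of "Suc k"] imageI) auto
    then show "(X ^^ (sbar - p)) (chain p k l 0 0) \<in> set (concat bss @ concat css)" using pkl by simp
  next
    fix p k l h assume pkl: "p < s" "k < s'" "l < min n t" "h < s'" and "kappa k = 0"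
    then have k: "k = j0 - 1" using uniq by blast
    \<comment> \<open>The nilpotent summands are numbered by j = p + s h < sbar, so p = j mod s and
      h = j div s.\<close>
    have "p + s * h < s * Suc h" using pkl by simp
    also have "\<dots> \<le> sbar" using pkl by (intro mult_le_mono) auto
    finally have "chain ((p + s * h) mod s) (j0 - 1) (min n t - (min n t - l)) ((p + s * h) div s) 0 \<in> set (concat css)"
      using pkl by (intro subsetD[OF sub'] UN_I[of "min n t - l"]
          image_eqI[of _ "\<lambda>j. chain (j mod s) (j0 - 1) (min n t - (min n t - l)) (j div s) 0" "p + s * h"]) auto
    then show "chain p k l h 0 \<in> set (concat bss @ concat css)" using pkl k by simp
  qed
qed

end

section \<open>Existence of the model\<close>

interpretation poly_vs: vspace "smult :: 'k::field_char_0 \<Rightarrow> 'k poly \<Rightarrow> 'k poly"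
  by unfold_locales (simp_all add: smult_add_right smult_add_left)

text \<open>Polynomials provide an explicit countable basis: index quadruples are encoded as
  exponents, and \<open>coeff\<close> supplies the coordinates needed to define a linear map by its
  values.\<close>

lemma exists_tensor_space:
  fixes n t N :: nat
  assumes "N > 0"
  obtains E :: "nat \<Rightarrow> nat \<Rightarrow> nat \<Rightarrow> nat \<Rightarrow> 'k::field_char_0 poly"
  where "\<And>i p j r. i \<ge> n \<or> j \<ge> t \<Longrightarrow> E i p j r = 0"
    and "\<And>i p j r. E i (p + N) j r = E i p j r" and "\<And>i p j r. E i p j (r + N) = E i p j r"
    and "poly_vs.dim (poly_vs.span (range (\<lambda>(i, p, j, r). E i p j r))) = n * N * (t * N)"
    and "\<And>F. \<exists>f. Vector_Spaces.linear smult smult f \<and>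
      (\<forall>i<n. \<forall>p<N. \<forall>j<t. \<forall>r<N. f (E i p j r) = F i p j r)"
proof -
  define enc :: "nat \<times> nat \<times> nat \<times> nat \<Rightarrow> nat"
    where "enc = (\<lambda>(i, p, j, r). prod_encode (i, prod_encode (p, prod_encode (j, r))))"
  have enc: "enc x = enc y \<longleftrightarrow> x = y" for x y
    by (cases x; cases y) (simp add: enc_def prod_encode_eq)
  define I where "I = {..<n} \<times> {..<N} \<times> {..<t} \<times> {..<N}"
  have fin: "finite I" by (simp add: I_def)
  define E :: "nat \<Rightarrow> nat \<Rightarrow> nat \<Rightarrow> nat \<Rightarrow> 'k poly"
    where "E i p j r = (if i < n \<and> j < t then monom 1 (enc (i, p mod N, j, r mod N)) else 0)" for i p j r
  define B :: "'k poly set" where "B = (\<lambda>x. monom 1 (enc x)) ` I"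
  have inj: "inj_on (\<lambda>x. monom (1::'k) (enc x)) I"
    by (rule inj_onI) (simp add: monom_eq_iff' enc)
  have "poly_vs.independent B"
  proof (rule poly_vs.independent_if_scalars_zero)
    show "finite B" using fin by (simp add: B_def)
    fix f b assume sum: "(\<Sum>x\<in>B. smult (f x) x) = 0" and "b \<in> B"
    then obtain x where x: "x \<in> I" "b = monom 1 (enc x)" by (auto simp: B_def)
    have "0 = coeff (\<Sum>x\<in>B. smult (f x) x) (enc x)" by (simp add: sum)
    also have "\<dots> = (\<Sum>y\<in>I. if y = x then f (monom 1 (enc y)) else 0)"
      unfolding B_def sum.reindex[OF inj] coeff_sum
      by (intro sum.cong) (auto simp: enc)
    also have "\<dots> = f b" using x fin by simp
    finally show "f b = 0" by simp
  qed
  moreover have "poly_vs.span (range (\<lambda>(i, p, j, r). E i p j r)) = poly_vs.span B"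
  proof (rule poly_vs.span_eq[THEN iffD2], intro conjI subsetI)
    fix v assume "v \<in> range (\<lambda>(i, p, j, r). E i p j r)"
    then obtain i p j r where v: "v = E i p j r" by auto
    show "v \<in> poly_vs.span B"
    proof (cases "i < n \<and> j < t")
      case True
      then have "v \<in> B" using assms by (auto simp: v E_def B_def I_def)
      then show ?thesis by (rule poly_vs.span_base)
    next
      case False
      then show ?thesis by (auto simp: v E_def poly_vs.span_zero)
    qed
  next
    fix v assume "v \<in> B"
    then obtain i p j r where "i < n" "p < N" "j < t" "r < N" "v = monom 1 (enc (i, p, j, r))"
      by (auto simp: B_def I_def)
    then have "v = (\<lambda>(i, p, j, r). E i p j r) (i, p, j, r)" by (simp add: E_def)
    then show "v \<in> poly_vs.span (range (\<lambda>(i, p, j, r). E i p j r))" by (intro poly_vs.span_base) (rule range_eqI)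
  qed
  moreover have "card B = n * N * (t * N)"
    unfolding B_def card_image[OF inj] by (simp add: I_def)
  ultimately have "poly_vs.dim (poly_vs.span (range (\<lambda>(i, p, j, r). E i p j r))) = n * N * (t * N)"
    by (simp add: poly_vs.dim_eq_card_independent)
  moreover have "\<exists>f. Vector_Spaces.linear smult smult f \<and>
      (\<forall>i<n. \<forall>p<N. \<forall>j<t. \<forall>r<N. f (E i p j r) = F i p j r)" for F :: "nat \<Rightarrow> nat \<Rightarrow> nat \<Rightarrow> nat \<Rightarrow> 'k poly"
  proof -
    let ?F = "\<lambda>(i, p, j, r). F i p j r"
    let ?f = "\<lambda>v. \<Sum>x\<in>I. smult (coeff v (enc x)) (?F x)"
    have "Vector_Spaces.linear smult smult ?f"
      by (simp add: Vector_Spaces.linear_iff poly_vs.vector_space_axioms smult_add_left sum.distrib poly_vs.scale_sum_right)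
    moreover have "?f (E i p j r) = F i p j r" if "i < n" "p < N" "j < t" "r < N" for i p j r
    proof -
      have "?f (E i p j r) = (\<Sum>x\<in>I. if x = (i, p, j, r) then ?F x else 0)"
        using that by (intro sum.cong) (auto simp: E_def enc)
      also have "\<dots> = F i p j r" using that fin by (simp add: I_def)
      finally show ?thesis .
    qed
    ultimately show ?thesis by blast
  qed
  ultimately show ?thesis by (intro that[of E]) (auto simp: E_def)
qed

section \<open>The decomposition theorem\<close>

lemma elem_order_props:
  assumes "elem_order x = d" and "d > 0"
  shows "x ^ d = 1" and "\<And>i. 0 < i \<Longrightarrow> i < d \<Longrightarrow> x ^ i \<noteq> 1"
proof -
  have ex: "\<exists>n>0. x ^ n = 1" using assms unfolding elem_order_def by (auto split: if_splits)
  then have d: "d = (LEAST n. n > 0 \<and> x ^ n = 1)" using assms(1) unfolding elem_order_def by simp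
  show "x ^ d = 1" using LeastI_ex[OF ex] unfolding d by blast
  show "x ^ i \<noteq> 1" if "0 < i" "i < d" for i
    using not_less_Least[of i "\<lambda>n. n > 0 \<and> x ^ n = 1"] that unfolding d by blast
qed

lemma char_order_power:
  assumes "char_order G f > 0" and "g \<in> carrier G"
  shows "f g ^ char_order G f = 1"
proof -
  have ex: "\<exists>n>0. \<forall>g\<in>carrier G. f g ^ n = 1" using assms unfolding char_order_def by (auto split: if_splits)
  then have "char_order G f = (LEAST n. n > 0 \<and> (\<forall>g\<in>carrier G. f g ^ n = 1))" unfolding char_order_def by simp
  then show ?thesis using LeastI_ex[OF ex] assms(2) by simp
qed

lemma power_inj_on_primitive_root:
  fixes xi :: "'k::field"
  assumes prim: "\<And>i. 0 < i \<Longrightarrow> i < d \<Longrightarrow> xi ^ i \<noteq> 1" and "xi \<noteq> 0"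
  shows "inj_on (\<lambda>i. xi ^ i) {..<d}"
proof (rule linorder_inj_onI)
  fix i j assume "i < j" "i \<in> {..<d}" "j \<in> {..<d}"
  then have "xi ^ (j - i) \<noteq> 1" by (intro prim) auto
  moreover have "xi ^ j = xi ^ i * xi ^ (j - i)" using \<open>i < j\<close> by (simp add: power_add[symmetric])
  ultimately show "xi ^ i \<noteq> xi ^ j" using \<open>xi \<noteq> 0\<close> by simp
qed auto

text \<open>The d distinct powers of xi are roots of Y^d - 1, which has at most d roots.\<close>

lemma root_of_unity_is_power:
  fixes xi :: "'k::field"
  assumes root: "xi ^ d = 1" and prim: "\<And>i. 0 < i \<Longrightarrow> i < d \<Longrightarrow> xi ^ i \<noteq> 1" and "d > 0" and z: "z ^ d = 1"
  obtains i where "i < d" and "z = xi ^ i"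
proof -
  let ?p = "monom 1 d - 1 :: 'k poly"
  have "xi \<noteq> 0" using root \<open>d > 0\<close> by (metis power_0_left zero_neq_one less_irrefl)
  have deg: "degree ?p = d"
    using \<open>d > 0\<close> by (metis degree_1 degree_add_eq_left degree_minus degree_monom_eq diff_conv_add_uminus zero_neq_one)
  then have p0: "?p \<noteq> 0" using \<open>d > 0\<close> by auto
  have poly: "poly ?p x = 0 \<longleftrightarrow> x ^ d = 1" for x by (simp add: poly_monom)
  let ?R = "(\<lambda>i. xi ^ i) ` {..<d}"
  have "?R \<subseteq> {x. poly ?p x = 0}"
    unfolding poly using root by (auto simp: power_mult[symmetric] mult.commute[of _ d]) (simp add: power_mult)
  moreover have "card {x. poly ?p x = 0} \<le> card ?R"
    using card_poly_roots_bound[OF p0] power_inj_on_primitive_root[OF prim \<open>xi \<noteq> 0\<close>] deg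
    by (simp add: card_image)
  ultimately have "?R = {x. poly ?p x = 0}"
    using poly_roots_finite[OF p0] by (intro card_seteq) auto
  then show ?thesis using z poly that by (metis (mono_tags, lifting) imageE lessThan_iff mem_Collect_eq)
qed

theorem theorem3p10:
  fixes G :: "('g, 'b) monoid_scheme" and a :: 'g
    and chi sigma lam :: "'g \<Rightarrow> 'k::field_char_0"
    and s sbar s' n t :: nat and xi alpha beta theta eta :: 'k
  assumes alg_closed: "\<forall>p :: 'k poly. degree p \<ge> 1 \<longrightarrow> (\<exists>x. poly p x = 0)"
    and grp: "group G"
    and a_in: "a \<in> carrier G"
    and a_central: "\<forall>g\<in>carrier G. a \<otimes>\<^bsub>G\<^esub> g = g \<otimes>\<^bsub>G\<^esub> a"
    and chi_char: "character G chi" and chi_a: "chi a \<noteq> 1"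
    and s_def: "s = elem_order (chi a)" and sbar_def: "sbar = char_order G chi"
    and s_gt1: "1 < s" and s_lt: "s < sbar"
    and sbar_eq: "sbar = s * s'"
    and xi_ord: "elem_order xi = s'"
    and n_pos: "n \<ge> 1" and t_pos: "t \<ge> 1"
    and sigma_char: "character G sigma" and lam_char: "character G lam"
    and alpha_nz: "alpha \<noteq> 0" and beta_nz: "beta \<noteq> 0"
    and theta: "theta ^ s' = alpha" and eta: "eta ^ s' = beta"
  defines "alphaj \<equiv> \<lambda>j::nat. (theta * lam a ^ s + eta * xi ^ (j - 1)) ^ s'"
    and "d \<equiv> \<lambda>i::nat. 2 * i - 1 + (max n t - min n t)"
    and "sl \<equiv> \<lambda>g. sigma g * lam g"
    and "T \<equiv> htensor a (Vmod2 chi sbar n sigma alpha) (Vmod2 chi sbar t lam beta)"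
  shows "(beta + (-1) ^ (s' + 1) * alpha * lam a ^ sbar \<noteq> 0 \<longrightarrow>
           hiso G T (hdsums (concat (map (\<lambda>i. concat (map (\<lambda>j.
              replicate s (Vmod2 chi sbar (d i) sl (alphaj j))) [1..<s'+1])) [1..<min n t + 1]))))
       \<and> (beta + (-1) ^ (s' + 1) * alpha * lam a ^ sbar = 0 \<longrightarrow>
           (\<exists>!j0. 1 \<le> j0 \<and> j0 \<le> s' \<and> alphaj j0 = 0) \<and>
           (\<forall>j0. 1 \<le> j0 \<and> j0 \<le> s' \<and> alphaj j0 = 0 \<longrightarrow>
              hiso G T (hdsum
                (hdsums (concat (map (\<lambda>i. concat (map (\<lambda>j.
                   replicate s (Vmod2 chi sbar (d i) sl (alphaj j))) (filter (\<lambda>j. j \<noteq> j0) [1..<s'+1])))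
                   [1..<min n t + 1])))
                (hdsums (concat (map (\<lambda>i. map (\<lambda>j.
                   Vmod chi (d i * s) (\<lambda>g. chi g ^ j * sl g)) [0..<sbar])
                   [1..<min n t + 1]))))))"
proof -
  have s'_pos: "s' > 0" and s_pos: "s > 0" and N_pos: "s * s' > 0"
    using s_gt1 s_lt sbar_eq by (auto intro: gr0I)
  note xi = elem_order_props[OF xi_ord s'_pos]
  note q = elem_order_props[OF s_def[symmetric] s_pos]
  have chi_root: "chi g ^ (s * s') = 1" if "g \<in> carrier G" for g
    using char_order_power[OF _ that, of chi] N_pos unfolding sbar_def[symmetric] sbar_eq by simp
  have xi_nz: "xi \<noteq> 0" using xi(1) s'_pos by (metis power_0_left zero_neq_one less_irrefl)
  have theta_nz: "theta \<noteq> 0" using theta alpha_nz s'_pos by auto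
  have eta_nz: "eta \<noteq> 0" using eta beta_nz s'_pos by auto
  have lam_nz: "lam a \<noteq> 0" using lam_char a_in by (simp add: character_def)
  obtain E :: "nat \<Rightarrow> nat \<Rightarrow> nat \<Rightarrow> nat \<Rightarrow> 'k poly"
    where E0: "\<And>i p j r. i \<ge> n \<or> j \<ge> t \<Longrightarrow> E i p j r = 0"
      and E1: "\<And>i p j r. E i (p + s * s') j r = E i p j r"
      and E2: "\<And>i p j r. E i p j (r + s * s') = E i p j r"
      and dimE: "poly_vs.dim (poly_vs.span (range (\<lambda>(i, p, j, r). E i p j r))) = n * (s * s') * (t * (s * s'))"
      and lift: "\<And>F. \<exists>f. Vector_Spaces.linear smult smult f \<and>
        (\<forall>i<n. \<forall>p<s * s'. \<forall>j<t. \<forall>r<s * s'. f (E i p j r) = F i p j r)"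
    using exists_tensor_space[OF N_pos, of n t] by blast
  let ?N = "s * s'"
  have Emod: "E i (p mod ?N) j (r mod ?N) = E i p j r" for i p j r
  proof -
    have "E i (p mod ?N) j (r mod ?N) = E i (p mod ?N + ?N * (p div ?N)) j (r mod ?N)"
      by (rule periodic_add_mult[where f = "\<lambda>p. E i p j (r mod ?N)", symmetric]) (rule E1)
    also have "\<dots> = E i p j (r mod ?N)" by (simp only: mod_mult_div_eq)
    also have "\<dots> = E i p j (r mod ?N + ?N * (r div ?N))"
      by (rule periodic_add_mult[where f = "\<lambda>r. E i p j r", symmetric]) (rule E2)
    finally show ?thesis by (simp only: mod_mult_div_eq)
  qed
  have E_mod1: "E i (p mod ?N) j r = E i p j r" for i p j r
    using Emod[of i "p mod ?N" j r] Emod[of i p j r] by simp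
  have E_mod2: "E i p j (r mod ?N) = E i p j r" for i p j r
    using Emod[of i p j "r mod ?N"] Emod[of i p j r] by simp
  have E_Suc1: "E i (Suc (p mod ?N)) j r = E i (Suc p) j r" for i p j r
    using E_mod1[of i "Suc (p mod ?N)" j r] E_mod1[of i "Suc p" j r] by (simp only: mod_Suc_eq)
  have E_Suc2: "E i p j (Suc (r mod ?N)) = E i p j (Suc r)" for i p j r
    using E_mod2[of i p j "Suc (r mod ?N)"] E_mod2[of i p j "Suc r"] by (simp only: mod_Suc_eq)
  have mod_s: "p mod ?N mod s = p mod s" for p by (simp add: mod_mod_cancel)
  have chi_mod: "chi g ^ (k mod ?N) = chi g ^ k" if "g \<in> carrier G" for g k
  proof -
    have "chi g ^ k = chi g ^ (k mod ?N + ?N * (k div ?N))" by simp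
    then show ?thesis using chi_root[OF that] by (simp only: power_add power_mult power_one mult_1_right)
  qed
  \<comment> \<open>A linear map may be prescribed at all indices, not just at representatives, if
    its values respect the periods and the zeros of E.\<close>
  have lift': "\<exists>f. Vector_Spaces.linear smult smult f \<and> (\<forall>i p j r. f (E i p j r) = F i p j r)"
    if F0: "\<And>i p j r. i \<ge> n \<or> j \<ge> t \<Longrightarrow> F i p j r = 0"
      and Fmod: "\<And>i p j r. F i (p mod ?N) j (r mod ?N) = F i p j r" for F :: "nat \<Rightarrow> nat \<Rightarrow> nat \<Rightarrow> nat \<Rightarrow> 'k poly"
  proof -
    obtain f where f: "Vector_Spaces.linear smult smult f"
      "\<And>i p j r. i < n \<Longrightarrow> p < ?N \<Longrightarrow> j < t \<Longrightarrow> r < ?N \<Longrightarrow> f (E i p j r) = F i p j r"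
      using lift[of F] by blast
    have "f (E i p j r) = F i p j r" for i p j r
    proof (cases "i < n \<and> j < t")
      case True
      then have "f (E i (p mod ?N) j (r mod ?N)) = F i (p mod ?N) j (r mod ?N)"
        using N_pos by (intro f(2)) auto
      then show ?thesis by (simp only: Emod Fmod)
    next
      case False
      then show ?thesis using E0 F0 f(1)
        by (simp add: not_less module_hom.zero Vector_Spaces.linear_iff_module_hom)
    qed
    then show ?thesis using f(1) by blast
  qed
  have "\<exists>f. Vector_Spaces.linear smult smult f \<and> (\<forall>i p j r. f (E i p j r) = (if p mod s = s - 1
      then smult theta (E i (Suc p) j r + E (Suc i) (Suc p) j r) else E i (Suc p) j r))"
    by (rule lift') (auto simp: E0 mod_s E_mod2 E_Suc1)
  then obtain x1 where x1: "Vector_Spaces.linear smult smult x1"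
    "\<And>i p j r. x1 (E i p j r) = (if p mod s = s - 1
      then smult theta (E i (Suc p) j r + E (Suc i) (Suc p) j r) else E i (Suc p) j r)"
    by blast
  have "\<exists>f. Vector_Spaces.linear smult smult f \<and> (\<forall>i p j r. f (E i p j r) = (if r mod s = s - 1
      then smult eta (E i p j (Suc r) + E i p (Suc j) (Suc r)) else E i p j (Suc r)))"
    by (rule lift') (auto simp: E0 mod_s E_mod1 E_Suc2)
  then obtain x2 where x2: "Vector_Spaces.linear smult smult x2"
    "\<And>i p j r. x2 (E i p j r) = (if r mod s = s - 1
      then smult eta (E i p j (Suc r) + E i p (Suc j) (Suc r)) else E i p j (Suc r))"
    by blast
  have "\<exists>f. Vector_Spaces.linear smult smult f \<and> (\<forall>i p j r. f (E i p j r) = smult (chi a ^ r * lam a) (E i p j r))"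
    by (rule lift') (auto simp: E0 Emod chi_mod[OF a_in])
  then obtain a2 where a2: "Vector_Spaces.linear smult smult a2"
    "\<And>i p j r. a2 (E i p j r) = smult (chi a ^ r * lam a) (E i p j r)"
    by blast
  \<comment> \<open>Outside \<open>carrier G\<close> any linear map will do as a default;
    \<open>a2\<close> is at hand.\<close>
  have "\<exists>f. Vector_Spaces.linear smult smult f \<and> (g \<in> carrier G \<longrightarrow>
      (\<forall>i p j r. f (E i p j r) = smult (chi g ^ (p + r) * (sigma g * lam g)) (E i p j r)))" for g
  proof (cases "g \<in> carrier G")
    case True
    have "\<exists>f. Vector_Spaces.linear smult smult f \<and>
        (\<forall>i p j r. f (E i p j r) = smult (chi g ^ (p + r) * (sigma g * lam g)) (E i p j r))"
      by (rule lift') (auto simp: E0 Emod power_add chi_mod[OF True])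
    then show ?thesis by blast
  next
    case False
    then show ?thesis using a2(1) by blast
  qed
  then obtain act where act: "\<And>g. Vector_Spaces.linear smult smult (act g)"
    "\<And>g i p j r. g \<in> carrier G \<Longrightarrow> act g (E i p j r) = smult (chi g ^ (p + r) * (sigma g * lam g)) (E i p j r)"
    by metis
  interpret tm: tensor_model smult G a chi sigma lam s s' n t xi theta eta E x1 x2 a2 act
    by (intro tensor_model.intro tensor_model_axioms.intro poly_vs.vspace_axioms)
       (fact a_in q chi_root xi s_pos s'_pos lam_nz theta_nz eta_nz x1 x2 a2 act E0 E1 E2)+
  have dimW: "poly_vs.dim tm.W = n * (s * s') * (t * (s * s'))" using dimE by (simp add: tm.W_def)
  have alphaj: "alphaj j = tm.kappa (j - 1) ^ s'" for j by (simp add: alphaj_def tm.kappa_def)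
  have alphaj_0: "alphaj j = 0 \<longleftrightarrow> tm.kappa (j - 1) = 0" for j using s'_pos by (simp add: alphaj)
  \<comment> \<open>Hence the criterion asks whether - theta lam(a)^s / eta is an s'-th root of
    unity. These roots are the powers of xi, so it vanishes exactly if some
    \<open>tm.kappa k\<close> does.\<close>
  have crit: "beta + (-1) ^ (s' + 1) * alpha * lam a ^ sbar = eta ^ s' - (- (theta * lam a ^ s)) ^ s'"
    unfolding theta[symmetric] eta[symmetric] sbar_eq
    by (simp add: power_mult power_mult_distrib power_minus[of "theta * lam a ^ s"])
  have kappa_0: "tm.kappa k = 0 \<longleftrightarrow> xi ^ k = - (theta * lam a ^ s) / eta" for k
    unfolding tm.kappa_def using eta_nz by (auto simp: field_simps eq_neg_iff_add_eq_0)
  have T: "T = htensor a (Vmod2 chi (s * s') n sigma (theta ^ s')) (Vmod2 chi (s * s') t lam (eta ^ s'))"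
    by (simp add: T_def theta eta sbar_eq)
  have nt: "n > 0" "t > 0" using n_pos t_pos by auto
  have inj: "inj_on (\<lambda>i. xi ^ i) {..<s'}"
    using power_inj_on_primitive_root xi(2) xi_nz by blast
  have uniq: "k = k'" if "tm.kappa k = 0" "tm.kappa k' = 0" "k < s'" "k' < s'" for k k'
    using inj_onD[OF inj, of k k'] that unfolding kappa_0 by simp
  have case1: "hiso G T (hdsums (concat (map (\<lambda>i. concat (map (\<lambda>j.
      replicate s (Vmod2 chi sbar (d i) sl (alphaj j))) [1..<s'+1])) [1..<min n t + 1])))"
    if ne: "beta + (-1) ^ (s' + 1) * alpha * lam a ^ sbar \<noteq> 0"
  proof -
    have "tm.kappa k \<noteq> 0" for k
    proof
      assume "tm.kappa k = 0"
      then have "eta * xi ^ k = - (theta * lam a ^ s)" unfolding tm.kappa_def by (simp add: eq_neg_iff_add_eq_0 add.commute)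
      then have "(eta * xi ^ k) ^ s' = (- (theta * lam a ^ s)) ^ s'" by simp
      moreover have "(xi ^ k) ^ s' = 1" using xi(1) by (metis mult.commute power_mult power_one)
      ultimately show False using ne crit by (simp add: power_mult_distrib)
    qed
    then show ?thesis using tm.tensor_hiso_invertible[OF dimW nt]
      unfolding T alphaj d_def sl_def sbar_eq by blast
  qed
  have ex: "\<exists>j0. 1 \<le> j0 \<and> j0 \<le> s' \<and> alphaj j0 = 0"
    if eq: "beta + (-1) ^ (s' + 1) * alpha * lam a ^ sbar = 0"
  proof -
    have "(- (theta * lam a ^ s) / eta) ^ s' = 1"
      unfolding power_divide using eq crit eta_nz theta_nz lam_nz by simp
    then obtain k where "k < s'" "- (theta * lam a ^ s) / eta = xi ^ k"
      using root_of_unity_is_power[OF xi s'_pos] by metis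
    then show ?thesis by (intro exI[of _ "Suc k"]) (simp add: alphaj_0 kappa_0)
  qed
  have uniq': "j = j'" if "1 \<le> j" "j \<le> s'" "alphaj j = 0" "1 \<le> j'" "j' \<le> s'" "alphaj j' = 0" for j j'
    using uniq[of "j - 1" "j' - 1"] that by (simp add: alphaj_0) arith
  have case2: "hiso G T (hdsum
      (hdsums (concat (map (\<lambda>i. concat (map (\<lambda>j.
         replicate s (Vmod2 chi sbar (d i) sl (alphaj j))) (filter (\<lambda>j. j \<noteq> j0) [1..<s'+1])))
         [1..<min n t + 1])))
      (hdsums (concat (map (\<lambda>i. map (\<lambda>j.
         Vmod chi (d i * s) (\<lambda>g. chi g ^ j * sl g)) [0..<sbar])
         [1..<min n t + 1]))))" if "1 \<le> j0" "j0 \<le> s'" "alphaj j0 = 0" for j0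
  proof -
    have k0: "tm.kappa (j0 - 1) = 0" using that(3) by (simp add: alphaj_0)
    have "k = j0 - 1" if "k < s'" "tm.kappa k = 0" for k
      using uniq[OF that(2) k0 that(1)] \<open>1 \<le> j0\<close> \<open>j0 \<le> s'\<close> by simp
    then show ?thesis using tm.tensor_hiso_nilpotent[OF dimW nt that(1,2) k0]
      unfolding T alphaj d_def sl_def sbar_eq by blast
  qed
  show ?thesis using case1 ex uniq' case2 by blast
qed

end
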